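(* Let $m,n\ge2$, $m\ne n$, $l\ge1$, $0\le p\le n$, $t,\lambda\in\mathbb{C}$, and let $M$ be a right $\mathbb{H}_{t,\lambda}(S_l)$-module. Then an action of $Y^{(p)}_\lambda(\mathfrak{sl}(m|n))$ on $M\otimes_{\mathbb{C}[S_l]}\mathbb{C}(p|m|n-p)^{\otimes l}$ is defined by the following formulas, for $1\le i\le m+n-1$, $\mathbf{m}\in M$, $\mathbf{v}\in\mathbb{C}(p|m|n-p)^{\otimes l}$ (write $s_i=s_i^{(p)}$): $$H_{i,0}(\mathbf{m}\otimes\mathbf{v})=\mathbf{m}\otimes((-1)^{s_i}E_{i,i}-(-1)^{s_{i+1}}E_{i+1,i+1})\mathbf{v},$$ $$X^+_{i,0}(\mathbf{m}\otimes\mathbf{v})=\mathbf{m}\otimes E_{i,i+1}\mathbf{v},\qquad X^-_{i,0}(\mathbf{m}\otimes\mathbf{v})=(-1)^{s_i}\mathbf{m}\otimes E_{i+1,i}\mathbf{v},$$ $$J(h_i)(\mathbf{m}\otimes\mathbf{v})=\sum_{k=1}^l\mathbf{m}\,\mathfrak{y}_k\otimes((-1)^{s_i}E^{(k)}_{i,i}-(-1)^{s_{i+1}}E^{(k)}_{i+1,i+1})\mathbf{v},$$ $$J(x_i^+)(\mathbf{m}\otimes\mathbf{v})=\sum_{k=1}^l\mathbf{m}\,\mathfrak{y}_k\otimes E^{(k)}_{i,i+1}\mathbf{v},\qquad J(x_i^-)(\mathbf{m}\otimes\mathbf{v})=(-1)^{s_i}\sum_{k=1}^l\mathbf{m}\,\mathfrak{y}_k\otimes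 E^{(k)}_{i+1,i}\mathbf{v}.$$
   Context: For $0\le p\le n$ let $s^{(p)}_i=1$ for $1\le i\le p$, $s^{(p)}_i=0$ for $p+1\le i\le p+m$, $s^{(p)}_i=1$ for $p+m+1\le i\le m+n$; write $s_i=s^{(p)}_i$. $\mathbb{C}(p|m|n-p)=\bigoplus_{i=1}^{m+n}\mathbb{C}e_i$ with $e_i$ of parity $s_i$. $\mathfrak{gl}(p|m|n-p)$ has basis the matrix units $E_{i,j}$, of parity $s_i+s_j$, with the supercommutator, and $\mathfrak{sl}(p|m|n-p)$ is its subalgebra of matrices $(x_{i,j})$ with $\sum_i(-1)^{s_i}x_{i,i}=0$. On $\mathbb{C}(p|m|n-p)^{\otimes l}$: $E_{a,b}^{(k)}(v_1\otimes\cdots\otimes v_l)=(-1)^{(s_a+s_b)\sum_{j<k}|v_j|}v_1\otimes\cdots\otimes E_{a,b}v_k\otimes\cdots\otimes v_l$, $E_{a,b}$ acts by $\sum_kE^{(k)}_{a,b}$, and $S_l$ acts on the left by $\sigma_{i,i+1}(v_1\otimes\cdots\otimes v_l)=(-1)^{|v_i||v_{i+1}|}v_1\otimes\cdots\otimes v_{i+1}\otimes v_i\otimes\cdots\otimes v_l$. $\sigma_{i,j}$ is the transposition of $i,j$; $M$ is regarded as purely even. $[\cdot,\cdot]$ is the supercommutator, $\{x,y\}=xy+yx$. For $1\le i,j\le m+n-1$: $a^{(p)}_{i,i}=(-1)^{s_i}+(-1)^{s_{i+1}}$, $a^{(p)}_{i,i+1}=-(-1)^{s_{i+1}}$, $a^{(p)}_{i,i-1}=-(-1)^{s_i}$,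 and $0$ otherwise. $Y^{(p)}_\lambda(\mathfrak{sl}(m|n))$ is the associative superalgebra generated by $X^\pm_{i,r},H_{i,r}$ ($1\le i\le m+n-1$, $r=0,1$), where $X^\pm_{i,r}$ is odd if $s_i\ne s_{i+1}$ and all other generators are even, with relations (all indices in $\{1,\dots,m+n-1\}$, $\widetilde H_{i,1}=H_{i,1}-\frac\lambda2H_{i,0}^2$): $[H_{i,r},H_{j,s}]=0$; $[X^+_{i,0},X^-_{j,0}]=\delta_{i,j}H_{i,0}$; $[X^+_{i,1},X^-_{j,0}]=\delta_{i,j}H_{i,1}=[X^+_{i,0},X^-_{j,1}]$; $[H_{i,0},X^\pm_{j,r}]=\pm a^{(p)}_{i,j}X^\pm_{j,r}$; $[\widetilde H_{i,1},X^\pm_{j,0}]=\pm a^{(p)}_{i,j}X^\pm_{j,1}$; $[X^\pm_{i,1},X^\pm_{j,0}]-[X^\pm_{i,0},X^\pm_{j,1}]=\pm a^{(p)}_{i,j}\frac\lambda2\{X^\pm_{i,0},X^\pm_{j,0}\}$; $(\mathrm{ad}X^\pm_{i,0})^{1+|a^{(p)}_{i,j}|}(X^\pm_{j,0})=0$ for $i\neq j$; $[X^\pm_{i,0},X^\pm_{i,0}]=0$ if $s_i\ne s_{i+1}$; $[[X^\pm_{i-1,0},X^\pm_{i,0}],[X^\pm_{i,0},X^\pm_{i+1,0}]]=0$ if $s_i\neq s_{i+1}$ (and $2\le i\le m+n-2$). There is a homomorphism $U(\mathfrak{sl}(p|m|n-p))\to Y^{(p)}_\lambda(\mathfrak{sl}(m|n))$,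 $E_{i,i+1}\mapsto X^+_{i,0}$, $(-1)^{s_i}E_{i+1,i}\mapsto X^-_{i,0}$, $(-1)^{s_i}E_{i,i}-(-1)^{s_{i+1}}E_{i+1,i+1}\mapsto H_{i,0}$; images are denoted by the same symbols. Put $i^{(p)}=\sum_{j=i+2}^{m+n}(-1)^{s_j}$ and $$\vartheta_i=-\tfrac{(i-1)^{(p)}}{2}H_{i,0}+\tfrac{(-1)^{s_i}}{2}\sum_{k\ne i}(-1)^{s_k}\mathrm{sign}(k-i)E_{i,k}E_{k,i}-\tfrac{(-1)^{s_{i+1}}}{2}\sum_{k\ne i+1}(-1)^{s_k}\mathrm{sign}(k-i-1)E_{i+1,k}E_{k,i+1},$$ $$\varpi_i^+=-\tfrac{i^{(p)}}{2}X^+_{i,0}+\tfrac12\sum_{k\ne i,i+1}(-1)^{s_k}\mathrm{sign}(k-i)E_{i,k}E_{k,i+1}-\tfrac12H_{i,0}X^+_{i,0},$$ $$\varpi_i^-=-\tfrac{i^{(p)}}{2}X^-_{i,0}+\tfrac{(-1)^{s_i}}{2}\sum_{k\ne i,i+1}(-1)^{s_k}\mathrm{sign}(k-i)E_{i+1,k}E_{k,i}-\tfrac12X^-_{i,0}H_{i,0},$$ $J(h_i)=\widetilde H_{i,1}+\lambda\vartheta_i$, $J(x_i^\pm)=X^\pm_{i,1}+\lambda\varpi_i^\pm$; so prescribing the action of $H_{i,0},X^\pm_{i,0},J(h_i),J(x_i^\pm)$ prescribes that of all generators. For $t,c\in\mathbb{C}$, the rational Cherednik algebra $\mathsf{H}_{t,c}(S_l)$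 is generated by $\mathbb{C}[S_l]$, commuting $\mathsf{x}_1,\dots,\mathsf{x}_l$ and commuting $\mathsf{y}_1,\dots,\mathsf{y}_l$ with $\sigma\mathsf{x}_i\sigma^{-1}=\mathsf{x}_{\sigma(i)}$, $\sigma\mathsf{y}_i\sigma^{-1}=\mathsf{y}_{\sigma(i)}$, $[\mathsf{y}_j,\mathsf{x}_i]=-c\sigma_{i,j}$ for $i\ne j$, $[\mathsf{y}_i,\mathsf{x}_i]=t+c\sum_{k\ne i}\sigma_{k,i}$. The degenerate double affine Hecke algebra $\mathbb{H}_{t,c}(S_l)$ is the localization of $\mathsf{H}_{t,c}(S_l)$ at $\mathsf{x}_1\cdots\mathsf{x}_l$ (adjoining $\mathsf{x}_1^{-1},\dots,\mathsf{x}_l^{-1}$). Put $\mathcal{U}_i=\frac t2+\mathsf{x}_i\mathsf{y}_i+c\sum_{j<i}\sigma_{i,j}$ and $\mathfrak{y}_i=\mathcal{U}_i+\frac c2\sum_{j\ne i}\mathrm{sign}(j-i)\sigma_{i,j}$ (with $c=\lambda$ in the claim). *)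

theory Defs
  imports
    "HOL-Algebra.Algebra"
    "HOL-Algebra.Algebraic_Closure_Type"
    "HOL-Library.Poly_Mapping"
    "HOL-Combinatorics.Permutations"
    Complex_Main
begin

section \<open>Complex vector spaces and algebras, quotients, tensor products\<close>

text \<open>
  Vector spaces and associative algebras over the complex numbers are both HOL-Algebra records of
  type \<open>(complex, 'a) module\<close>. For a mere vector space the multiplicative fields are
  not used (as in the locale \<^locale>\<open>module\<close>).
\<close>

abbreviation complex_ring :: "complex ring" where
  "complex_ring \<equiv> ring_of_type_algebra"

definition cscale :: "complex \<Rightarrow> ('a \<Rightarrow>\<^sub>0 complex) \<Rightarrow> ('a \<Rightarrow>\<^sub>0 complex)" where
  "cscale c f = Poly_Mapping.map ((*) c) f"

definition free_space :: "'a set \<Rightarrow> (complex, 'a \<Rightarrow>\<^sub>0 complex) module" where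
  "free_space S = \<lparr>carrier = {f. Poly_Mapping.keys f \<subseteq> S},
     monoid.mult = undefined, one = undefined, ring.zero = 0, add = (+), module.smult = cscale\<rparr>"

definition lin_ext :: "('a \<Rightarrow> ('b \<Rightarrow>\<^sub>0 complex)) \<Rightarrow> ('a \<Rightarrow>\<^sub>0 complex) \<Rightarrow> ('b \<Rightarrow>\<^sub>0 complex)" where
  "lin_ext f r = (\<Sum>a\<in>Poly_Mapping.keys r. cscale (Poly_Mapping.lookup r a) (f a))"

definition lin_span :: "(complex, 'a) module \<Rightarrow> 'a set \<Rightarrow> 'a set" where
  "lin_span V S = \<Inter> {W. submodule W complex_ring V \<and> S \<subseteq> W}"

text \<open>
  \<^const>\<open>FactRing\<close> equipped with the induced scalar multiplication. It is used both
  for an algebra modulo a two-sided ideal and for a vector space modulo a subspace; in the latter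
  case only the additive fields and the scalar multiplication are meaningful.
\<close>

definition quot_module :: "(complex, 'a) module \<Rightarrow> 'a set \<Rightarrow> (complex, 'a set) module" where
  "quot_module V N =
     ring.extend (V Quot N) (module.fields (\<lambda>c K. \<Union>x\<in>K. N +>\<^bsub>V\<^esub> (c \<odot>\<^bsub>V\<^esub> x)))"

locale left_algebra_module =
  fixes A :: "(complex, 'a) module" and V :: "(complex, 'v) module"
    and act :: "'a \<Rightarrow> 'v \<Rightarrow> 'v"
  assumes vector_space: "module complex_ring V"
    and act_closed: "\<lbrakk>a \<in> carrier A; v \<in> carrier V\<rbrakk> \<Longrightarrow> act a v \<in> carrier V"
    and act_add_right: "\<lbrakk>a \<in> carrier A; v \<in> carrier V; w \<in> carrier V\<rbrakk>
      \<Longrightarrow> act a (v \<oplus>\<^bsub>V\<^esub> w) = act a v \<oplus>\<^bsub>V\<^esub> act a w"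
    and act_smult_right: "\<lbrakk>a \<in> carrier A; v \<in> carrier V\<rbrakk>
      \<Longrightarrow> act a (c \<odot>\<^bsub>V\<^esub> v) = c \<odot>\<^bsub>V\<^esub> act a v"
    and act_add_left: "\<lbrakk>a \<in> carrier A; b \<in> carrier A; v \<in> carrier V\<rbrakk>
      \<Longrightarrow> act (a \<oplus>\<^bsub>A\<^esub> b) v = act a v \<oplus>\<^bsub>V\<^esub> act b v"
    and act_smult_left: "\<lbrakk>a \<in> carrier A; v \<in> carrier V\<rbrakk>
      \<Longrightarrow> act (c \<odot>\<^bsub>A\<^esub> a) v = c \<odot>\<^bsub>V\<^esub> act a v"
    and act_mult: "\<lbrakk>a \<in> carrier A; b \<in> carrier A; v \<in> carrier V\<rbrakk>
      \<Longrightarrow> act (a \<otimes>\<^bsub>A\<^esub> b) v = act a (act b v)"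
    and act_one: "v \<in> carrier V \<Longrightarrow> act \<one>\<^bsub>A\<^esub> v = v"

locale right_algebra_module =
  fixes A :: "(complex, 'a) module" and M :: "(complex, 'm) module"
    and act :: "'m \<Rightarrow> 'a \<Rightarrow> 'm"
  assumes vector_space: "module complex_ring M"
    and act_closed: "\<lbrakk>x \<in> carrier M; a \<in> carrier A\<rbrakk> \<Longrightarrow> act x a \<in> carrier M"
    and act_add_left: "\<lbrakk>x \<in> carrier M; y \<in> carrier M; a \<in> carrier A\<rbrakk>
      \<Longrightarrow> act (x \<oplus>\<^bsub>M\<^esub> y) a = act x a \<oplus>\<^bsub>M\<^esub> act y a"
    and act_smult_left: "\<lbrakk>x \<in> carrier M; a \<in> carrier A\<rbrakk>
      \<Longrightarrow> act (c \<odot>\<^bsub>M\<^esub> x) a = c \<odot>\<^bsub>M\<^esub> act x a"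
    and act_add_right: "\<lbrakk>x \<in> carrier M; a \<in> carrier A; b \<in> carrier A\<rbrakk>
      \<Longrightarrow> act x (a \<oplus>\<^bsub>A\<^esub> b) = act x a \<oplus>\<^bsub>M\<^esub> act x b"
    and act_smult_right: "\<lbrakk>x \<in> carrier M; a \<in> carrier A\<rbrakk>
      \<Longrightarrow> act x (c \<odot>\<^bsub>A\<^esub> a) = c \<odot>\<^bsub>M\<^esub> act x a"
    and act_mult: "\<lbrakk>x \<in> carrier M; a \<in> carrier A; b \<in> carrier A\<rbrakk>
      \<Longrightarrow> act x (a \<otimes>\<^bsub>A\<^esub> b) = act (act x a) b"
    and act_one: "x \<in> carrier M \<Longrightarrow> act x \<one>\<^bsub>A\<^esub> = x"

text \<open>
  Modules over superalgebras: \<open>grA a\<close> and \<open>grV b\<close> are the homogeneous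
  components of parity \<open>a, b \<in> {0, 1}\<close>.
\<close>

locale left_superalgebra_module = left_algebra_module A V act
  for A :: "(complex, 'a) module" and grA :: "nat \<Rightarrow> 'a set"
    and V :: "(complex, 'v) module" and grV :: "nat \<Rightarrow> 'v set"
    and act :: "'a \<Rightarrow> 'v \<Rightarrow> 'v" +
  assumes act_parity: "\<lbrakk>a < 2; b < 2; x \<in> grA a; v \<in> grV b\<rbrakk> \<Longrightarrow> act x v \<in> grV ((a + b) mod 2)"

text \<open>
  The tensor product of a right module \<open>M\<close> and a left module \<open>N\<close> over an
  algebra with underlying set \<open>R\<close>.
\<close>

inductive_set tensor_rel ::
    "'r set \<Rightarrow> (complex, 'm) module \<Rightarrow> ('m \<Rightarrow> 'r \<Rightarrow> 'm) \<Rightarrow> (complex, 'n) module \<Rightarrow> ('r \<Rightarrow> 'n \<Rightarrow> 'n)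
      \<Rightarrow> (('m \<times> 'n) \<Rightarrow>\<^sub>0 complex) set"
  for R M ract N lact where
  add_left: "\<lbrakk>x \<in> carrier M; y \<in> carrier M; v \<in> carrier N\<rbrakk> \<Longrightarrow>
     Poly_Mapping.single (x \<oplus>\<^bsub>M\<^esub> y, v) 1 - Poly_Mapping.single (x, v) 1 - Poly_Mapping.single (y, v) 1
       \<in> tensor_rel R M ract N lact"
| add_right: "\<lbrakk>x \<in> carrier M; v \<in> carrier N; w \<in> carrier N\<rbrakk> \<Longrightarrow>
     Poly_Mapping.single (x, v \<oplus>\<^bsub>N\<^esub> w) 1 - Poly_Mapping.single (x, v) 1 - Poly_Mapping.single (x, w) 1
       \<in> tensor_rel R M ract N lact"
| smult_left: "\<lbrakk>x \<in> carrier M; v \<in> carrier N\<rbrakk> \<Longrightarrow>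
     Poly_Mapping.single (c \<odot>\<^bsub>M\<^esub> x, v) 1 - Poly_Mapping.single (x, v) c \<in> tensor_rel R M ract N lact"
| smult_right: "\<lbrakk>x \<in> carrier M; v \<in> carrier N\<rbrakk> \<Longrightarrow>
     Poly_Mapping.single (x, c \<odot>\<^bsub>N\<^esub> v) 1 - Poly_Mapping.single (x, v) c \<in> tensor_rel R M ract N lact"
| balanced: "\<lbrakk>x \<in> carrier M; r \<in> R; v \<in> carrier N\<rbrakk> \<Longrightarrow>
     Poly_Mapping.single (ract x r, v) 1 - Poly_Mapping.single (x, lact r v) 1
       \<in> tensor_rel R M ract N lact"

definition tensor_kernel ::
    "'r set \<Rightarrow> (complex, 'm) module \<Rightarrow> ('m \<Rightarrow> 'r \<Rightarrow> 'm) \<Rightarrow> (complex, 'n) module \<Rightarrow> ('r \<Rightarrow> 'n \<Rightarrow> 'n)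
      \<Rightarrow> (('m \<times> 'n) \<Rightarrow>\<^sub>0 complex) set" where
  "tensor_kernel R M ract N lact =
     lin_span (free_space (carrier M \<times> carrier N)) (tensor_rel R M ract N lact)"

definition tensor_space ::
    "'r set \<Rightarrow> (complex, 'm) module \<Rightarrow> ('m \<Rightarrow> 'r \<Rightarrow> 'm) \<Rightarrow> (complex, 'n) module \<Rightarrow> ('r \<Rightarrow> 'n \<Rightarrow> 'n)
      \<Rightarrow> (complex, (('m \<times> 'n) \<Rightarrow>\<^sub>0 complex) set) module" where
  "tensor_space R M ract N lact =
     quot_module (free_space (carrier M \<times> carrier N)) (tensor_kernel R M ract N lact)"

definition pure_tensor ::
    "'r set \<Rightarrow> (complex, 'm) module \<Rightarrow> ('m \<Rightarrow> 'r \<Rightarrow> 'm) \<Rightarrow> (complex, 'n) module \<Rightarrow> ('r \<Rightarrow> 'n \<Rightarrow> 'n)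
      \<Rightarrow> 'm \<Rightarrow> 'n \<Rightarrow> (('m \<times> 'n) \<Rightarrow>\<^sub>0 complex) set" where
  "pure_tensor R M ract N lact x v =
     tensor_kernel R M ract N lact +>\<^bsub>free_space (carrier M \<times> carrier N)\<^esub> Poly_Mapping.single (x, v) 1"


section \<open>Algebras given by generators and relations\<close>

text \<open>
  The free algebra is the monoid algebra of the free monoid; \<^typ>\<open>'a \<Rightarrow>\<^sub>0 complex\<close>
  carries the convolution product for an additively written monoid \<open>'a\<close>.
\<close>

datatype 'g free_word = Free_Word (letters: "'g list")

instantiation free_word :: (type) monoid_add
begin

definition zero_free_word :: "'a free_word" where
  "0 = Free_Word []"

definition plus_free_word :: "'a free_word \<Rightarrow> 'a free_word \<Rightarrow> 'a free_word" where
  "u + v = Free_Word (letters u @ letters v)"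

instance
  by standard (simp_all add: zero_free_word_def plus_free_word_def)

end

type_synonym 'g free_alg = "'g free_word \<Rightarrow>\<^sub>0 complex"

definition gen :: "'g \<Rightarrow> 'g free_alg" where
  "gen g = Poly_Mapping.single (Free_Word [g]) 1"

definition free_algebra :: "'g set \<Rightarrow> (complex, 'g free_alg) module" where
  "free_algebra G = \<lparr>carrier = {f. \<forall>w\<in>Poly_Mapping.keys f. set (letters w) \<subseteq> G},
     monoid.mult = (*), one = 1, ring.zero = 0, add = (+), module.smult = cscale\<rparr>"

definition presented_algebra :: "'g set \<Rightarrow> 'g free_alg set \<Rightarrow> (complex, 'g free_alg set) module" where
  "presented_algebra G R = quot_module (free_algebra G) (genideal (free_algebra G) R)"

definition presented_class :: "'g set \<Rightarrow> 'g free_alg set \<Rightarrow> 'g free_alg \<Rightarrow> 'g free_alg set" where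
  "presented_class G R f = genideal (free_algebra G) R +>\<^bsub>free_algebra G\<^esub> f"

text \<open>Gradings by parity, determined by the parity \<open>\<pi>\<close> of the generators.\<close>

definition word_parity :: "('g \<Rightarrow> nat) \<Rightarrow> 'g free_word \<Rightarrow> nat" where
  "word_parity \<pi> w = sum_list (map \<pi> (letters w)) mod 2"

definition homogeneous :: "('g \<Rightarrow> nat) \<Rightarrow> nat \<Rightarrow> 'g free_alg set" where
  "homogeneous \<pi> a = {f. \<forall>w\<in>Poly_Mapping.keys f. word_parity \<pi> w = a}"

text \<open>
  The supercommutator is the bilinear extension of \<open>uv - (-1)^(|u||v|) vu\<close> on words
  (see the lemma \<open>supercomm_homogeneous\<close> below).
\<close>

definition supercomm :: "('g \<Rightarrow> nat) \<Rightarrow> 'g free_alg \<Rightarrow> 'g free_alg \<Rightarrow> 'g free_alg" where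
  "supercomm \<pi> x y = x * y -
     (\<Sum>u\<in>Poly_Mapping.keys x. \<Sum>v\<in>Poly_Mapping.keys y. Poly_Mapping.single (v + u)
        ((-1) ^ (word_parity \<pi> u * word_parity \<pi> v)
          * Poly_Mapping.lookup x u * Poly_Mapping.lookup y v))"

definition anticomm :: "'g free_alg \<Rightarrow> 'g free_alg \<Rightarrow> 'g free_alg" where
  "anticomm x y = x * y + y * x"


section \<open>The Yangian\<close>

text \<open>\<open>par m p i\<close> is the parity of the \<open>i\<close>-th basis vector (indices start at 1).\<close>

definition par :: "nat \<Rightarrow> nat \<Rightarrow> nat \<Rightarrow> nat" where
  "par m p i = (if p < i \<and> i \<le> p + m then 0 else 1)"

definition psgn :: "nat \<Rightarrow> nat \<Rightarrow> nat \<Rightarrow> 'a::ring_1" where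
  "psgn m p i = (-1) ^ par m p i"

definition cartan :: "nat \<Rightarrow> nat \<Rightarrow> nat \<Rightarrow> nat \<Rightarrow> int" where
  "cartan m p i j =
     (if j = i then psgn m p i + psgn m p (i + 1)
      else if j = i + 1 then - psgn m p (i + 1)
      else if i = j + 1 then - psgn m p i
      else 0)"

datatype pm = Plus | Minus

fun pm_val :: "pm \<Rightarrow> complex" where
  "pm_val Plus = 1"
| "pm_val Minus = -1"

datatype ygen = YX pm nat nat | YH nat nat

definition ygens :: "nat \<Rightarrow> nat \<Rightarrow> ygen set" where
  "ygens m n = {YX e i r | e i r. i \<in> {1..m + n - 1} \<and> r \<in> {0, 1}}
     \<union> {YH i r | i r. i \<in> {1..m + n - 1} \<and> r \<in> {0, 1}}"

fun ygen_parity :: "nat \<Rightarrow> nat \<Rightarrow> ygen \<Rightarrow> nat" where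
  "ygen_parity m p (YX e i r) = (if par m p i \<noteq> par m p (i + 1) then 1 else 0)"
| "ygen_parity m p (YH i r) = 0"

abbreviation yX :: "pm \<Rightarrow> nat \<Rightarrow> nat \<Rightarrow> ygen free_alg" where
  "yX e i r \<equiv> gen (YX e i r)"

abbreviation yH :: "nat \<Rightarrow> nat \<Rightarrow> ygen free_alg" where
  "yH i r \<equiv> gen (YH i r)"

definition yH_tilde :: "complex \<Rightarrow> nat \<Rightarrow> ygen free_alg" where
  "yH_tilde lam i = yH i 1 - cscale (lam / 2) (yH i 0 * yH i 0)"

abbreviation ybr :: "nat \<Rightarrow> nat \<Rightarrow> ygen free_alg \<Rightarrow> ygen free_alg \<Rightarrow> ygen free_alg" where
  "ybr m p \<equiv> supercomm (ygen_parity m p)"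

text \<open>A relation \<open>a = b\<close> is represented by the element \<open>a - b\<close>.\<close>

inductive_set yangian_rel :: "nat \<Rightarrow> nat \<Rightarrow> nat \<Rightarrow> complex \<Rightarrow> ygen free_alg set"
  for m n p lam where
  HH: "\<lbrakk>i \<in> {1..m + n - 1}; j \<in> {1..m + n - 1}; r \<in> {0, 1}; s \<in> {0, 1}\<rbrakk> \<Longrightarrow>
     ybr m p (yH i r) (yH j s) \<in> yangian_rel m n p lam"
| XX00: "\<lbrakk>i \<in> {1..m + n - 1}; j \<in> {1..m + n - 1}\<rbrakk> \<Longrightarrow>
     ybr m p (yX Plus i 0) (yX Minus j 0) - (if i = j then yH i 0 else 0) \<in> yangian_rel m n p lam"
| XX10: "\<lbrakk>i \<in> {1..m + n - 1}; j \<in> {1..m + n - 1}\<rbrakk> \<Longrightarrow>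
     ybr m p (yX Plus i 1) (yX Minus j 0) - (if i = j then yH i 1 else 0) \<in> yangian_rel m n p lam"
| XX01: "\<lbrakk>i \<in> {1..m + n - 1}; j \<in> {1..m + n - 1}\<rbrakk> \<Longrightarrow>
     ybr m p (yX Plus i 0) (yX Minus j 1) - (if i = j then yH i 1 else 0) \<in> yangian_rel m n p lam"
| HX0: "\<lbrakk>i \<in> {1..m + n - 1}; j \<in> {1..m + n - 1}; r \<in> {0, 1}\<rbrakk> \<Longrightarrow>
     ybr m p (yH i 0) (yX e j r) - cscale (pm_val e * of_int (cartan m p i j)) (yX e j r)
       \<in> yangian_rel m n p lam"
| HX1: "\<lbrakk>i \<in> {1..m + n - 1}; j \<in> {1..m + n - 1}\<rbrakk> \<Longrightarrow>
     ybr m p (yH_tilde lam i) (yX e j 0) - cscale (pm_val e * of_int (cartan m p i j)) (yX e j 1)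
       \<in> yangian_rel m n p lam"
| XX: "\<lbrakk>i \<in> {1..m + n - 1}; j \<in> {1..m + n - 1}\<rbrakk> \<Longrightarrow>
     ybr m p (yX e i 1) (yX e j 0) - ybr m p (yX e i 0) (yX e j 1)
       - cscale (pm_val e * of_int (cartan m p i j) * (lam / 2)) (anticomm (yX e i 0) (yX e j 0))
       \<in> yangian_rel m n p lam"
| Serre: "\<lbrakk>i \<in> {1..m + n - 1}; j \<in> {1..m + n - 1}; i \<noteq> j\<rbrakk> \<Longrightarrow>
     (ybr m p (yX e i 0) ^^ (1 + nat \<bar>cartan m p i j\<bar>)) (yX e j 0) \<in> yangian_rel m n p lam"
| odd_square: "\<lbrakk>i \<in> {1..m + n - 1}; par m p i \<noteq> par m p (i + 1)\<rbrakk> \<Longrightarrow>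
     ybr m p (yX e i 0) (yX e i 0) \<in> yangian_rel m n p lam"
| odd_Serre: "\<lbrakk>2 \<le> i; i \<le> m + n - 2; par m p i \<noteq> par m p (i + 1)\<rbrakk> \<Longrightarrow>
     ybr m p (ybr m p (yX e (i - 1) 0) (yX e i 0)) (ybr m p (yX e i 0) (yX e (i + 1) 0))
       \<in> yangian_rel m n p lam"

definition yangian :: "nat \<Rightarrow> nat \<Rightarrow> nat \<Rightarrow> complex \<Rightarrow> (complex, ygen free_alg set) module" where
  "yangian m n p lam = presented_algebra (ygens m n) (yangian_rel m n p lam)"

definition yangian_class :: "nat \<Rightarrow> nat \<Rightarrow> nat \<Rightarrow> complex \<Rightarrow> ygen free_alg \<Rightarrow> ygen free_alg set" where
  "yangian_class m n p lam = presented_class (ygens m n) (yangian_rel m n p lam)"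

definition yangian_part :: "nat \<Rightarrow> nat \<Rightarrow> nat \<Rightarrow> complex \<Rightarrow> nat \<Rightarrow> ygen free_alg set set" where
  "yangian_part m n p lam a =
     yangian_class m n p lam ` (carrier (free_algebra (ygens m n)) \<inter> homogeneous (ygen_parity m p) a)"

text \<open>
  Images of the matrix units \<open>E(i,j)\<close>, \<open>i \<noteq> j\<close>, under the homomorphism
  from the enveloping algebra of \<open>sl(p|m|n-p)\<close>. It sends \<open>E(i,i+1)\<close> to
  \<open>X\<^sup>+(i,0)\<close> and \<open>(-1)^s(i) E(i+1,i)\<close> to \<open>X\<^sup>-(i,0)\<close>; the other
  values follow from \<open>E(i,k) = [E(i,j), E(j,k)]\<close> for distinct \<open>i, j, k\<close>
  (see the lemma \<open>yE_unique\<close> below).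
\<close>

fun yE_up :: "nat \<Rightarrow> nat \<Rightarrow> nat \<Rightarrow> nat \<Rightarrow> ygen free_alg" where
  "yE_up m p i 0 = yX Plus i 0"
| "yE_up m p i (Suc d) = ybr m p (yE_up m p i d) (yX Plus (i + d + 1) 0)"

fun yE_down :: "nat \<Rightarrow> nat \<Rightarrow> nat \<Rightarrow> nat \<Rightarrow> ygen free_alg" where
  "yE_down m p i 0 = cscale (psgn m p i) (yX Minus i 0)"
| "yE_down m p i (Suc d) =
     ybr m p (cscale (psgn m p (i + d + 1)) (yX Minus (i + d + 1) 0)) (yE_down m p i d)"

definition yE :: "nat \<Rightarrow> nat \<Rightarrow> nat \<Rightarrow> nat \<Rightarrow> ygen free_alg" where
  "yE m p i j = (if i < j then yE_up m p i (j - i - 1)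
                 else if j < i then yE_down m p j (i - j - 1)
                 else undefined)"

text \<open>\<open>shift m n p i\<close> is the number denoted \<open>i\<^sup>(\<^sup>p\<^sup>)\<close>.\<close>

definition shift :: "nat \<Rightarrow> nat \<Rightarrow> nat \<Rightarrow> nat \<Rightarrow> complex" where
  "shift m n p i = (\<Sum>j = i + 2..m + n. psgn m p j)"

definition nsign :: "nat \<Rightarrow> nat \<Rightarrow> complex" where
  "nsign k i = of_int (sgn (int k - int i))"

definition vartheta :: "nat \<Rightarrow> nat \<Rightarrow> nat \<Rightarrow> nat \<Rightarrow> ygen free_alg" where
  "vartheta m n p i =
     cscale (- shift m n p (i - 1) / 2) (yH i 0)
     + cscale (psgn m p i / 2)
         (\<Sum>k\<in>{1..m + n} - {i}. cscale (psgn m p k * nsign k i) (yE m p i k * yE m p k i))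
     - cscale (psgn m p (i + 1) / 2)
         (\<Sum>k\<in>{1..m + n} - {i + 1}.
            cscale (psgn m p k * nsign k (i + 1)) (yE m p (i + 1) k * yE m p k (i + 1)))"

definition varpi_plus :: "nat \<Rightarrow> nat \<Rightarrow> nat \<Rightarrow> nat \<Rightarrow> ygen free_alg" where
  "varpi_plus m n p i =
     cscale (- shift m n p i / 2) (yX Plus i 0)
     + cscale (1 / 2)
         (\<Sum>k\<in>{1..m + n} - {i, i + 1}.
            cscale (psgn m p k * nsign k i) (yE m p i k * yE m p k (i + 1)))
     - cscale (1 / 2) (yH i 0 * yX Plus i 0)"

definition varpi_minus :: "nat \<Rightarrow> nat \<Rightarrow> nat \<Rightarrow> nat \<Rightarrow> ygen free_alg" where
  "varpi_minus m n p i =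
     cscale (- shift m n p i / 2) (yX Minus i 0)
     + cscale (psgn m p i / 2)
         (\<Sum>k\<in>{1..m + n} - {i, i + 1}.
            cscale (psgn m p k * nsign k i) (yE m p (i + 1) k * yE m p k i))
     - cscale (1 / 2) (yX Minus i 0 * yH i 0)"

definition J_h :: "nat \<Rightarrow> nat \<Rightarrow> nat \<Rightarrow> complex \<Rightarrow> nat \<Rightarrow> ygen free_alg" where
  "J_h m n p lam i = yH_tilde lam i + cscale lam (vartheta m n p i)"

definition J_x_plus :: "nat \<Rightarrow> nat \<Rightarrow> nat \<Rightarrow> complex \<Rightarrow> nat \<Rightarrow> ygen free_alg" where
  "J_x_plus m n p lam i = yX Plus i 1 + cscale lam (varpi_plus m n p i)"

definition J_x_minus :: "nat \<Rightarrow> nat \<Rightarrow> nat \<Rightarrow> complex \<Rightarrow> nat \<Rightarrow> ygen free_alg" where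
  "J_x_minus m n p lam i = yX Minus i 1 + cscale lam (varpi_minus m n p i)"


section \<open>The degenerate double affine Hecke algebra\<close>

text \<open>
  The symmetric group consists of the permutations of \<open>{1..l}\<close>, with
  \<open>\<sigma>\<tau> = \<sigma> \<circ> \<tau>\<close>. The localization of the rational Cherednik
  algebra is presented by adjoining two-sided inverses \<open>DXinv i\<close> of the \<open>DX i\<close>.
\<close>

datatype dgen = DPerm "nat \<Rightarrow> nat" | DX nat | DXinv nat | DY nat

definition dgens :: "nat \<Rightarrow> dgen set" where
  "dgens l = DPerm ` {\<sigma>. \<sigma> permutes {1..l}} \<union> DX ` {1..l} \<union> DXinv ` {1..l} \<union> DY ` {1..l}"

abbreviation dperm :: "(nat \<Rightarrow> nat) \<Rightarrow> dgen free_alg" where "dperm \<sigma> \<equiv> gen (DPerm \<sigma>)"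
abbreviation dx :: "nat \<Rightarrow> dgen free_alg" where "dx i \<equiv> gen (DX i)"
abbreviation dxinv :: "nat \<Rightarrow> dgen free_alg" where "dxinv i \<equiv> gen (DXinv i)"
abbreviation dy :: "nat \<Rightarrow> dgen free_alg" where "dy i \<equiv> gen (DY i)"

inductive_set daha_rel :: "nat \<Rightarrow> complex \<Rightarrow> complex \<Rightarrow> dgen free_alg set" for l t c where
  perm_id: "dperm id - 1 \<in> daha_rel l t c"
| perm_mult: "\<lbrakk>\<sigma> permutes {1..l}; \<tau> permutes {1..l}\<rbrakk> \<Longrightarrow>
     dperm \<sigma> * dperm \<tau> - dperm (\<sigma> \<circ> \<tau>) \<in> daha_rel l t c"
| xx: "\<lbrakk>i \<in> {1..l}; j \<in> {1..l}\<rbrakk> \<Longrightarrow> dx i * dx j - dx j * dx i \<in> daha_rel l t c"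
| yy: "\<lbrakk>i \<in> {1..l}; j \<in> {1..l}\<rbrakk> \<Longrightarrow> dy i * dy j - dy j * dy i \<in> daha_rel l t c"
| perm_x: "\<lbrakk>\<sigma> permutes {1..l}; i \<in> {1..l}\<rbrakk> \<Longrightarrow>
     dperm \<sigma> * dx i * dperm (Hilbert_Choice.inv \<sigma>) - dx (\<sigma> i) \<in> daha_rel l t c"
| perm_y: "\<lbrakk>\<sigma> permutes {1..l}; i \<in> {1..l}\<rbrakk> \<Longrightarrow>
     dperm \<sigma> * dy i * dperm (Hilbert_Choice.inv \<sigma>) - dy (\<sigma> i) \<in> daha_rel l t c"
| yx_neq: "\<lbrakk>i \<in> {1..l}; j \<in> {1..l}; i \<noteq> j\<rbrakk> \<Longrightarrow>
     (dy j * dx i - dx i * dy j) - (- cscale c (dperm (transpose i j))) \<in> daha_rel l t c"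
| yx_eq: "i \<in> {1..l} \<Longrightarrow>
     (dy i * dx i - dx i * dy i)
       - (cscale t 1 + cscale c (\<Sum>k\<in>{1..l} - {i}. dperm (transpose k i))) \<in> daha_rel l t c"
| x_xinv: "i \<in> {1..l} \<Longrightarrow> dx i * dxinv i - 1 \<in> daha_rel l t c"
| xinv_x: "i \<in> {1..l} \<Longrightarrow> dxinv i * dx i - 1 \<in> daha_rel l t c"

definition daha :: "nat \<Rightarrow> complex \<Rightarrow> complex \<Rightarrow> (complex, dgen free_alg set) module" where
  "daha l t c = presented_algebra (dgens l) (daha_rel l t c)"

definition daha_class :: "nat \<Rightarrow> complex \<Rightarrow> complex \<Rightarrow> dgen free_alg \<Rightarrow> dgen free_alg set" where
  "daha_class l t c = presented_class (dgens l) (daha_rel l t c)"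

definition calU :: "complex \<Rightarrow> complex \<Rightarrow> nat \<Rightarrow> dgen free_alg" where
  "calU t c i = cscale (t / 2) 1 + dx i * dy i + cscale c (\<Sum>j\<in>{1..<i}. dperm (transpose i j))"

definition frak_y :: "nat \<Rightarrow> complex \<Rightarrow> complex \<Rightarrow> nat \<Rightarrow> dgen free_alg" where
  "frak_y l t c i = calU t c i
     + cscale (c / 2) (\<Sum>j\<in>{1..l} - {i}. cscale (nsign j i) (dperm (transpose i j)))"

text \<open>The group algebra of the symmetric group and its map to the Hecke algebra.\<close>

definition perm_algebra :: "nat \<Rightarrow> ((nat \<Rightarrow> nat) \<Rightarrow>\<^sub>0 complex) set" where
  "perm_algebra l = {r. Poly_Mapping.keys r \<subseteq> {\<sigma>. \<sigma> permutes {1..l}}}"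

definition perm_to_daha ::
    "nat \<Rightarrow> complex \<Rightarrow> complex \<Rightarrow> ((nat \<Rightarrow> nat) \<Rightarrow>\<^sub>0 complex) \<Rightarrow> dgen free_alg set" where
  "perm_to_daha l t c r = daha_class l t c (lin_ext dperm r)"


section \<open>Tensor powers of the natural representation\<close>

text \<open>
  The \<open>l\<close>-th tensor power has as basis the lists \<open>w\<close> of length \<open>l\<close> over
  \<open>{1..m+n}\<close>, where \<open>w\<close> stands for the tensor of the \<open>e(w ! 0), ..., e(w ! (l-1))\<close>.
  Tensor factors are numbered from 1, so factor \<open>k\<close> has index \<open>w ! (k - 1)\<close>.
\<close>

type_synonym tensor = "nat list \<Rightarrow>\<^sub>0 complex"

definition tensor_power :: "nat \<Rightarrow> nat \<Rightarrow> nat \<Rightarrow> (complex, tensor) module" where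
  "tensor_power m n l = free_space {w. length w = l \<and> set w \<subseteq> {1..m + n}}"

definition tensor_part :: "nat \<Rightarrow> nat \<Rightarrow> nat \<Rightarrow> nat \<Rightarrow> nat \<Rightarrow> tensor set" where
  "tensor_part m n p l a = {v \<in> carrier (tensor_power m n l).
     \<forall>w\<in>Poly_Mapping.keys v. sum_list (map (par m p) w) mod 2 = a}"

definition E_at :: "nat \<Rightarrow> nat \<Rightarrow> nat \<Rightarrow> nat \<Rightarrow> nat \<Rightarrow> tensor \<Rightarrow> tensor" where
  "E_at m p a b k = lin_ext (\<lambda>w.
     if w ! (k - 1) = b
     then Poly_Mapping.single (w[k - 1 := a])
            ((-1) ^ ((par m p a + par m p b) * (\<Sum>j = 1..<k. par m p (w ! (j - 1)))))
     else 0)"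

definition E_tot :: "nat \<Rightarrow> nat \<Rightarrow> nat \<Rightarrow> nat \<Rightarrow> nat \<Rightarrow> tensor \<Rightarrow> tensor" where
  "E_tot m p l a b v = (\<Sum>k = 1..l. E_at m p a b k v)"

text \<open>
  The permutation \<open>\<sigma>\<close> moves the factor in position \<open>i\<close> to position \<open>\<sigma> i\<close>; the
  sign is the product of \<open>(-1)^(|v(i)||v(j)|)\<close> over the inversions of \<open>\<sigma>\<close>. This is the
  action given on adjacent transpositions by the signed flip (see the lemmas
  \<open>perm_act_adjacent\<close> and \<open>perm_act_comp\<close> below).
\<close>

definition koszul_exp :: "nat \<Rightarrow> nat \<Rightarrow> nat \<Rightarrow> (nat \<Rightarrow> nat) \<Rightarrow> nat list \<Rightarrow> nat" where
  "koszul_exp m p l \<sigma> w =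
     (\<Sum>(i, j)\<in>{(i, j). i \<in> {1..l} \<and> j \<in> {1..l} \<and> i < j \<and> \<sigma> j < \<sigma> i}.
        par m p (w ! (i - 1)) * par m p (w ! (j - 1)))"

definition permute_word :: "nat \<Rightarrow> (nat \<Rightarrow> nat) \<Rightarrow> nat list \<Rightarrow> nat list" where
  "permute_word l \<sigma> w = map (\<lambda>j. w ! (Hilbert_Choice.inv \<sigma> j - 1)) [1..<l + 1]"

definition perm_act :: "nat \<Rightarrow> nat \<Rightarrow> nat \<Rightarrow> (nat \<Rightarrow> nat) \<Rightarrow> tensor \<Rightarrow> tensor" where
  "perm_act m p l \<sigma> =
     lin_ext (\<lambda>w. Poly_Mapping.single (permute_word l \<sigma> w) ((-1) ^ koszul_exp m p l \<sigma> w))"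

definition perm_algebra_act ::
    "nat \<Rightarrow> nat \<Rightarrow> nat \<Rightarrow> ((nat \<Rightarrow> nat) \<Rightarrow>\<^sub>0 complex) \<Rightarrow> tensor \<Rightarrow> tensor" where
  "perm_algebra_act m p l r v = lin_ext (\<lambda>\<sigma>. perm_act m p l \<sigma> v) r"


section \<open>The space on which the Yangian acts\<close>

definition SW_space ::
    "nat \<Rightarrow> nat \<Rightarrow> nat \<Rightarrow> nat \<Rightarrow> complex \<Rightarrow> complex
      \<Rightarrow> (complex, 'm) module \<Rightarrow> ('m \<Rightarrow> dgen free_alg set \<Rightarrow> 'm)
      \<Rightarrow> (complex, (('m \<times> tensor) \<Rightarrow>\<^sub>0 complex) set) module" where
  "SW_space m n p l t c M act =
     tensor_space (perm_algebra l) M (\<lambda>x r. act x (perm_to_daha l t c r))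
       (tensor_power m n l) (perm_algebra_act m p l)"

definition SW_tensor ::
    "nat \<Rightarrow> nat \<Rightarrow> nat \<Rightarrow> nat \<Rightarrow> complex \<Rightarrow> complex
      \<Rightarrow> (complex, 'm) module \<Rightarrow> ('m \<Rightarrow> dgen free_alg set \<Rightarrow> 'm)
      \<Rightarrow> 'm \<Rightarrow> tensor \<Rightarrow> (('m \<times> tensor) \<Rightarrow>\<^sub>0 complex) set" where
  "SW_tensor m n p l t c M act =
     pure_tensor (perm_algebra l) M (\<lambda>x r. act x (perm_to_daha l t c r))
       (tensor_power m n l) (perm_algebra_act m p l)"

definition SW_part ::
    "nat \<Rightarrow> nat \<Rightarrow> nat \<Rightarrow> nat \<Rightarrow> complex \<Rightarrow> complex
      \<Rightarrow> (complex, 'm) module \<Rightarrow> ('m \<Rightarrow> dgen free_alg set \<Rightarrow> 'm)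
      \<Rightarrow> nat \<Rightarrow> (('m \<times> tensor) \<Rightarrow>\<^sub>0 complex) set set" where
  "SW_part m n p l t c M act a =
     lin_span (SW_space m n p l t c M act)
       {SW_tensor m n p l t c M act x v | x v. x \<in> carrier M \<and> v \<in> tensor_part m n p l a}"


section \<open>Basic facts about the definitions\<close>

lemma lookup_cscale: "Poly_Mapping.lookup (cscale c f) w = c * Poly_Mapping.lookup f w"
  by (simp add: cscale_def Poly_Mapping.map.rep_eq when_def)

lemma cscale_simps:
  "cscale c (f + g) = cscale c f + cscale c g"
  "cscale (c + d) f = cscale c f + cscale d f"
  "cscale c (cscale d f) = cscale (c * d) f"
  "cscale 1 f = f" "cscale 0 f = 0" "cscale c 0 = 0" "cscale (-1) f = - f" 
  "cscale c (Poly_Mapping.single w d) = Poly_Mapping.single w (c * d)"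
  by (rule poly_mapping_eqI; simp add: lookup_cscale lookup_add algebra_simps lookup_single when_def)+

lemma cscale_sum: "cscale c (sum f A) = (\<Sum>a\<in>A. cscale c (f a))"
  by (induction A rule: infinite_finite_induct) (simp_all add: cscale_simps)

lemma sum_single_keys:
  fixes f :: "'a \<Rightarrow>\<^sub>0 complex"
  shows "(\<Sum>w\<in>Poly_Mapping.keys f. Poly_Mapping.single w (Poly_Mapping.lookup f w)) = f"
proof (rule poly_mapping_eqI)
  fix u
  show "Poly_Mapping.lookup (\<Sum>w\<in>Poly_Mapping.keys f. Poly_Mapping.single w (Poly_Mapping.lookup f w)) u
      = Poly_Mapping.lookup f u"
    by (simp add: lookup_sum lookup_single when_def sum.delta' not_in_keys_iff_lookup_eq_zero)
qed

lemma lin_ext_single: "lin_ext f (Poly_Mapping.single w c) = cscale c (f w)"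
  by (cases "c = 0") (simp_all add: lin_ext_def cscale_simps)

lemma lin_ext_superset:
  assumes "finite A" "Poly_Mapping.keys r \<subseteq> A"
  shows "lin_ext f r = (\<Sum>a\<in>A. cscale (Poly_Mapping.lookup r a) (f a))"
  unfolding lin_ext_def using assms
  by (intro sum.mono_neutral_left) (auto simp: cscale_simps in_keys_iff)

lemma lin_ext_add: "lin_ext f (r + s) = lin_ext f r + lin_ext f s"
proof -
  let ?A = "Poly_Mapping.keys r \<union> Poly_Mapping.keys s"
  have "Poly_Mapping.keys (r + s) \<subseteq> ?A" by (rule Poly_Mapping.keys_add)
  then show ?thesis
    using lin_ext_superset[of ?A r f] lin_ext_superset[of ?A s f] lin_ext_superset[of ?A "r + s" f]
    by (simp add: lookup_add cscale_simps sum.distrib)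
qed

lemma lin_ext_zero: "lin_ext f 0 = 0"
  by (simp add: lin_ext_def)

lemma lin_ext_sum: "lin_ext f (sum g A) = (\<Sum>a\<in>A. lin_ext f (g a))"
  by (induction A rule: infinite_finite_induct) (simp_all add: lin_ext_add lin_ext_zero)

lemma supercomm_homogeneous:
  assumes "x \<in> homogeneous \<pi> a" and "y \<in> homogeneous \<pi> b"
  shows "supercomm \<pi> x y = x * y - cscale ((-1) ^ (a * b)) (y * x)"
proof -
  let ?k = Poly_Mapping.keys and ?l = Poly_Mapping.lookup
  have "y * x = (\<Sum>v\<in>?k y. Poly_Mapping.single v (?l y v)) * (\<Sum>u\<in>?k x. Poly_Mapping.single u (?l x u))"
    by (simp only: sum_single_keys)
  also have "\<dots> = (\<Sum>u\<in>?k x. \<Sum>v\<in>?k y. Poly_Mapping.single (v + u) (?l x u * ?l y v))"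
    by (simp add: sum_product mult_single sum.swap[of _ "?k y"] mult.commute)
  finally have "cscale ((-1) ^ (a * b)) (y * x)
      = (\<Sum>u\<in>?k x. \<Sum>v\<in>?k y. Poly_Mapping.single (v + u) ((-1) ^ (a * b) * (?l x u * ?l y v)))"
    by (simp add: cscale_sum cscale_simps)
  also have "\<dots> = (\<Sum>u\<in>?k x. \<Sum>v\<in>?k y. Poly_Mapping.single (v + u)
        ((-1) ^ (word_parity \<pi> u * word_parity \<pi> v) * ?l x u * ?l y v))"
    using assms by (intro sum.cong refl) (simp add: homogeneous_def mult.assoc)
  finally show ?thesis by (simp add: supercomm_def)
qed


lemma keys_cscale: "Poly_Mapping.keys (cscale c f) \<subseteq> Poly_Mapping.keys f"
  by (auto simp: in_keys_iff lookup_cscale)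

lemma keys_diff_subset: "Poly_Mapping.keys (f - g) \<subseteq> Poly_Mapping.keys f \<union> Poly_Mapping.keys (g :: 'a \<Rightarrow>\<^sub>0 complex)"
  by (auto simp: in_keys_iff lookup_minus)

lemma keys_minus: "Poly_Mapping.keys (- f) = Poly_Mapping.keys (f :: 'a \<Rightarrow>\<^sub>0 complex)"
  by (auto simp: in_keys_iff)

lemma letters_plus [simp]: "letters (u + v) = letters u @ letters v"
  by (simp add: plus_free_word_def)

lemma letters_zero [simp]: "letters 0 = []"
  by (simp add: zero_free_word_def)

lemma cscale_conv_mult: "cscale c f = Poly_Mapping.single 0 c * (f :: 'g free_alg)"
proof -
  have "Poly_Mapping.single 0 c * f
      = Poly_Mapping.single 0 c * (\<Sum>w\<in>Poly_Mapping.keys f. Poly_Mapping.single w (Poly_Mapping.lookup f w))"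
    by (simp only: sum_single_keys)
  also have "\<dots> = cscale c (\<Sum>w\<in>Poly_Mapping.keys f. Poly_Mapping.single w (Poly_Mapping.lookup f w))"
    by (simp add: sum_distrib_left mult_single cscale_sum cscale_simps)
  finally show ?thesis by (simp only: sum_single_keys)
qed

lemma free_algebra_ring: "ring (free_algebra G)"
proof (rule ringI)
  show "abelian_group (free_algebra G)"
  proof (rule abelian_groupI)
    fix x assume "x \<in> carrier (free_algebra G)"
    then show "\<exists>y\<in>carrier (free_algebra G). y \<oplus>\<^bsub>free_algebra G\<^esub> x = \<zero>\<^bsub>free_algebra G\<^esub>"
      by (intro bexI[of _ "- x"]) (auto simp: free_algebra_def keys_minus)
  next
    fix x y assume "x \<in> carrier (free_algebra G)" "y \<in> carrier (free_algebra G)"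
    then show "x \<oplus>\<^bsub>free_algebra G\<^esub> y \<in> carrier (free_algebra G)"
      using Poly_Mapping.keys_add[of x y] by (auto simp: free_algebra_def)
  qed (simp_all add: free_algebra_def add_ac)
  show "Group.monoid (free_algebra G)"
  proof (rule monoidI)
    fix x y assume "x \<in> carrier (free_algebra G)" "y \<in> carrier (free_algebra G)"
    then show "x \<otimes>\<^bsub>free_algebra G\<^esub> y \<in> carrier (free_algebra G)"
      using keys_mult[of x y] by (fastforce simp: free_algebra_def)
  qed (auto simp: free_algebra_def algebra_simps)
qed (auto simp: free_algebra_def algebra_simps)

lemma cscale_closed: "f \<in> carrier (free_algebra G) \<Longrightarrow> cscale c f \<in> carrier (free_algebra G)"
  using keys_cscale[of c f] by (auto simp: free_algebra_def)

lemma free_algebra_minus: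
  assumes "f \<in> carrier (free_algebra G)" "g \<in> carrier (free_algebra G)"
  shows "f \<ominus>\<^bsub>free_algebra G\<^esub> g = f - g"
proof -
  interpret ring "free_algebra G" by (rule free_algebra_ring)
  have "- g \<in> carrier (free_algebra G)" "- g \<oplus>\<^bsub>free_algebra G\<^esub> g = \<zero>\<^bsub>free_algebra G\<^esub>"
    using assms by (auto simp: free_algebra_def keys_minus)
  then have "\<ominus>\<^bsub>free_algebra G\<^esub> g = - g" using assms by (intro minus_equality)
  then show ?thesis using assms by (simp add: a_minus_def) (simp add: free_algebra_def)
qed

lemma quot_module_simps:
  "carrier (quot_module V N) = carrier (V Quot N)"
  "monoid.mult (quot_module V N) = monoid.mult (V Quot N)"
  "monoid.one (quot_module V N) = monoid.one (V Quot N)"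
  "ring.zero (quot_module V N) = ring.zero (V Quot N)"
  "ring.add (quot_module V N) = ring.add (V Quot N)"
  "c \<odot>\<^bsub>quot_module V N\<^esub> K = (\<Union>x\<in>K. N +>\<^bsub>V\<^esub> (c \<odot>\<^bsub>V\<^esub> x))"
  by (simp_all add: quot_module_def ring.extend_def module.fields_def)


lemma presented_algebra_ring_hom:
  assumes "R \<subseteq> carrier (free_algebra G)"
  shows "ring_hom_ring (free_algebra G) (presented_algebra G R) (presented_class G R)"
proof -
  interpret ring "free_algebra G" by (rule free_algebra_ring)
  interpret I: ideal "genideal (free_algebra G) R" "free_algebra G"
    by (rule genideal_ideal[OF assms])
  let ?P = "presented_algebra G R" and ?Q = "free_algebra G Quot genideal (free_algebra G) R"
  have hom: "ring_hom_ring (free_algebra G) ?Q (presented_class G R)"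
    using I.rcos_ring_hom_ring by (simp add: presented_class_def[abs_def])
  interpret Q: ring ?Q by (rule I.quotient_is_ring)
  have fields: "carrier ?P = carrier ?Q" "monoid.mult ?P = monoid.mult ?Q" "monoid.one ?P = monoid.one ?Q"
    "ring.zero ?P = ring.zero ?Q" "ring.add ?P = ring.add ?Q"
    by (simp_all add: presented_algebra_def quot_module_simps)
  have ring_P: "ring ?P"
  proof (rule ringI)
    show "abelian_group ?P"
    proof (rule abelian_groupI; unfold fields)
      fix x assume "x \<in> carrier ?Q"
      then show "\<exists>y\<in>carrier ?Q. y \<oplus>\<^bsub>?Q\<^esub> x = \<zero>\<^bsub>?Q\<^esub>"
        using Q.l_neg by blast
    qed (simp_all add: Q.a_ac)
    show "Group.monoid ?P"
      by (rule monoidI; unfold fields) (simp_all add: Q.m_assoc)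
  qed (unfold fields, simp_all add: Q.l_distr Q.r_distr)
  show ?thesis
  proof (rule ring_hom_ringI2[OF free_algebra_ring ring_P])
    show "presented_class G R \<in> ring_hom (free_algebra G) ?P"
      using ring_hom_ring.homh[OF hom]
      by (simp add: ring_hom_def presented_algebra_def quot_module_simps)
  qed
qed

lemma presented_class_cscale:
  assumes R: "R \<subseteq> carrier (free_algebra G)" and f: "f \<in> carrier (free_algebra G)"
  shows "c \<odot>\<^bsub>presented_algebra G R\<^esub> presented_class G R f = presented_class G R (cscale c f)"
proof -
  interpret ring "free_algebra G" by (rule free_algebra_ring)
  interpret I: ideal "genideal (free_algebra G) R" "free_algebra G"
    by (rule genideal_ideal[OF R])
  let ?I = "genideal (free_algebra G) R" and ?F = "free_algebra G"
  have one: "Poly_Mapping.single 0 c \<in> carrier ?F" by (simp add: free_algebra_def)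
  have 1: "?I +>\<^bsub>?F\<^esub> cscale c x = ?I +>\<^bsub>?F\<^esub> cscale c f" if x: "x \<in> ?I +>\<^bsub>?F\<^esub> f" for x
  proof -
    obtain h where h: "h \<in> ?I" "x = h \<oplus>\<^bsub>?F\<^esub> f" using x unfolding a_r_coset_def' by blast
    have ch: "cscale c h \<in> ?I" using I.I_l_closed[OF h(1) one] 
      by (simp add: cscale_conv_mult) (simp add: free_algebra_def)
    have "cscale c x = cscale c h \<oplus>\<^bsub>?F\<^esub> cscale c f"
      using h(2) by (simp add: cscale_simps free_algebra_def)
    then have "cscale c x \<in> ?I +>\<^bsub>?F\<^esub> cscale c f" using ch unfolding a_r_coset_def' by auto
    then show ?thesis using I.a_repr_independence'[OF _ cscale_closed[OF f]] by simp
  qed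
  have f': "f \<in> ?I +>\<^bsub>?F\<^esub> f" using I.a_rcos_self[OF f] .
  have "(\<Union>x\<in>?I +>\<^bsub>?F\<^esub> f. ?I +>\<^bsub>?F\<^esub> cscale c x) = ?I +>\<^bsub>?F\<^esub> cscale c f"
    using 1 f' by blast
  moreover have "c \<odot>\<^bsub>?F\<^esub> x = cscale c x" for x by (simp add: free_algebra_def)
  ultimately show ?thesis
    by (simp only: presented_algebra_def presented_class_def quot_module_simps)
qed

lemma homogeneous_cscale: "f \<in> homogeneous \<pi> a \<Longrightarrow> cscale c f \<in> homogeneous \<pi> a"
  using keys_cscale[of c f] by (auto simp: homogeneous_def)

lemma homogeneous_mult:
  assumes "x \<in> homogeneous \<pi> a" "y \<in> homogeneous \<pi> b"
  shows "x * y \<in> homogeneous \<pi> ((a + b) mod 2)"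
  using assms keys_mult[of x y] unfolding homogeneous_def word_parity_def
  by (fastforce simp: mod_simps)

lemma homogeneous_supercomm:
  assumes "x \<in> homogeneous \<pi> a" "y \<in> homogeneous \<pi> b"
  shows "supercomm \<pi> x y \<in> homogeneous \<pi> ((a + b) mod 2)"
  using homogeneous_mult[OF assms] homogeneous_cscale[OF homogeneous_mult[OF assms(2,1)], of "(-1) ^ (a * b)"]
    keys_diff_subset[of "x * y" "cscale ((-1) ^ (a * b)) (y * x)"]
  unfolding supercomm_homogeneous[OF assms] by (auto simp: homogeneous_def add.commute)

lemma free_algebra_closed:
  assumes "x \<in> carrier (free_algebra G)" "y \<in> carrier (free_algebra G)"
  shows "x * y \<in> carrier (free_algebra G)" "x - y \<in> carrier (free_algebra G)"
proof -
  interpret ring "free_algebra G" by (rule free_algebra_ring)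
  show "x * y \<in> carrier (free_algebra G)" using m_closed[OF assms] by (simp add: free_algebra_def)
  show "x - y \<in> carrier (free_algebra G)"
    using minus_closed[OF assms] by (simp add: free_algebra_minus assms)
qed

lemma presented_class_supercomm:
  assumes R: "R \<subseteq> carrier (free_algebra G)"
    and x: "x \<in> carrier (free_algebra G)" "x \<in> homogeneous \<pi> a"
    and y: "y \<in> carrier (free_algebra G)" "y \<in> homogeneous \<pi> b"
  shows "presented_class G R (supercomm \<pi> x y)
     = (presented_class G R x \<otimes>\<^bsub>presented_algebra G R\<^esub> presented_class G R y)
       \<ominus>\<^bsub>presented_algebra G R\<^esub> ((-1) ^ (a * b) \<odot>\<^bsub>presented_algebra G R\<^esub>
          (presented_class G R y \<otimes>\<^bsub>presented_algebra G R\<^esub> presented_class G R x))"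
proof -
  interpret h: ring_hom_ring "free_algebra G" "presented_algebra G R" "presented_class G R"
    by (rule presented_algebra_ring_hom[OF R])
  let ?F = "free_algebra G"
  have m: "x \<otimes>\<^bsub>?F\<^esub> y = x * y" "y \<otimes>\<^bsub>?F\<^esub> x = y * x" by (simp_all add: free_algebra_def)
  note c = free_algebra_closed[OF x(1) y(1)] free_algebra_closed[OF y(1) x(1)]
  have "presented_class G R (x * y \<ominus>\<^bsub>?F\<^esub> cscale ((-1) ^ (a * b)) (y * x))
    = presented_class G R (x * y) \<ominus>\<^bsub>presented_algebra G R\<^esub> presented_class G R (cscale ((-1) ^ (a * b)) (y * x))"
    using c(1) cscale_closed[OF c(3)] by (simp add: a_minus_def)
  then show ?thesis
    using h.hom_mult[OF x(1) y(1)] h.hom_mult[OF y(1) x(1)] c cscale_closed[OF c(3)]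
    by (simp add: supercomm_homogeneous[OF x(2) y(2)] m free_algebra_minus flip: presented_class_cscale[OF R c(3)])
qed

lemma gen_closed [simp]: "g \<in> G \<Longrightarrow> gen g \<in> carrier (free_algebra G)"
  by (simp add: gen_def free_algebra_def)

lemma gen_homogeneous: "gen g \<in> homogeneous \<pi> (\<pi> g mod 2)"
  by (simp add: gen_def homogeneous_def word_parity_def)



lemma free_algebra_zero_closed: "0 \<in> carrier (free_algebra G)"
  by (simp add: free_algebra_def)

lemma free_algebra_add_closed:
  assumes "x \<in> carrier (free_algebra G)" "y \<in> carrier (free_algebra G)"
  shows "x + y \<in> carrier (free_algebra G)"
proof -
  interpret ring "free_algebra G" by (rule free_algebra_ring)
  show ?thesis using a_closed[OF assms] by (simp add: free_algebra_def)
qed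

lemma free_algebra_sum_closed:
  "(\<And>a. a \<in> A \<Longrightarrow> h a \<in> carrier (free_algebra G)) \<Longrightarrow> sum h A \<in> carrier (free_algebra G)"
  by (induction A rule: infinite_finite_induct)
    (simp_all add: free_algebra_zero_closed free_algebra_add_closed)

lemma supercomm_closed:
  assumes "x \<in> carrier (free_algebra G)" "y \<in> carrier (free_algebra G)"
  shows "supercomm \<pi> x y \<in> carrier (free_algebra G)"
proof -
  have "Poly_Mapping.single (v + u) c \<in> carrier (free_algebra G)"
    if "u \<in> Poly_Mapping.keys x" "v \<in> Poly_Mapping.keys y" for u v c
  proof -
    have "set (letters (v + u)) \<subseteq> G" using assms that by (simp add: free_algebra_def)
    then show ?thesis by (simp add: free_algebra_def)
  qed
  then show ?thesis
    unfolding supercomm_def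
    by (intro free_algebra_closed(2) free_algebra_closed(1) free_algebra_sum_closed assms)
qed

lemma yangian_rel_closed: "yangian_rel m n p lam \<subseteq> carrier (free_algebra (ygens m n))"
proof
  have gens: "yX e i r \<in> carrier (free_algebra (ygens m n))" "yH i r \<in> carrier (free_algebra (ygens m n))"
    if "1 \<le> i" "i \<le> m + n - 1" "r \<in> {0, 1}" for e i r
    using that by (auto simp: ygens_def)
  note cl = supercomm_closed free_algebra_closed free_algebra_zero_closed
    free_algebra_add_closed cscale_closed gens
  have iter: "(ybr m p x ^^ k) y \<in> carrier (free_algebra (ygens m n))"
    if "x \<in> carrier (free_algebra (ygens m n))" "y \<in> carrier (free_algebra (ygens m n))" for x y k
    using that by (induction k) (auto intro: cl)
  fix x assume "x \<in> yangian_rel m n p lam"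
  then show "x \<in> carrier (free_algebra (ygens m n))"
    by cases (auto simp: yH_tilde_def anticomm_def simp del: funpow.simps intro!: cl iter)
qed

lemma yE_up_props:
  assumes "1 \<le> i" "i + d + 1 \<le> m + n"
  shows "yE_up m p i d \<in> carrier (free_algebra (ygens m n)) \<inter>
    homogeneous (ygen_parity m p) ((par m p i + par m p (i + d + 1)) mod 2)"
  using assms
proof (induction d)
  case 0
  then show ?case
    using gen_homogeneous[of "YX Plus i 0" "ygen_parity m p"] by (auto simp: ygens_def par_def)
next
  case (Suc d)
  let ?j = "i + d + 1"
  have X: "yX Plus ?j 0 \<in> carrier (free_algebra (ygens m n))"
    "yX Plus ?j 0 \<in> homogeneous (ygen_parity m p) ((par m p ?j + par m p (?j + 1)) mod 2)"
    using Suc.prems gen_homogeneous[of "YX Plus ?j 0" "ygen_parity m p"]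
    by (auto simp: ygens_def par_def)
  have e: "((a + b) mod 2 + (b + c) mod 2) mod 2 = (a + c) mod 2" for a b c :: nat
    by (auto simp: mod2_eq_if)
  have idx: "i + Suc d + 1 = ?j + 1" by simp
  have "1 \<le> i" "?j \<le> m + n" using Suc.prems by linarith+
  note U = IntD1[OF Suc.IH[OF this]] IntD2[OF Suc.IH[OF this]]
  show ?case
    using supercomm_closed[OF U(1) X(1)] homogeneous_supercomm[OF U(2) X(2), unfolded e]
    unfolding yE_up.simps idx by blast
qed

lemma yE_down_props:
  assumes "1 \<le> i" "i + d + 1 \<le> m + n"
  shows "yE_down m p i d \<in> carrier (free_algebra (ygens m n)) \<inter>
    homogeneous (ygen_parity m p) ((par m p i + par m p (i + d + 1)) mod 2)"
  using assms
proof (induction d)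
  case 0
  then show ?case
    using gen_homogeneous[of "YX Minus i 0" "ygen_parity m p"]
    by (auto simp: ygens_def par_def intro!: cscale_closed homogeneous_cscale)
next
  case (Suc d)
  let ?j = "i + d + 1"
  let ?X = "cscale (psgn m p ?j) (yX Minus ?j 0)"
  have X: "?X \<in> carrier (free_algebra (ygens m n))"
    "?X \<in> homogeneous (ygen_parity m p) ((par m p ?j + par m p (?j + 1)) mod 2)"
    using Suc.prems gen_homogeneous[of "YX Minus ?j 0" "ygen_parity m p"]
    by (auto simp: ygens_def par_def intro!: cscale_closed homogeneous_cscale)
  have e: "((b + c) mod 2 + (a + b) mod 2) mod 2 = (a + c) mod 2" for a b c :: nat
    by (auto simp: mod2_eq_if)
  have idx: "i + Suc d + 1 = ?j + 1" by simp
  have "1 \<le> i" "?j \<le> m + n" using Suc.prems by linarith+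
  note U = IntD1[OF Suc.IH[OF this]] IntD2[OF Suc.IH[OF this]]
  show ?case
    using supercomm_closed[OF X(1) U(1)] homogeneous_supercomm[OF X(2) U(2), unfolded e]
    unfolding yE_down.simps idx by blast
qed

lemma yE_unique:
  fixes \<phi> :: "nat \<Rightarrow> nat \<Rightarrow> ygen free_alg set" and m n p :: nat and lam :: complex
  defines "Y \<equiv> yangian m n p lam" and "cl \<equiv> yangian_class m n p lam" and "s \<equiv> par m p"
  assumes closed: "\<And>i j. \<lbrakk>i \<in> {1..m + n}; j \<in> {1..m + n}; i \<noteq> j\<rbrakk> \<Longrightarrow> \<phi> i j \<in> carrier Y"
    and bracket: "\<And>i j k. \<lbrakk>i \<in> {1..m + n}; j \<in> {1..m + n}; k \<in> {1..m + n}; i \<noteq> j; j \<noteq> k; i \<noteq> k\<rbrakk>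
      \<Longrightarrow> \<phi> i k = (\<phi> i j \<otimes>\<^bsub>Y\<^esub> \<phi> j k)
            \<ominus>\<^bsub>Y\<^esub> ((-1) ^ ((s i + s j) * (s j + s k)) \<odot>\<^bsub>Y\<^esub> (\<phi> j k \<otimes>\<^bsub>Y\<^esub> \<phi> i j))"
    and plus: "\<And>i. i \<in> {1..m + n - 1} \<Longrightarrow> \<phi> i (i + 1) = cl (yX Plus i 0)"
    and minus: "\<And>i. i \<in> {1..m + n - 1} \<Longrightarrow> psgn m p i \<odot>\<^bsub>Y\<^esub> \<phi> (i + 1) i = cl (yX Minus i 0)"
    and "i \<in> {1..m + n}" "j \<in> {1..m + n}" "i \<noteq> j"
  shows "\<phi> i j = cl (yE m p i j)"
proof -
  let ?F = "free_algebra (ygens m n)"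
  note R = yangian_rel_closed[of m n p lam]
  have sgn: "(-1 :: complex) ^ ((a mod 2) * (b mod 2)) = (-1) ^ (a * b)" for a b :: nat
    by (simp add: minus_one_power_iff)
  have br: "cl (ybr m p x y) = (cl x \<otimes>\<^bsub>Y\<^esub> cl y) \<ominus>\<^bsub>Y\<^esub> ((-1) ^ (a * b) \<odot>\<^bsub>Y\<^esub> (cl y \<otimes>\<^bsub>Y\<^esub> cl x))"
    if "x \<in> carrier ?F \<inter> homogeneous (ygen_parity m p) (a mod 2)"
      "y \<in> carrier ?F \<inter> homogeneous (ygen_parity m p) (b mod 2)" for x y a b
    unfolding cl_def Y_def yangian_class_def yangian_def using that
    by (subst presented_class_supercomm[OF R, of _ _ "a mod 2" _ "b mod 2"]) (auto simp: sgn)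
  have down0: "\<phi> (i + 1) i = cl (cscale (psgn m p i) (yX Minus i 0))" if i: "i \<in> {1..m + n - 1}" for i
  proof -
    have "\<phi> (i + 1) i \<in> carrier Y" using i by (intro closed) auto
    then obtain f where f: "f \<in> carrier ?F" "\<phi> (i + 1) i = cl f"
      unfolding Y_def cl_def yangian_def presented_algebra_def quot_module_simps FactRing_def
        A_RCOSETS_def' yangian_class_def presented_class_def by auto
    have sm: "c \<odot>\<^bsub>Y\<^esub> cl g = cl (cscale c g)" if "g \<in> carrier ?F" for c g
      using presented_class_cscale[OF R that] by (simp add: cl_def Y_def yangian_def yangian_class_def)
    have sq: "psgn m p i * psgn m p i = (1 :: complex)" by (simp add: psgn_def par_def)
    have X: "yX Minus i 0 \<in> carrier ?F" using i by (auto simp: ygens_def)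
    have "cl (cscale (psgn m p i) (yX Minus i 0)) = psgn m p i \<odot>\<^bsub>Y\<^esub> (psgn m p i \<odot>\<^bsub>Y\<^esub> \<phi> (i + 1) i)"
      using minus[OF i] sm[OF X] by simp
    also have "\<dots> = \<phi> (i + 1) i"
      using f sm cscale_closed[OF f(1)] by (simp add: cscale_simps sq)
    finally show ?thesis by simp
  qed
  have up: "\<phi> i (i + d + 1) = cl (yE_up m p i d)" if "1 \<le> i" "i + d + 1 \<le> m + n" for i d
    using that
  proof (induction d)
    case 0
    then show ?case using plus[of i] by auto
  next
    case (Suc d)
    have X: "yX Plus (i + d + 1) 0 \<in> carrier ?F \<inter> homogeneous (ygen_parity m p) ((s (i + d + 1) + s (i + d + 2)) mod 2)"
      using yE_up_props[of "i + d + 1" 0 m n p] Suc.prems by (simp add: s_def)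
    have "cl (yE_up m p i (Suc d)) = (\<phi> i (i + d + 1) \<otimes>\<^bsub>Y\<^esub> \<phi> (i + d + 1) (i + d + 2))
        \<ominus>\<^bsub>Y\<^esub> ((-1) ^ ((s i + s (i + d + 1)) * (s (i + d + 1) + s (i + d + 2)))
          \<odot>\<^bsub>Y\<^esub> (\<phi> (i + d + 1) (i + d + 2) \<otimes>\<^bsub>Y\<^esub> \<phi> i (i + d + 1)))"
      using br[OF yE_up_props[of i d m n p, folded s_def] X] Suc plus[of "i + d + 1"] by simp
    then show ?case using bracket[of i "i + d + 1" "i + d + 2"] Suc.prems by simp
  qed
  have down: "\<phi> (i + d + 1) i = cl (yE_down m p i d)" if "1 \<le> i" "i + d + 1 \<le> m + n" for i d
    using that
  proof (induction d)
    case 0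
    then show ?case using down0[of i] by auto
  next
    case (Suc d)
    let ?X = "cscale (psgn m p (i + d + 1)) (yX Minus (i + d + 1) 0)"
    have X: "?X \<in> carrier ?F \<inter> homogeneous (ygen_parity m p) ((s (i + d + 2) + s (i + d + 1)) mod 2)"
      using yE_down_props[of "i + d + 1" 0 m n p] Suc.prems by (simp add: s_def add.commute)
    have D: "yE_down m p i d \<in> carrier ?F \<inter> homogeneous (ygen_parity m p) ((s (i + d + 1) + s i) mod 2)"
      using yE_down_props[of i d m n p] Suc.prems by (simp add: s_def add.commute)
    have "cl (yE_down m p i (Suc d)) = (\<phi> (i + d + 2) (i + d + 1) \<otimes>\<^bsub>Y\<^esub> \<phi> (i + d + 1) i)
        \<ominus>\<^bsub>Y\<^esub> ((-1) ^ ((s (i + d + 2) + s (i + d + 1)) * (s (i + d + 1) + s i))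
          \<odot>\<^bsub>Y\<^esub> (\<phi> (i + d + 1) i \<otimes>\<^bsub>Y\<^esub> \<phi> (i + d + 2) (i + d + 1)))"
      using br[OF X D] Suc down0[of "i + d + 1"] by simp
    then show ?case using bracket[of "i + d + 2" "i + d + 1" i] Suc.prems by simp
  qed
  show ?thesis
  proof (cases "i < j")
    case True
    then show ?thesis using up[of i "j - i - 1"] assms(8-) by (simp add: yE_def)
  next
    case False
    then show ?thesis using down[of j "i - j - 1"] assms(8-) by (simp add: yE_def)
  qed
qed

lemma sum_pairs_split:
  fixes h :: "nat \<Rightarrow> nat \<Rightarrow> nat"
  assumes "\<And>i. h i i = 0" "finite D"
  shows "(\<Sum>i\<in>D. \<Sum>j\<in>D. h i j) = (\<Sum>i\<in>D. \<Sum>j\<in>D. if i < j then h i j + h j i else 0)"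
proof -
  have "(\<Sum>i\<in>D. \<Sum>j\<in>D. h i j)
    = (\<Sum>i\<in>D. \<Sum>j\<in>D. if i < j then h i j else 0) + (\<Sum>i\<in>D. \<Sum>j\<in>D. if j < i then h i j else 0)"
    unfolding sum.distrib[symmetric]
  proof (intro sum.cong refl)
    fix i j
    show "h i j = (if i < j then h i j else 0) + (if j < i then h i j else 0)"
      by (cases i j rule: linorder_cases) (simp_all add: assms)
  qed
  also have "(\<Sum>i\<in>D. \<Sum>j\<in>D. if j < i then h i j else 0) = (\<Sum>i\<in>D. \<Sum>j\<in>D. if i < j then h j i else 0)"
    by (rule sum.swap)
  finally show ?thesis
    unfolding sum.distrib[symmetric] by (auto intro!: sum.cong)
qed

lemma koszul_exp_alt:
  "koszul_exp m p l \<sigma> w = (\<Sum>i\<in>{1..l}. \<Sum>j\<in>{1..l}. if i < j then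
     (if \<sigma> j < \<sigma> i then par m p (w ! (i - 1)) * par m p (w ! (j - 1)) else 0) else 0)"
proof -
  have "koszul_exp m p l \<sigma> w = (\<Sum>(i, j)\<in>{1..l} \<times> {1..l}. if i < j then
     (if \<sigma> j < \<sigma> i then par m p (w ! (i - 1)) * par m p (w ! (j - 1)) else 0) else 0)"
    unfolding koszul_exp_def
    by (rule sum.mono_neutral_cong_left) (auto split: if_splits)
  then show ?thesis by (simp add: sum.cartesian_product)
qed

lemma permute_word_nth:
  assumes "j \<in> {1..l}"
  shows "permute_word l \<sigma> w ! (j - 1) = w ! (Hilbert_Choice.inv \<sigma> j - 1)"
proof -
  have "[1..<l + 1] ! (j - 1) = j" using assms by (subst nth_upt) auto
  then show ?thesis using assms unfolding permute_word_def by (subst nth_map) auto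
qed

lemma permute_word_comp:
  assumes "\<sigma> permutes {1..l}" "\<tau> permutes {1..l}"
  shows "permute_word l (\<sigma> \<circ> \<tau>) w = permute_word l \<sigma> (permute_word l \<tau> w)"
proof -
  have "Hilbert_Choice.inv \<sigma> j \<in> {1..l}" if "j \<in> {1..l}" for j
    using permutes_in_image[OF permutes_inv[OF assms(1)]] that by blast
  moreover have "Hilbert_Choice.inv (\<sigma> \<circ> \<tau>) j = Hilbert_Choice.inv \<tau> (Hilbert_Choice.inv \<sigma> j)" for j
    using assms by (simp add: o_inv_distrib permutes_bij)
  ultimately show ?thesis
    unfolding permute_word_def[of l "\<sigma> \<circ> \<tau>"] permute_word_def[of l \<sigma>]
    by (intro map_cong refl) (simp only: set_upt atLeastLessThanSuc_atLeastAtMost Suc_eq_plus1[symmetric] permute_word_nth)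
qed

lemma koszul_sign_comp:
  assumes s: "\<sigma> permutes {1..l}" and t: "\<tau> permutes {1..l}"
  shows "(-1 :: complex) ^ koszul_exp m p l (\<sigma> \<circ> \<tau>) w
    = (-1) ^ koszul_exp m p l \<sigma> (permute_word l \<tau> w) * (-1) ^ koszul_exp m p l \<tau> w"
proof -
  let ?D = "{1..l}" and ?s = "\<lambda>i. par m p (w ! (i - 1))"
  let ?h = "\<lambda>i j. if \<tau> i < \<tau> j then (if \<sigma> (\<tau> j) < \<sigma> (\<tau> i) then ?s i * ?s j else 0) else 0"
  have re1: "(\<Sum>i\<in>?D. f i) = (\<Sum>i\<in>?D. f (\<tau> i))" for f :: "nat \<Rightarrow> nat"
    using sum.permute[OF t, of f] by (simp add: o_def)
  have re: "(\<Sum>i\<in>?D. \<Sum>j\<in>?D. f i j) = (\<Sum>i\<in>?D. \<Sum>j\<in>?D. f (\<tau> i) (\<tau> j))" for f :: "nat \<Rightarrow> nat \<Rightarrow> nat"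
    by (subst re1) (intro sum.cong refl re1)
  have ti: "\<tau> i \<in> ?D" if "i \<in> ?D" for i using permutes_in_image[OF t] that by blast
  have iv: "Hilbert_Choice.inv \<tau> (\<tau> i) = i" for i using permutes_inverses(2)[OF t] .
  have "koszul_exp m p l \<sigma> (permute_word l \<tau> w) = (\<Sum>i\<in>?D. \<Sum>j\<in>?D. ?h i j)"
    unfolding koszul_exp_alt
    by (subst re) (intro sum.cong refl; simp only: permute_word_nth[OF ti] iv)
  also have "\<dots> = (\<Sum>i\<in>?D. \<Sum>j\<in>?D. if i < j then ?h i j + ?h j i else 0)"
    by (rule sum_pairs_split) auto
  finally have K: "koszul_exp m p l \<sigma> (permute_word l \<tau> w) = \<dots>" .
  have inj: "\<tau> i = \<tau> j \<longleftrightarrow> i = j" "\<sigma> i = \<sigma> j \<longleftrightarrow> i = j" for i j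
    using permutes_inj[OF s] permutes_inj[OF t] by (auto simp: inj_eq)
  have "even (koszul_exp m p l (\<sigma> \<circ> \<tau>) w + koszul_exp m p l \<sigma> (permute_word l \<tau> w) + koszul_exp m p l \<tau> w)"
    unfolding K koszul_exp_alt[of m p l "\<sigma> \<circ> \<tau>"] koszul_exp_alt[of m p l \<tau>] sum.distrib[symmetric]
  proof (intro dvd_sum, goal_cases)
    case (1 i j)
    consider "i < j" "\<tau> i < \<tau> j" | "i < j" "\<tau> j < \<tau> i" | "\<not> i < j"
      using inj(1)[of i j] by linarith
    then show ?case
    proof cases
      case 2
      consider "\<sigma> (\<tau> i) < \<sigma> (\<tau> j)" | "\<sigma> (\<tau> j) < \<sigma> (\<tau> i)" 
        using inj(1)[of i j] inj(2)[of "\<tau> i" "\<tau> j"] 2 by linarith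
      then show ?thesis using 2 by cases auto
    qed auto
  qed
  then show ?thesis
    by (auto simp: minus_one_power_iff simp flip: power_add)
qed

lemma perm_act_comp:
  assumes s: "\<sigma> permutes {1..l}" and t: "\<tau> permutes {1..l}"
  shows "perm_act m p l (\<sigma> \<circ> \<tau>) v = perm_act m p l \<sigma> (perm_act m p l \<tau> v)"
  unfolding perm_act_def lin_ext_def[of _ v] lin_ext_sum
  by (intro sum.cong refl) (simp only: cscale_simps(8) lin_ext_single permute_word_comp[OF s t]
      koszul_sign_comp[OF s t] mult_ac)

lemma perm_act_adjacent:
  assumes "1 \<le> i" "i < l" "length w = l"
  shows "perm_act m p l (transpose i (i + 1)) (Poly_Mapping.single w 1)
    = Poly_Mapping.single (w[i - 1 := w ! i, i := w ! (i - 1)])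
        ((-1) ^ (par m p (w ! (i - 1)) * par m p (w ! i)))"
proof -
  have "{(a, b). a \<in> {1..l} \<and> b \<in> {1..l} \<and> a < b \<and> transpose i (i + 1) b < transpose i (i + 1) a} = {(i, i + 1)}"
    using assms by (auto simp: transpose_def split: if_splits)
  then have "koszul_exp m p l (transpose i (i + 1)) w = par m p (w ! (i - 1)) * par m p (w ! i)"
    by (simp add: koszul_exp_def)
  moreover have "permute_word l (transpose i (i + 1)) w = w[i - 1 := w ! i, i := w ! (i - 1)]"
    using assms
    by (intro nth_equalityI) (auto simp: permute_word_def transpose_def nth_list_update simp del: upt_Suc)
  ultimately show ?thesis by (simp add: perm_act_def lin_ext_single cscale_simps)
qed

end

theory Submission imports Defs begin

text \<open>
  All operators are realised on the free vector space over \<open>M \<times> V\<close>, \<open>V\<close> the tensor power, and composed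
  with a projection whose kernel is the span of the tensor relations, so that the Yangian relations
  become identities in an associative ring. The operators \<open>E\<^sub>a\<^sub>b\<close> and \<open>J\<^sub>a\<^sub>b = \<Sum>\<^sub>k y\<^sub>k \<otimes> E\<^sub>a\<^sub>b\<^sup>(\<^sup>k\<^sup>)\<close> satisfy
  \<open>[E\<^sub>a\<^sub>b, E\<^sub>c\<^sub>d] = \<delta>\<^sub>b\<^sub>c E\<^sub>a\<^sub>d \<plusminus> \<delta>\<^sub>a\<^sub>d E\<^sub>c\<^sub>b\<close> and \<open>[E\<^sub>a\<^sub>b, J\<^sub>c\<^sub>d] = \<delta>\<^sub>b\<^sub>c J\<^sub>a\<^sub>d \<plusminus> \<delta>\<^sub>a\<^sub>d J\<^sub>c\<^sub>b\<close>. Hence every relation that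
  involves at most one \<open>J\<close> reduces to identities between the quadratic elements \<open>\<vartheta>\<^sub>i\<close>, \<open>\<varpi>\<^sub>i\<^sup>\<plusminus>\<close>
  of the enveloping algebra of the general linear superalgebra. The only other relation says that the
  operators \<open>J(h\<^sub>i) - \<lambda>\<vartheta>\<^sub>i\<close> commute. On a tensor \<open>m \<otimes> w\<close> with a basis word \<open>w\<close>, the sum
  \<open>\<Sum>\<^sub>k E\<^sub>i\<^sub>k E\<^sub>k\<^sub>i\<close> in \<open>\<vartheta>\<^sub>i\<close> acts by signed flips, which move across the tensor sign and turn into
  transpositions acting on \<open>m\<close>. Up to scalars the operator then replaces \<open>m\<close> by
  \<open>\<Sum>\<^sub>b m (y\<^sub>b - \<lambda>/2 (\<Sum>\<^sub>a \<sigma>\<^sub>a\<^sub>b - \<Sum>\<^sub>c \<sigma>\<^sub>c\<^sub>b))\<close>, where \<open>b\<close>, \<open>a\<close>, \<open>c\<close> run over the positions of \<open>w\<close> with letter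
  equal to, larger than and smaller than \<open>i\<close>. These elements of the Hecke algebra commute for
  different \<open>i\<close>, like Jucys-Murphy elements. Uniqueness holds because the pure tensors span and the
  generators of degree one are the elements \<open>J\<close> up to polynomials in those of degree zero.
\<close>

section \<open>Linear operators on free vector spaces\<close>

text \<open>Two demands pull against each other. For \<open>J_act\<close> to descend to the tensor
  product over the group algebra, conjugation by S_l must permute the elements
  \<open>frak_y\<close>. It does, because they have the symmetric form t/2 + x_k y_k + (\<lambda>/2)
  sum_{j \<noteq> k} \<sigma>_kj, but in this form they need not commute. The correction \<lambda>
  \<vartheta>_i breaks the symmetry on each word separately: of the coefficients \<lambda>/2 it
  removes those at larger letters and doubles those at smaller ones, and this restores
  commutativity. A second obstacle is that quotients of records only have carriers, whereas ring
  normalisation needs a type of class \<open>ring_1\<close>. If P is a projection whose kernel is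
  the span of the relations and A maps the relations into that kernel, then (P A) P = P A, so
  composing operators P A on the free space amounts to composing the induced maps on the quotient.
  The bound 2 \<le> m rules out two adjacent odd nodes in the relation between degree-one and
  degree-zero generators of equal sign.\<close>

lemma cscale_diff: "cscale c (f - g) = cscale c f - cscale c g"
  by (rule poly_mapping_eqI) (simp add: lookup_cscale lookup_minus algebra_simps)

lemma cscale_minus: "cscale c (- f) = - cscale c f"
  by (rule poly_mapping_eqI) (simp add: lookup_cscale)

lemma cscale_minus_left: "cscale (- c) f = - cscale c f"
  by (rule poly_mapping_eqI) (simp add: lookup_cscale)

lemma cscale_commute: "cscale a (cscale b x) = cscale b (cscale a x)"
  by (simp add: cscale_simps mult.commute)

lemma lin_ext_cscale: "lin_ext f (cscale c x) = cscale c (lin_ext f x)"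
proof -
  have "lin_ext f (cscale c x) = (\<Sum>a\<in>Poly_Mapping.keys x. cscale (c * Poly_Mapping.lookup x a) (f a))"
    by (subst lin_ext_superset[OF _ keys_cscale]) (simp_all add: lookup_cscale)
  then show ?thesis by (simp add: lin_ext_def cscale_sum cscale_simps)
qed

text \<open>Linear endomorphisms form a type of their own so that they become an instance of
  \<open>ring_1\<close>; relations between operators are then checked by ring laws without side
  conditions on carriers.\<close>

typedef 'a linop = "{f :: ('a \<Rightarrow>\<^sub>0 complex) \<Rightarrow> ('a \<Rightarrow>\<^sub>0 complex).
    (\<forall>x y. f (x + y) = f x + f y) \<and> (\<forall>c x. f (cscale c x) = cscale c (f x))}"
  morphisms app Linop
  by (rule exI[of _ id]) simp

setup_lifting type_definition_linop

instantiation linop :: (type) ring_1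
begin

lift_definition zero_linop :: "'a linop" is "\<lambda>_. 0" by (simp add: cscale_simps)
lift_definition one_linop :: "'a linop" is "\<lambda>x. x" by simp
lift_definition plus_linop :: "'a linop \<Rightarrow> 'a linop \<Rightarrow> 'a linop" is "\<lambda>f g x. f x + g x"
  by (simp add: cscale_simps add_ac)
lift_definition minus_linop :: "'a linop \<Rightarrow> 'a linop \<Rightarrow> 'a linop" is "\<lambda>f g x. f x - g x"
  by (simp add: cscale_diff)
lift_definition uminus_linop :: "'a linop \<Rightarrow> 'a linop" is "\<lambda>f x. - f x"
  by (simp add: cscale_minus)
lift_definition times_linop :: "'a linop \<Rightarrow> 'a linop \<Rightarrow> 'a linop" is "\<lambda>f g x. f (g x)"
  by simp

instance
proof
  show "(0 :: 'a linop) \<noteq> 1"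
  proof transfer
    have "(0 :: 'a \<Rightarrow>\<^sub>0 complex) \<noteq> Poly_Mapping.single undefined 1"
      using lookup_single_eq[of undefined "1 :: complex"] by (metis lookup_zero zero_neq_one)
    then show "(\<lambda>_. 0 :: 'a \<Rightarrow>\<^sub>0 complex) \<noteq> (\<lambda>x. x)" by metis
  qed
qed (transfer; simp add: fun_eq_iff algebra_simps)+

end

lift_definition smul :: "complex \<Rightarrow> 'a linop \<Rightarrow> 'a linop" is "\<lambda>c f x. cscale c (f x)"
  by (simp add: cscale_simps cscale_commute mult.commute)

lift_definition lin :: "('a \<Rightarrow> 'a \<Rightarrow>\<^sub>0 complex) \<Rightarrow> 'a linop" is lin_ext
  by (simp add: lin_ext_add lin_ext_cscale)

lemma app_simps [simp]:
  "app 0 x = 0" "app 1 x = x" "app (f + g) x = app f x + app g x" "app (f - g) x = app f x - app g x"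
  "app (- f) x = - app f x" "app (f * g) x = app f (app g x)" "app (smul c f) x = cscale c (app f x)"
  by (transfer; simp)+

lemma app_lin: "app (lin \<phi>) = lin_ext \<phi>"
  by transfer simp

lemma app_linear:
  "app f (x + y) = app f x + app f y" "app f (cscale c x) = cscale c (app f x)"
  by (transfer; simp)+

lemma app_zero [simp]: "app f 0 = 0"
  using app_linear(2)[of f 0 0] by (simp add: cscale_simps)

lemma app_minus: "app f (- x) = - app f x"
  using app_linear(2)[of f "-1" x] by (simp add: cscale_simps)

lemma app_diff: "app f (x - y) = app f x - app f y"
  using app_linear(1)[of f x "- y"] by (simp add: app_minus)

lemma app_sum: "app f (sum g A) = (\<Sum>a\<in>A. app f (g a))"
  by (induction A rule: infinite_finite_induct) (simp_all add: app_linear)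

lemma app_sum_left: "app (sum f A) x = (\<Sum>a\<in>A. app (f a) x)"
  by (induction A rule: infinite_finite_induct) simp_all

lemma linop_eqI: "(\<And>x. app f x = app g x) \<Longrightarrow> f = g"
  by transfer (simp add: fun_eq_iff)

lemma app_expand:
  "app f x = (\<Sum>a\<in>Poly_Mapping.keys x. cscale (Poly_Mapping.lookup x a) (app f (Poly_Mapping.single a 1)))"
proof -
  have "app f x = app f (\<Sum>a\<in>Poly_Mapping.keys x. cscale (Poly_Mapping.lookup x a) (Poly_Mapping.single a 1))"
    by (simp add: cscale_simps sum_single_keys)
  then show ?thesis by (simp add: app_sum app_linear)
qed

lemma linop_eq_on_single:
  assumes "\<And>a. app f (Poly_Mapping.single a 1) = app g (Poly_Mapping.single a 1)"
  shows "f = g"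
  by (rule linop_eqI) (subst (1 2) app_expand, simp add: assms)

lemma app_lin_single [simp]: "app (lin \<phi>) (Poly_Mapping.single a 1) = \<phi> a"
  by (simp add: app_lin lin_ext_single cscale_simps)

lemma smul_simps:
  "smul c (f + g) = smul c f + smul c g" "smul c (f - g) = smul c f - smul c g"
  "smul c (- f) = - smul c f" "smul c f * g = smul c (f * g)" "f * smul c g = smul c (f * g)"
  "smul c (smul d f) = smul (c * d) f" "smul 1 f = f" "smul 0 f = 0" "smul c 0 = 0"
  "smul (- c) f = - smul c f"
  by (rule linop_eqI; simp add: cscale_simps cscale_diff cscale_minus app_linear cscale_minus_left)+

lemma smul_add_left: "smul (c + d) f = smul c f + smul d f"
  by (rule linop_eqI) (simp add: cscale_simps)

lemma smul_sum: "smul c (sum f A) = (\<Sum>a\<in>A. smul c (f a))"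
  by (induction A rule: infinite_finite_induct) (simp_all add: smul_simps)

lemma smul_sign: "smul ((-1) ^ k) f = (-1) ^ k * f"
  by (simp add: minus_one_power_iff smul_simps)

lemma smul_of_int: "smul (of_int k) f = of_int k * f"
proof -
  have nat: "smul (of_nat n) f = of_nat n * f" for n
    by (induction n) (simp_all add: smul_simps smul_add_left distrib_right)
  show ?thesis
    by (cases k rule: int_cases2) (simp_all add: nat smul_simps)
qed

section \<open>Evaluation of free algebra elements at operators\<close>

definition ev :: "('g \<Rightarrow> 'a linop) \<Rightarrow> 'g free_alg \<Rightarrow> 'a linop" where
  "ev \<phi> f = (\<Sum>w\<in>Poly_Mapping.keys f. smul (Poly_Mapping.lookup f w) (prod_list (map \<phi> (letters w))))"

lemma ev_superset:
  assumes "finite A" "Poly_Mapping.keys f \<subseteq> A"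
  shows "ev \<phi> f = (\<Sum>w\<in>A. smul (Poly_Mapping.lookup f w) (prod_list (map \<phi> (letters w))))"
  unfolding ev_def using assms
  by (intro sum.mono_neutral_left) (auto simp: smul_simps in_keys_iff)

lemma ev_single: "ev \<phi> (Poly_Mapping.single w c) = smul c (prod_list (map \<phi> (letters w)))"
  by (subst ev_superset[of "{w}"]) auto

lemma ev_gen [simp]: "ev \<phi> (gen g) = \<phi> g"
  by (simp add: gen_def ev_single smul_simps)

lemma ev_zero [simp]: "ev \<phi> 0 = 0"
  by (simp add: ev_def)

lemma ev_one [simp]: "ev \<phi> 1 = 1"
  by (simp add: ev_single smul_simps flip: single_one)

lemma ev_add [simp]: "ev \<phi> (f + g) = ev \<phi> f + ev \<phi> g"
proof -
  let ?A = "Poly_Mapping.keys f \<union> Poly_Mapping.keys g"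
  have "Poly_Mapping.keys (f + g) \<subseteq> ?A" by (rule Poly_Mapping.keys_add)
  then show ?thesis
    using ev_superset[of ?A f \<phi>] ev_superset[of ?A g \<phi>] ev_superset[of ?A "f + g" \<phi>]
    by (simp add: lookup_add smul_add_left sum.distrib)
qed

lemma ev_cscale [simp]: "ev \<phi> (cscale c f) = smul c (ev \<phi> f)"
  by (subst ev_superset[OF _ keys_cscale]) (simp_all add: ev_def lookup_cscale smul_sum smul_simps)

lemma ev_minus [simp]: "ev \<phi> (- f) = - ev \<phi> f"
  using ev_cscale[of \<phi> "-1" f] by (simp add: cscale_simps smul_simps)

lemma ev_diff [simp]: "ev \<phi> (f - g) = ev \<phi> f - ev \<phi> g"
  using ev_add[of \<phi> f "- g"] by simp

lemma ev_sum [simp]: "ev \<phi> (sum f A) = (\<Sum>a\<in>A. ev \<phi> (f a))"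
  by (induction A rule: infinite_finite_induct) simp_all

lemma ev_mult [simp]: "ev \<phi> (f * g) = ev \<phi> f * ev \<phi> g"
proof -
  let ?k = Poly_Mapping.keys and ?l = Poly_Mapping.lookup
  have s: "ev \<phi> (Poly_Mapping.single u a * Poly_Mapping.single v b)
      = ev \<phi> (Poly_Mapping.single u a) * ev \<phi> (Poly_Mapping.single v b)" for u v a b
    by (simp add: mult_single ev_single smul_simps mult.commute)
  have "ev \<phi> ((\<Sum>w\<in>?k f. Poly_Mapping.single w (?l f w)) * (\<Sum>w\<in>?k g. Poly_Mapping.single w (?l g w)))
      = ev \<phi> (\<Sum>w\<in>?k f. Poly_Mapping.single w (?l f w)) * ev \<phi> (\<Sum>w\<in>?k g. Poly_Mapping.single w (?l g w))"
    unfolding sum_product ev_sum s ..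
  then show ?thesis by (simp only: sum_single_keys)
qed

lemma ev_supercomm:
  assumes "x \<in> homogeneous \<pi> a" and "y \<in> homogeneous \<pi> b"
  shows "ev \<phi> (supercomm \<pi> x y) = ev \<phi> x * ev \<phi> y - (-1) ^ (a * b) * (ev \<phi> y * ev \<phi> x)"
  by (simp add: supercomm_homogeneous[OF assms] smul_sign)

section \<open>Projections with a prescribed kernel\<close>

interpretation cvec: vector_space "cscale :: complex \<Rightarrow> ('a \<Rightarrow>\<^sub>0 complex) \<Rightarrow> _"
  by standard (simp_all add: cscale_simps)

text \<open>The identity has a linear left inverse g on \<open>K\<close>, that is, a retraction of
  the whole space onto \<open>K\<close>; the kernel of \<open>1 - g\<close> is then exactly
  \<open>K\<close>.\<close>

lemma subspace_projection:
  assumes "cvec.subspace K"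
  obtains P :: "'a linop" where "\<And>u. app P u = 0 \<longleftrightarrow> u \<in> K" and "\<And>u. u - app P u \<in> K"
proof -
  interpret vector_space_pair "cscale :: complex \<Rightarrow> ('a \<Rightarrow>\<^sub>0 complex) \<Rightarrow> _" "cscale :: complex \<Rightarrow> ('a \<Rightarrow>\<^sub>0 complex) \<Rightarrow> _" ..
  have "Vector_Spaces.linear cscale cscale (\<lambda>x :: 'a \<Rightarrow>\<^sub>0 complex. x)" by (rule cvec.linear_ident)
  from linear_exists_left_inverse_on[OF this assms]
  obtain g where g: "range g \<subseteq> K" "Vector_Spaces.linear cscale cscale g" "\<And>v. v \<in> K \<Longrightarrow> g v = v" by auto
  interpret g: Vector_Spaces.linear cscale cscale g by fact
  define P where "P = 1 - Linop g"
  have "app (Linop g) = g" using g.add g.scale by (subst Linop_inverse) auto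
  then have P: "app P u = u - g u" for u by (simp add: P_def)
  show ?thesis
  proof (rule that)
    have "g u \<in> K" for u using g(1) by blast
    then show "app P u = 0 \<longleftrightarrow> u \<in> K" for u using g(3)[of u] unfolding P right_minus_eq by metis
    show "u - app P u \<in> K" for u using g(1) by (auto simp: P)
  qed
qed

section \<open>Jucys-Murphy type elements\<close>

lemma presented_class_rel:
  assumes "R \<subseteq> carrier (free_algebra G)" "r \<in> R"
  shows "presented_class G R r = presented_class G R 0"
proof -
  interpret ring "free_algebra G" by (rule free_algebra_ring)
  interpret I: ideal "genideal (free_algebra G) R" "free_algebra G"
    by (rule genideal_ideal[OF assms(1)])
  have "r \<in> genideal (free_algebra G) R" using genideal_self[OF assms(1)] assms(2) by blast
  moreover have "0 \<in> genideal (free_algebra G) R"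
    using I.zero_closed by (simp add: free_algebra_def)
  ultimately show ?thesis by (simp add: presented_class_def I.a_rcos_const)
qed

text \<open>An arbitrary but fixed choice. The two properties force idempotence, since
  \<open>u\<close> and its image differ by an element of the kernel.\<close>

definition proj :: "('a \<Rightarrow>\<^sub>0 complex) set \<Rightarrow> 'a linop" where
  "proj K = (SOME P. (\<forall>u. app P u = 0 \<longleftrightarrow> u \<in> K) \<and> (\<forall>u. u - app P u \<in> K))"

lemma proj:
  assumes "cvec.subspace K"
  shows "app (proj K) u = 0 \<longleftrightarrow> u \<in> K" "u - app (proj K) u \<in> K"
proof -
  have "\<exists>P :: 'a linop. (\<forall>u. app P u = 0 \<longleftrightarrow> u \<in> K) \<and> (\<forall>u. u - app P u \<in> K)"
    using subspace_projection[OF assms] by metis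
  from someI_ex[OF this] show "app (proj K) u = 0 \<longleftrightarrow> u \<in> K" "u - app (proj K) u \<in> K"
    by (simp_all add: proj_def)
qed

text \<open>The quotient by the span of \<open>Rel\<close> is realised as the range of a projection with that kernel.\<close>

definition desc :: "('a \<Rightarrow>\<^sub>0 complex) set \<Rightarrow> 'a linop \<Rightarrow> 'a linop" where
  "desc Rel A = proj (cvec.span Rel) * A"

abbreviation rep :: "('a \<Rightarrow>\<^sub>0 complex) set \<Rightarrow> 'a \<Rightarrow> ('a \<Rightarrow>\<^sub>0 complex)" where
  "rep Rel a \<equiv> app (proj (cvec.span Rel)) (Poly_Mapping.single a 1)"

lemma proj_span_iff: "app (proj (cvec.span Rel)) u = 0 \<longleftrightarrow> u \<in> cvec.span Rel"
  by (rule proj(1)) simp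

lemma proj_rel: "u \<in> Rel \<Longrightarrow> app (proj (cvec.span Rel)) u = 0"
  by (simp add: proj_span_iff cvec.span_base)

text \<open>\<open>u\<close> and its projection differ by an element of the span, which the operator
  kills by linearity. Consequently products of descended operators can be computed without
  intermediate projections.\<close>

lemma desc_proj:
  assumes "\<And>u. u \<in> Rel \<Longrightarrow> app (desc Rel A) u = 0"
  shows "app (desc Rel A) (app (proj (cvec.span Rel)) u) = app (desc Rel A) u"
proof -
  have "app (desc Rel A) v = 0" if "v \<in> cvec.span Rel" for v
    using that by (induction rule: cvec.span_induct_alt) (simp_all add: app_linear cscale_simps assms)
  from this[OF proj(2)] show ?thesis by (simp add: app_diff)
qed

lemma span_lin_ext_zero:
  assumes "\<And>u. u \<in> Rel \<Longrightarrow> lin_ext f u = 0" "u \<in> cvec.span Rel"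
  shows "lin_ext f u = 0"
  using assms(2)
  by (induction rule: cvec.span_induct_alt) (simp_all add: lin_ext_zero lin_ext_add lin_ext_cscale cscale_simps assms(1))

lemma lin_ext_single_diff: "lin_ext f (u - v) = lin_ext f u - lin_ext f v"
  using app_diff[of "lin _" u v]
  by (metis (no_types) add_diff_cancel diff_add_cancel lin_ext_add)

section \<open>Sums of transpositions and of the elements x_i y_i\<close>

locale transposition_ops =
  fixes l :: nat and S :: "nat \<Rightarrow> nat \<Rightarrow> 'a::ring_1" and z :: "nat \<Rightarrow> 'a"
  assumes S_sym: "i \<in> {1..l} \<Longrightarrow> j \<in> {1..l} \<Longrightarrow> S i j = S j i"
    and S_S: "\<lbrakk>i \<in> {1..l}; j \<in> {1..l}; a \<in> {1..l}; b \<in> {1..l}; i \<noteq> j; a \<noteq> b\<rbrakk> \<Longrightarrow>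
      S i j * S a b = S (transpose i j a) (transpose i j b) * S i j"
    and S_z: "\<lbrakk>i \<in> {1..l}; j \<in> {1..l}; a \<in> {1..l}; i \<noteq> j\<rbrakk> \<Longrightarrow> S i j * z a = z (transpose i j a) * S i j"
    and z_z: "\<lbrakk>i \<in> {1..l}; j \<in> {1..l}; i \<noteq> j\<rbrakk> \<Longrightarrow> z i * z j - z j * z i = (z j - z i) * S i j"
begin

definition inner_swaps :: "nat set \<Rightarrow> 'a" where "inner_swaps A = (\<Sum>(a, b)\<in>{(a, b). a \<in> A \<and> b \<in> A \<and> a \<noteq> b}. S a b)"

definition cross_swaps :: "nat set \<Rightarrow> nat set \<Rightarrow> 'a" where "cross_swaps A C = (\<Sum>a\<in>A. \<Sum>c\<in>C. S a c)"

definition sum_z :: "nat set \<Rightarrow> 'a" where "sum_z A = (\<Sum>a\<in>A. z a)"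

text \<open>\<open>inner_swaps\<close> runs over ordered pairs and so counts each transposition
  inside \<open>A\<close> twice. Hence this is twice the sum of \<open>z\<close> over
  \<open>A\<close>, of the transpositions inside \<open>A\<close>, and of those between
  \<open>A\<close> and \<open>C\<close>; the doubling avoids halves in the ring.\<close>

definition level_op :: "nat set \<Rightarrow> nat set \<Rightarrow> 'a" where "level_op A C = 2 * sum_z A + inner_swaps A + 2 * cross_swaps A C"

text \<open>The transposition of \<open>i\<close> and \<open>j\<close> permutes the ordered pairs in
  \<open>D\<close>. Invariance is phrased as commutation because \<open>S i j\<close> need not be
  invertible: it is a transposition times a parameter that may be 0.\<close>

lemma S_T:
  assumes "D \<subseteq> {1..l}" "i \<in> D" "j \<in> D" "i \<noteq> j"
  shows "S i j * inner_swaps D = inner_swaps D * S i j"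
proof -
  let ?P = "{(a, b). a \<in> D \<and> b \<in> D \<and> a \<noteq> b}" and ?t = "transpose i j"
  have t: "?t a \<in> D" if "a \<in> D" for a using that assms by (auto simp: transpose_def)
  have "S i j * inner_swaps D = (\<Sum>(a, b)\<in>?P. S (?t a) (?t b) * S i j)"
    unfolding inner_swaps_def sum_distrib_left using assms
    by (intro sum.cong refl) (auto intro!: S_S)
  also have "\<dots> = (\<Sum>(a, b)\<in>?P. S a b * S i j)"
    by (rule sum.reindex_bij_witness[of _ "map_prod ?t ?t" "map_prod ?t ?t"])
      (use assms(2,3) in \<open>auto simp: t transpose_involutory transpose_eq_iff\<close>)
  finally show ?thesis by (simp add: inner_swaps_def sum_distrib_right case_prod_unfold)
qed

lemma sum_commute:
  fixes x :: 'a
  shows "(\<And>a. a \<in> A \<Longrightarrow> f a * x = x * f a) \<Longrightarrow> sum f A * x = x * sum f A"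
  by (simp add: sum_distrib_left sum_distrib_right)

lemma T_T: "C \<subseteq> D \<Longrightarrow> D \<subseteq> {1..l} \<Longrightarrow> inner_swaps C * inner_swaps D = inner_swaps D * inner_swaps C"
  unfolding inner_swaps_def[of C] by (intro sum_commute) (auto intro!: S_T)

lemma S_z_commute:
  "\<lbrakk>i \<in> {1..l}; j \<in> {1..l}; a \<in> {1..l}; i \<noteq> j; a \<noteq> i; a \<noteq> j\<rbrakk> \<Longrightarrow> S i j * z a = z a * S i j"
  by (simp add: S_z transpose_def)

lemma T_Z:
  assumes "D \<subseteq> {1..l}" "A \<subseteq> {1..l}" "A \<inter> D = {}"
  shows "inner_swaps D * sum_z A = sum_z A * inner_swaps D"
proof -
  have "inner_swaps D * z a = z a * inner_swaps D" if "a \<in> A" for a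
    unfolding inner_swaps_def using that assms by (intro sum_commute) (auto intro!: S_z_commute)
  then show ?thesis unfolding sum_z_def by (intro sum_commute[symmetric]) simp
qed

lemma T_union:
  assumes "A \<subseteq> {1..l}" "C \<subseteq> {1..l}" "A \<inter> C = {}"
  shows "inner_swaps (A \<union> C) = inner_swaps A + inner_swaps C + 2 * cross_swaps A C"
proof -
  have fin: "finite A" "finite C" using assms finite_subset by blast+
  let ?P = "\<lambda>D. {(a, b). a \<in> D \<and> b \<in> D \<and> a \<noteq> b}"
  have P: "?P (A \<union> C) = (?P A \<union> ?P C) \<union> (A \<times> C \<union> C \<times> A)" using assms(3) by auto
  have f: "finite (?P A)" "finite (?P C)" using fin by (auto intro: finite_subset[of _ "A \<times> A"] finite_subset[of _ "C \<times> C"])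
  have "inner_swaps (A \<union> C) = inner_swaps A + inner_swaps C + ((\<Sum>(a, b)\<in>A \<times> C. S a b) + (\<Sum>(a, b)\<in>C \<times> A. S a b))"
    unfolding inner_swaps_def P using assms(3) f fin
    by (subst sum.union_disjoint; auto simp: sum.union_disjoint)+
  also have "(\<Sum>(a, b)\<in>C \<times> A. S a b) = (\<Sum>(a, b)\<in>A \<times> C. S a b)"
    by (rule sum.reindex_bij_witness[of _ prod.swap prod.swap]) (use assms in \<open>auto intro!: S_sym\<close>)
  finally show ?thesis
    by (simp add: cross_swaps_def sum.cartesian_product mult_2)
qed

lemma Z_Z:
  assumes "A \<subseteq> {1..l}" "B \<subseteq> {1..l}" "A \<inter> B = {}"
  shows "sum_z A * sum_z B - sum_z B * sum_z A = (\<Sum>b\<in>B. \<Sum>a\<in>A. (z b - z a) * S b a)"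
proof -
  have "sum_z A * sum_z B - sum_z B * sum_z A = (\<Sum>b\<in>B. \<Sum>a\<in>A. z a * z b - z b * z a)"
    unfolding sum_z_def sum_product sum_subtractf by (simp add: sum.swap[of _ A])
  also have "\<dots> = (\<Sum>b\<in>B. \<Sum>a\<in>A. (z b - z a) * S b a)"
    using assms by (intro sum.cong refl) (metis IntI S_sym empty_iff subsetD z_z)
  finally show ?thesis .
qed

text \<open>Since \<open>B\<close> is disjoint from \<open>C\<close>, the element \<open>z a\<close>
  fails to commute with \<open>S b c\<close> only for c = a. The surviving terms are the negatives
  of those in \<open>Z_Z\<close>.\<close>

lemma Z_U:
  assumes "A \<subseteq> C" "C \<subseteq> {1..l}" "B \<subseteq> {1..l}" "B \<inter> C = {}"
  shows "sum_z A * cross_swaps B C - cross_swaps B C * sum_z A = (\<Sum>b\<in>B. \<Sum>a\<in>A. (z a - z b) * S b a)"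
proof -
  have fin: "finite C" "finite A" using assms finite_subset by (blast, metis finite_atLeastAtMost finite_subset)
  have 1: "z a * S b c - S b c * z a = (if c = a then (z a - z b) * S b c else 0)"
    if "a \<in> A" "b \<in> B" "c \<in> C" for a b c
  proof -
    have "b \<in> {1..l}" "c \<in> {1..l}" "a \<in> {1..l}" "b \<noteq> c" "a \<noteq> b" using assms that by auto
    then show ?thesis
      using S_z_commute[of b c a] S_z[of b c a] by (auto simp: transpose_def left_diff_distrib)
  qed
  have "sum_z A * cross_swaps B C - cross_swaps B C * sum_z A = (\<Sum>b\<in>B. \<Sum>c\<in>C. \<Sum>a\<in>A. z a * S b c - S b c * z a)"
    unfolding sum_z_def cross_swaps_def sum_distrib_left sum_distrib_right sum_subtractf
    by (subst sum.swap, subst (2) sum.swap) (simp add: sum.swap[of _ A])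
  also have "\<dots> = (\<Sum>b\<in>B. \<Sum>c\<in>C. \<Sum>a\<in>A. if c = a then (z a - z b) * S b c else 0)"
    by (intro sum.cong refl 1)
  also have "\<dots> = (\<Sum>b\<in>B. \<Sum>a\<in>A. \<Sum>c\<in>C. if c = a then (z a - z b) * S b c else 0)"
    by (simp add: sum.swap[of _ C])
  also have "\<dots> = (\<Sum>b\<in>B. \<Sum>a\<in>A. (z a - z b) * S b a)"
    using assms(1) fin by (intro sum.cong refl) (auto simp: sum.delta')
  finally show ?thesis .
qed

text \<open>The Jucys-Murphy type elements \<open>inner_swaps A + 2 cross_swaps A C = inner_swaps (A \<union> C) - inner_swaps C\<close> commute because
  each \<open>inner_swaps D\<close> is central among the transpositions of \<open>D\<close>; the remaining commutators of
  \<open>sum_z A\<close> with \<open>sum_z B\<close> and with \<open>cross_swaps B C\<close> cancel.\<close>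

lemma X_commute:
  assumes "A \<subseteq> {1..l}" "C \<subseteq> {1..l}" "B \<subseteq> {1..l}" "D \<subseteq> {1..l}"
    and "A \<inter> C = {}" "B \<inter> D = {}" "A \<union> C \<subseteq> D"
  shows "level_op A C * level_op B D = level_op B D * level_op A C"
proof -
  have XA: "level_op A C = 2 * sum_z A + (inner_swaps (A \<union> C) - inner_swaps C)" and XB: "level_op B D = 2 * sum_z B + (inner_swaps (B \<union> D) - inner_swaps D)"
    using assms by (simp_all add: level_op_def T_union algebra_simps)
  have 1: "(inner_swaps (A \<union> C) - inner_swaps C) * (inner_swaps (B \<union> D) - inner_swaps D) = (inner_swaps (B \<union> D) - inner_swaps D) * (inner_swaps (A \<union> C) - inner_swaps C)"
  proof -
    have "inner_swaps (A \<union> C) * inner_swaps (B \<union> D) = inner_swaps (B \<union> D) * inner_swaps (A \<union> C)" "inner_swaps C * inner_swaps (B \<union> D) = inner_swaps (B \<union> D) * inner_swaps C"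
      "inner_swaps (A \<union> C) * inner_swaps D = inner_swaps D * inner_swaps (A \<union> C)" "inner_swaps C * inner_swaps D = inner_swaps D * inner_swaps C"
      using assms by (auto intro!: T_T)
    then show ?thesis by (simp add: algebra_simps)
  qed
  have 2: "(inner_swaps (A \<union> C) - inner_swaps C) * sum_z B = sum_z B * (inner_swaps (A \<union> C) - inner_swaps C)"
  proof -
    have "B \<inter> (A \<union> C) = {}" "B \<inter> C = {}" "A \<union> C \<subseteq> {1..l}" using assms by blast+
    then show ?thesis using T_Z[of "A \<union> C" B] T_Z[of C B] assms by (simp add: algebra_simps)
  qed
  have "A \<inter> B = {}" using assms by blast
  then have "sum_z A * inner_swaps B = inner_swaps B * sum_z A" using T_Z[of B A] assms by simp
  moreover have "inner_swaps (B \<union> D) - inner_swaps D = inner_swaps B + 2 * cross_swaps B D" using assms by (simp add: T_union)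
  moreover have "sum_z A * sum_z B - sum_z B * sum_z A + (sum_z A * cross_swaps B D - cross_swaps B D * sum_z A) = 0"
    using assms by (subst Z_Z, simp, simp, blast, subst Z_U)
      (auto simp: left_diff_distrib simp flip: sum.distrib)
  ultimately have 3: "2 * (sum_z A * sum_z B - sum_z B * sum_z A) + (sum_z A * (inner_swaps (B \<union> D) - inner_swaps D) - (inner_swaps (B \<union> D) - inner_swaps D) * sum_z A) = 0"
    by (simp add: algebra_simps mult_2) 
  \<comment> \<open>Commutator of two level operators in the form 2 a + P and 2 b + Q; its three
    summands vanish by the facts 3, 2 and 1.\<close>
  have "(2 * a + P) * (2 * b + Q) - (2 * b + Q) * (2 * a + P)
      = 2 * (2 * (a * b - b * a) + (a * Q - Q * a)) + 2 * (P * b - b * P) + (P * Q - Q * P)" for a b P Q :: 'a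
    by (simp add: algebra_simps mult_2)
  from this[of "sum_z A" "inner_swaps (A \<union> C) - inner_swaps C" "sum_z B" "inner_swaps (B \<union> D) - inner_swaps D"] show ?thesis
    unfolding XA XB 1 2 3 by simp
qed

end

section \<open>Quadratic identities for the general linear superalgebra\<close>

text \<open>The commutation relation is oriented as a rewrite rule. \<open>E_odd\<close> is a
  separate axiom because \<open>EE\<close> only yields that twice the square vanishes, and 2 need
  not be cancellable in \<open>'a\<close>.\<close>

locale gl_ops =
  fixes N :: nat and s :: "nat \<Rightarrow> nat" and E :: "nat \<Rightarrow> nat \<Rightarrow> 'a::ring_1"
  assumes s01: "s i = 0 \<or> s i = 1"
    and EE: "\<lbrakk>a \<in> {1..N}; b \<in> {1..N}; c \<in> {1..N}; d \<in> {1..N}\<rbrakk> \<Longrightarrow>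
      E a b * E c d = (if b = c then E a d else 0)
        + (-1) ^ ((s a + s b) * (s c + s d)) * (E c d * E a b - (if a = d then E c b else 0))"
    and E_odd: "\<lbrakk>a \<in> {1..N}; b \<in> {1..N}; s a \<noteq> s b\<rbrakk> \<Longrightarrow> E a b * E a b = 0"
begin

definition sg :: "nat \<Rightarrow> 'a" where "sg i = (-1) ^ s i"

text \<open>The Koszul sign for exchanging \<open>E a b\<close> with \<open>E c d\<close>.\<close>

definition ks :: "nat \<Rightarrow> nat \<Rightarrow> nat \<Rightarrow> nat \<Rightarrow> 'a" where
  "ks a b c d = (-1) ^ ((s a + s b) * (s c + s d))"

text \<open>Partial sums: the signs \<open>sgn (k - i)\<close> in the quadratic elements are handled by writing those
  elements as combinations of \<open>L N\<close>, \<open>L i\<close> and \<open>L (i - 1)\<close>.\<close>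

definition L :: "nat \<Rightarrow> nat \<Rightarrow> nat \<Rightarrow> 'a" where
  "L r c d = (\<Sum>k = 1..r. sg k * (E c k * E k d))"

lemma L_Suc: "L (Suc r) c d = L r c d + sg (Suc r) * (E c (Suc r) * E (Suc r) d)"
  by (simp add: L_def)

lemma L_0: "L 0 c d = 0"
  by (simp add: L_def)

text \<open>Moving \<open>E a b\<close> past the terms with k = b and k = a creates two extra
  products that cancel each other. For a truncated sum they cancel only if both or neither of
  \<open>a\<close>, \<open>b\<close> are at most \<open>r\<close>; otherwise the last summand
  remains as a boundary term. For r = N the element \<open>L N c d\<close> transforms exactly like
  \<open>E c d\<close>.\<close>

lemma E_L:
  assumes "a \<in> {1..N}" "b \<in> {1..N}" "c \<in> {1..N}" "d \<in> {1..N}" "r \<le> N"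
  shows "E a b * L r c d = (if b = c then L r a d else 0)
      + ks a b c d * (L r c d * E a b - (if a = d then L r c b else 0))
      + (of_bool (b \<le> r) - of_bool (a \<le> r)) * (sg b * ks a b c b * (E c b * E a d))"
  using assms(5)
proof (induction r)
  case 0
  then show ?case using assms by (simp add: L_0)
next
  case (Suc r)
  let ?k = "Suc r"
  have k: "?k \<in> {1..N}" using Suc.prems by simp
  have "E a b * (E c ?k * E ?k d) = (E a b * E c ?k) * E ?k d" by (simp add: mult.assoc)
  also have "\<dots> = (if b = c then E a ?k * E ?k d else 0)
      + ks a b c ?k * (E c ?k * (E a b * E ?k d) - (if a = ?k then E c b * E ?k d else 0))"
    by (subst EE) (use assms k in \<open>auto simp: ks_def algebra_simps\<close>)
  also have "E a b * E ?k d = (if b = ?k then E a d else 0)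
      + ks a b ?k d * (E ?k d * E a b - (if a = d then E ?k b else 0))"
    by (subst EE) (use assms k in \<open>auto simp: ks_def\<close>)
  finally have step: "E a b * (E c ?k * E ?k d) = (if b = c then E a ?k * E ?k d else 0)
      + ks a b c ?k * (E c ?k * ((if b = ?k then E a d else 0)
      + ks a b ?k d * (E ?k d * E a b - (if a = d then E ?k b else 0))) - (if a = ?k then E c b * E ?k d else 0))" .
  have "E a b * (sg ?k * (E c ?k * E ?k d)) = sg ?k * (E a b * (E c ?k * E ?k d))"
    using s01[of ?k] by (auto simp: sg_def)
  also have "\<dots> = (if b = c then sg ?k * (E a ?k * E ?k d) else 0)
      + ks a b c d * (sg ?k * (E c ?k * E ?k d) * E a b - (if a = d then sg ?k * (E c ?k * E ?k b) else 0))
      + (of_bool (b = ?k) - of_bool (a = ?k)) * (sg b * ks a b c b * (E c b * E a d))"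
    unfolding step
    using s01[of a] s01[of b] s01[of c] s01[of d] s01[of ?k]
    by (elim disjE) (auto simp: sg_def ks_def algebra_simps)
  finally have T: "E a b * (sg ?k * (E c ?k * E ?k d)) = \<dots>" .
  have "of_bool (b \<le> ?k) = of_bool (b \<le> r) + (of_bool (b = ?k) :: 'a)" for b
    by (auto simp: le_Suc_eq)
  then show ?case
    using Suc unfolding L_Suc distrib_left T
    by (auto simp add: algebra_simps)
qed

text \<open>Coefficients such as Cartan entries and shifts are kept as integers, because their
  images under \<open>of_int\<close> are central in every ring.\<close>

definition sg_int :: "nat \<Rightarrow> int" where "sg_int i = (-1) ^ s i"

definition h :: "nat \<Rightarrow> 'a" where "h i = sg i * E i i - sg (i + 1) * E (i + 1) (i + 1)"

definition cart :: "nat \<Rightarrow> nat \<Rightarrow> int" where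
  "cart i j = (if j = i then sg_int i + sg_int (i + 1) else if j = i + 1 then - sg_int (i + 1)
     else if i = j + 1 then - sg_int i else 0)"

definition shf :: "nat \<Rightarrow> int" where "shf i = (\<Sum>j = i + 2..N. sg_int j)"

definition outer :: "nat \<Rightarrow> nat set \<Rightarrow> nat \<Rightarrow> nat \<Rightarrow> 'a" where
  "outer i D c d = (\<Sum>k\<in>{1..N} - D. sg k * of_int (sgn (int k - int i)) * (E c k * E k d))"

text \<open>\<open>th2\<close>, \<open>wp2\<close>, \<open>wm2\<close> are \<open>2\<vartheta>\<close>, \<open>2\<varpi>\<^sup>+\<close>, \<open>2\<varpi>\<^sup>-\<close>, so that no division is needed in the ring.\<close>

definition th2 :: "nat \<Rightarrow> 'a" where
  "th2 i = - of_int (shf (i - 1)) * h i + sg i * outer i {i} i i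
     - sg (i + 1) * outer (i + 1) {i + 1} (i + 1) (i + 1)"

definition wp2 :: "nat \<Rightarrow> 'a" where
  "wp2 i = - of_int (shf i) * E i (i + 1) + outer i {i, i + 1} i (i + 1) - h i * E i (i + 1)"

definition wm2 :: "nat \<Rightarrow> 'a" where
  "wm2 i = - of_int (shf i) * (sg i * E (i + 1) i) + sg i * outer i {i, i + 1} (i + 1) i
     - sg i * E (i + 1) i * h i"

text \<open>The sign sgn (k - i) is -1 below \<open>i\<close> and +1 above \<open>j\<close>, so the
  sum is an upper tail of \<open>L\<close> minus an initial segment.\<close>

lemma outer_L:
  assumes "1 \<le> i" "i \<le> j" "j \<le> N"
  shows "outer i {i..j} c d = L N c d - L j c d - L (i - 1) c d"
proof -
  let ?f = "\<lambda>k. sg k * (E c k * E k d)"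
  have D: "{1..N} - {i..j} = {1..i - 1} \<union> {j + 1..N}" "{1..i - 1} \<inter> {j + 1..N} = {}"
    using assms by auto
  have "outer i {i..j} c d = (\<Sum>k\<in>{1..i - 1}. - ?f k) + (\<Sum>k\<in>{j + 1..N}. ?f k)"
    unfolding outer_def D(1)
    by (subst sum.union_disjoint) (use D(2) assms in \<open>auto intro!: arg_cong2[where f = "(+)"] sum.cong\<close>)
  moreover have "L N c d = L j c d + (\<Sum>k\<in>{j + 1..N}. ?f k)"
    unfolding L_def using assms sum.ub_add_nat[of 1 j ?f "N - j"] by simp
  ultimately show ?thesis by (simp add: L_def sum_negf)
qed

lemma outer_simps:
  "1 \<le> i \<Longrightarrow> i \<le> N \<Longrightarrow> outer i {i} c d = L N c d - L i c d - L (i - 1) c d"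
  "1 \<le> i \<Longrightarrow> i + 1 \<le> N \<Longrightarrow> outer i {i, i + 1} c d = L N c d - L (i + 1) c d - L (i - 1) c d"
  "1 \<le> i \<Longrightarrow> i + 1 \<le> N \<Longrightarrow> outer i {i, Suc i} c d = L N c d - L (i + 1) c d - L (i - 1) c d"
proof -
  show "1 \<le> i \<Longrightarrow> i \<le> N \<Longrightarrow> outer i {i} c d = L N c d - L i c d - L (i - 1) c d"
    using outer_L[of i i] by simp
  have "{i..i + 1} = {i, i + 1}" by auto
  then show "1 \<le> i \<Longrightarrow> i + 1 \<le> N \<Longrightarrow> outer i {i, i + 1} c d = L N c d - L (i + 1) c d - L (i - 1) c d"
    "1 \<le> i \<Longrightarrow> i + 1 \<le> N \<Longrightarrow> outer i {i, Suc i} c d = L N c d - L (i + 1) c d - L (i - 1) c d"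
    using outer_L[of i "i + 1"] by simp_all
qed

lemma shf_rec: "i + 2 \<le> N \<Longrightarrow> shf i = sg_int (i + 2) + shf (i + 1)"
  unfolding shf_def using sum.atLeast_Suc_atMost[of "i + 2" N sg_int] by simp

lemma EE':
  "\<lbrakk>a \<in> {1..N}; b \<in> {1..N}; c \<in> {1..N}; d \<in> {1..N}\<rbrakk> \<Longrightarrow>
    E a b * E c d = (if b = c then E a d else 0) + ks a b c d * (E c d * E a b - (if a = d then E c b else 0))"
  unfolding ks_def by (rule EE)

lemma EE3:
  assumes "a \<in> {1..N}" "b \<in> {1..N}" "c \<in> {1..N}" "d \<in> {1..N}"
  shows "E a b * (E c d * z) = (if b = c then E a d * z else 0)
    + ks a b c d * (E c d * (E a b * z) - (if a = d then E c b * z else 0))"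
proof -
  have "E a b * (E c d * z) = (E a b * E c d) * z" by (simp add: mult.assoc)
  then show ?thesis by (simp add: EE'[OF assms] distrib_right left_diff_distrib right_diff_distrib mult.assoc)
qed

text \<open>The ring carries no grading, so the parities of the two arguments are passed
  explicitly.\<close>

definition br :: "nat \<Rightarrow> nat \<Rightarrow> 'a \<Rightarrow> 'a \<Rightarrow> 'a" where
  "br q r x y = x * y - (-1) ^ (q * r) * (y * x)"

definition pt :: "nat \<Rightarrow> nat" where "pt i = (if s i \<noteq> s (i + 1) then 1 else 0)"

lemma of_int_left: "x * (of_int z * y) = of_int z * (x * y)" "x * of_int z = of_int z * x" for x y :: 'a
proof -
  show "x * of_int z = of_int z * x" by (simp add: mult_of_int_commute)
  then show "x * (of_int z * y) = of_int z * (x * y)" by (simp flip: mult.assoc)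
qed

lemma central_left:
  "E a b * (2 * y) = 2 * (E a b * y)" "L r a b * (2 * y) = 2 * (L r a b * y)"
  "E a b * (of_int z * y) = of_int z * (E a b * y)" "L r a b * (of_int z * y) = of_int z * (L r a b * y)"
  using of_int_left(1)[where z = 2] of_int_left(1) by auto

lemma shf_Suc: "i + 2 \<le> N \<Longrightarrow> shf (Suc i) = shf i - sg_int (i + 2)"
  using shf_rec[of i] by simp

lemma E_odd': "s a \<noteq> s b \<Longrightarrow> a \<in> {1..N} \<Longrightarrow> b \<in> {1..N} \<Longrightarrow> E a b * (E a b * z) = 0"
  using E_odd[of a b] by (simp flip: mult.assoc)

lemmas gl_norm = ring_distribs mult.assoc central_left shf_Suc ks_def sg_int_def

lemmas gl_defs = br_def th2_def wp2_def wm2_def outer_simps L_Suc h_def cart_def sg_def sg_int_def ks_def pt_def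

text \<open>The guards keep the rewriting of \<open>E a b * E a b\<close> from looping.\<close>

lemma EE_move:
  "\<lbrakk>c \<noteq> a \<or> d \<noteq> b; a \<in> {1..N}; b \<in> {1..N}; c \<in> {1..N}; d \<in> {1..N}\<rbrakk> \<Longrightarrow>
    E a b * E c d = (if b = c then E a d else 0) + ks a b c d * (E c d * E a b - (if a = d then E c b else 0))"
  by (rule EE')

lemma EE3_move:
  "\<lbrakk>c \<noteq> a \<or> d \<noteq> b; a \<in> {1..N}; b \<in> {1..N}; c \<in> {1..N}; d \<in> {1..N}\<rbrakk> \<Longrightarrow>
    E a b * (E c d * z) = (if b = c then E a d * z else 0)
    + ks a b c d * (E c d * (E a b * z) - (if a = d then E c b * z else 0))"
  by (rule EE3)

section \<open>Brackets at equal and adjacent nodes\<close>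

context
  fixes k :: nat
begin

private abbreviation (input) "k1 \<equiv> Suc k"
private abbreviation (input) "k2 \<equiv> Suc (Suc k)"
private abbreviation (input) "k3 \<equiv> Suc (Suc (Suc k))"

text \<open>This lemma and its companions below compare normal forms. Splitting by parities turns
  every sign into a number, and the linear generator is moved to the right past all \<open>L\<close>
  and \<open>E\<close>. Nodes are written with \<open>Suc\<close> so that index comparisons are
  decided by rewriting.\<close>

lemma th2_plus_same:
  assumes "k2 \<le> N"
  shows "br 0 (pt k1) (th2 k1) (E k1 k2) = of_int (cart k1 k1) * wp2 k1"
proof -
  note M = E_L[of k1 k2] EE_move[of _ k1 _ k2] EE3_move[of _ k1 _ k2]
  show ?thesis
    using assms s01[of k1] s01[of k2] E_odd[of k1 k2] E_odd'[of k1 k2]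
    by (elim disjE) (simp add: gl_defs; simp add: gl_norm M; simp add: algebra_simps mult_2)+
qed

lemma th2_minus_same:
  assumes "k2 \<le> N"
  shows "br 0 (pt k1) (th2 k1) (sg k1 * E k2 k1) = - of_int (cart k1 k1) * wm2 k1"
proof -
  note M = E_L[of k2 k1] EE_move[of _ k2 _ k1] EE3_move[of _ k2 _ k1]
  show ?thesis
    using assms s01[of k1] s01[of k2] E_odd[of k2 k1] E_odd'[of k2 k1]
    by (elim disjE) (simp add: gl_defs; simp add: gl_norm M; simp add: algebra_simps mult_2)+
qed

lemma wp2_minus_same:
  assumes "k2 \<le> N"
  shows "br (pt k1) (pt k1) (wp2 k1) (sg k1 * E k2 k1) = th2 k1 - h k1 * h k1"
proof -
  note M = E_L[of k2 k1] EE_move[of _ k2 _ k1] EE3_move[of _ k2 _ k1]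
  show ?thesis
    using assms s01[of k1] s01[of k2] E_odd[of k2 k1] E_odd'[of k2 k1]
    by (elim disjE) (simp add: gl_defs; simp add: gl_norm M; simp add: algebra_simps mult_2)+
qed

lemma plus_wm2_same:
  assumes "k2 \<le> N"
  shows "br (pt k1) (pt k1) (E k1 k2) (wm2 k1) = th2 k1 - h k1 * h k1"
proof -
  note M = E_L[of k1 k2] EE_move[of _ k1 _ k2] EE3_move[of _ k1 _ k2]
  show ?thesis
    using assms s01[of k1] s01[of k2] E_odd[of k1 k2] E_odd'[of k1 k2]
    by (elim disjE) (simp add: gl_defs; simp add: gl_norm M; simp add: algebra_simps mult_2)+
qed

lemma th2_plus_next:
  assumes "k3 \<le> N"
  shows "br 0 (pt k2) (th2 k1) (E k2 k3) = of_int (cart k1 k2) * wp2 k2"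
proof -
  note M = E_L[of k2 k3] EE_move[of _ k2 _ k3] EE3_move[of _ k2 _ k3]
  show ?thesis
    using assms s01[of k1] s01[of k2] s01[of k3] E_odd[of k2 k3] E_odd'[of k2 k3]
    by (elim disjE) (simp add: gl_defs; simp add: gl_norm M; simp add: algebra_simps mult_2)+
qed

lemma th2_minus_next:
  assumes "k3 \<le> N"
  shows "br 0 (pt k2) (th2 k1) (sg k2 * E k3 k2) = - of_int (cart k1 k2) * wm2 k2"
proof -
  note M = E_L[of k3 k2] EE_move[of _ k3 _ k2] EE3_move[of _ k3 _ k2]
  show ?thesis
    using assms s01[of k1] s01[of k2] s01[of k3] E_odd[of k3 k2] E_odd'[of k3 k2]
    by (elim disjE) (simp add: gl_defs; simp add: gl_norm M; simp add: algebra_simps mult_2)+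
qed

lemma wp2_minus_next:
  assumes "k3 \<le> N"
  shows "br (pt k1) (pt k2) (wp2 k1) (sg k2 * E k3 k2) = 0"
proof -
  note M = E_L[of k3 k2] EE_move[of _ k3 _ k2] EE3_move[of _ k3 _ k2]
  show ?thesis
    using assms s01[of k1] s01[of k2] s01[of k3] E_odd[of k3 k2] E_odd'[of k3 k2]
    by (elim disjE) (simp add: gl_defs; simp add: gl_norm M; simp add: algebra_simps mult_2)+
qed

lemma plus_wm2_next:
  assumes "k3 \<le> N"
  shows "br (pt k2) (pt k1) (E k2 k3) (wm2 k1) = 0"
proof -
  note M = E_L[of k2 k3] EE_move[of _ k2 _ k3] EE3_move[of _ k2 _ k3]
  show ?thesis
    using assms s01[of k1] s01[of k2] s01[of k3] E_odd[of k2 k3] E_odd'[of k2 k3]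
    by (elim disjE) (simp add: gl_defs; simp add: gl_norm M; simp add: algebra_simps mult_2)+
qed

lemma th2_plus_prev:
  assumes "k3 \<le> N"
  shows "br 0 (pt k1) (th2 k2) (E k1 k2) = of_int (cart k2 k1) * wp2 k1"
proof -
  note M = E_L[of k1 k2] EE_move[of _ k1 _ k2] EE3_move[of _ k1 _ k2]
  show ?thesis
    using assms s01[of k1] s01[of k2] s01[of k3] E_odd[of k1 k2] E_odd'[of k1 k2]
    by (elim disjE) (simp add: gl_defs; simp add: gl_norm M; simp add: algebra_simps mult_2)+
qed

lemma th2_minus_prev:
  assumes "k3 \<le> N"
  shows "br 0 (pt k1) (th2 k2) (sg k1 * E k2 k1) = - of_int (cart k2 k1) * wm2 k1"
proof -
  note M = E_L[of k2 k1] EE_move[of _ k2 _ k1] EE3_move[of _ k2 _ k1]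
  show ?thesis
    using assms s01[of k1] s01[of k2] s01[of k3] E_odd[of k2 k1] E_odd'[of k2 k1]
    by (elim disjE) (simp add: gl_defs; simp add: gl_norm M; simp add: algebra_simps mult_2)+
qed

lemma wp2_minus_prev:
  assumes "k3 \<le> N"
  shows "br (pt k2) (pt k1) (wp2 k2) (sg k1 * E k2 k1) = 0"
proof -
  note M = E_L[of k2 k1] EE_move[of _ k2 _ k1] EE3_move[of _ k2 _ k1]
  show ?thesis
    using assms s01[of k1] s01[of k2] s01[of k3] E_odd[of k2 k1] E_odd'[of k2 k1]
    by (elim disjE) (simp add: gl_defs; simp add: gl_norm M; simp add: algebra_simps mult_2)+
qed

lemma plus_wm2_prev:
  assumes "k3 \<le> N"
  shows "br (pt k1) (pt k2) (E k1 k2) (wm2 k2) = 0"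
proof -
  note M = E_L[of k1 k2] EE_move[of _ k1 _ k2] EE3_move[of _ k1 _ k2]
  show ?thesis
    using assms s01[of k1] s01[of k2] s01[of k3] E_odd[of k1 k2] E_odd'[of k1 k2]
    by (elim disjE) (simp add: gl_defs; simp add: gl_norm M; simp add: algebra_simps mult_2)+
qed

lemma wp2_comm_same:
  assumes "k2 \<le> N"
  shows "br (pt k1) (pt k1) (E k1 k2) (wp2 k1) - br (pt k1) (pt k1) (wp2 k1) (E k1 k2)
      = of_int (cart k1 k1) * (E k1 k2 * (E k1 k2) + E k1 k2 * (E k1 k2))"
proof -
  note M = E_L[of k1 k2] EE_move[of _ k1 _ k2] EE3_move[of _ k1 _ k2]
  show ?thesis
    using assms s01[of k1] s01[of k2] E_odd[of k1 k2] E_odd'[of k1 k2]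
    by (elim disjE) (simp add: gl_defs; simp add: gl_norm M; simp add: algebra_simps mult_2)+
qed

lemma wm2_comm_same:
  assumes "k2 \<le> N"
  shows "br (pt k1) (pt k1) (sg k1 * E k2 k1) (wm2 k1) - br (pt k1) (pt k1) (wm2 k1) (sg k1 * E k2 k1)
      = - of_int (cart k1 k1) * (sg k1 * E k2 k1 * (sg k1 * E k2 k1) + sg k1 * E k2 k1 * (sg k1 * E k2 k1))"
proof -
  note M = E_L[of k2 k1] EE_move[of _ k2 _ k1] EE3_move[of _ k2 _ k1]
  show ?thesis
    using assms s01[of k1] s01[of k2] E_odd[of k2 k1] E_odd'[of k2 k1]
    by (elim disjE) (simp add: gl_defs; simp add: gl_norm M; simp add: algebra_simps mult_2)+
qed

text \<open>The parity assumption excludes two adjacent odd nodes, where the supercommutator of the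
  two generators is itself their anticommutator. Two different generators are moved here, so the
  extra instances of \<open>EE'\<close> and \<open>EE3\<close> fix the order of the remaining
  products.\<close>

lemma wp2_comm_next:
  assumes "k3 \<le> N" and "s k1 = s k2 \<or> s k2 = s k3"
  shows "br (pt k1) (pt k2) (E k1 k2) (wp2 k2) - br (pt k1) (pt k2) (wp2 k1) (E k2 k3)
      = of_int (cart k1 k2) * (E k1 k2 * (E k2 k3) + E k2 k3 * (E k1 k2))"
proof -
  note M = E_L[of k1 k2] EE_move[of _ k1 _ k2] EE3_move[of _ k1 _ k2] E_L[of k2 k3]
    EE'[of k2 k3 k1 k1] EE3[of k2 k3 k1 k1]
    EE'[of k2 k3 k2 k2] EE3[of k2 k3 k2 k2]
    EE'[of k2 k3 k3 k3] EE3[of k2 k3 k3 k3]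
    EE'[of k2 k3 k1 k3] EE3[of k2 k3 k1 k3]
  show ?thesis
    using assms s01[of k1] s01[of k2] s01[of k3] E_odd[of k1 k2] E_odd'[of k1 k2] E_odd[of k2 k3] E_odd'[of k2 k3]
    by (elim disjE) (simp add: gl_defs; simp add: gl_norm M; simp add: algebra_simps mult_2)+
qed

lemma wm2_comm_next:
  assumes "k3 \<le> N" and "s k1 = s k2 \<or> s k2 = s k3"
  shows "br (pt k1) (pt k2) (sg k1 * E k2 k1) (wm2 k2) - br (pt k1) (pt k2) (wm2 k1) (sg k2 * E k3 k2)
      = - of_int (cart k1 k2) * (sg k1 * E k2 k1 * (sg k2 * E k3 k2) + sg k2 * E k3 k2 * (sg k1 * E k2 k1))"
proof -
  note M = E_L[of k2 k1] EE_move[of _ k2 _ k1] EE3_move[of _ k2 _ k1] E_L[of k3 k2]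
    EE'[of k1 k1 k3 k1] EE'[of k2 k2 k3 k1]
    EE'[of k3 k2 k1 k1] EE3[of k3 k2 k1 k1]
    EE'[of k3 k2 k2 k2] EE3[of k3 k2 k2 k2]
    EE'[of k3 k2 k3 k3] EE3[of k3 k2 k3 k3]
    EE'[of k3 k2 k3 k1] EE3[of k3 k2 k3 k1]
  show ?thesis
    using assms s01[of k1] s01[of k2] s01[of k3] E_odd[of k2 k1] E_odd'[of k2 k1] E_odd[of k3 k2] E_odd'[of k3 k2]
    by (elim disjE) (simp add: gl_defs; simp add: gl_norm M; simp add: algebra_simps mult_2)+
qed

lemma wp2_comm_prev:
  assumes "k3 \<le> N" and "s k1 = s k2 \<or> s k2 = s k3"
  shows "br (pt k2) (pt k1) (E k2 k3) (wp2 k1) - br (pt k2) (pt k1) (wp2 k2) (E k1 k2)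
      = of_int (cart k2 k1) * (E k2 k3 * (E k1 k2) + E k1 k2 * (E k2 k3))"
proof -
  note M = E_L[of k1 k2] EE_move[of _ k1 _ k2] EE3_move[of _ k1 _ k2] E_L[of k2 k3]
    EE'[of k2 k3 k1 k1] EE3[of k2 k3 k1 k1]
    EE'[of k2 k3 k2 k2] EE3[of k2 k3 k2 k2]
    EE'[of k2 k3 k3 k3] EE3[of k2 k3 k3 k3]
    EE'[of k2 k3 k1 k3] EE3[of k2 k3 k1 k3]
  show ?thesis
    using assms s01[of k1] s01[of k2] s01[of k3] E_odd[of k1 k2] E_odd'[of k1 k2] E_odd[of k2 k3] E_odd'[of k2 k3]
    by (elim disjE) (simp add: gl_defs; simp add: gl_norm M; simp add: algebra_simps mult_2)+
qed

lemma wm2_comm_prev: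
  assumes "k3 \<le> N" and "s k1 = s k2 \<or> s k2 = s k3"
  shows "br (pt k2) (pt k1) (sg k2 * E k3 k2) (wm2 k1) - br (pt k2) (pt k1) (wm2 k2) (sg k1 * E k2 k1)
      = - of_int (cart k2 k1) * (sg k2 * E k3 k2 * (sg k1 * E k2 k1) + sg k1 * E k2 k1 * (sg k2 * E k3 k2))"
proof -
  note M = E_L[of k2 k1] EE_move[of _ k2 _ k1] EE3_move[of _ k2 _ k1] E_L[of k3 k2]
    EE'[of k1 k1 k3 k1] EE'[of k2 k2 k3 k1]
    EE'[of k3 k2 k1 k1] EE3[of k3 k2 k1 k1]
    EE'[of k3 k2 k2 k2] EE3[of k3 k2 k2 k2]
    EE'[of k3 k2 k3 k3] EE3[of k3 k2 k3 k3]
    EE'[of k3 k2 k3 k1] EE3[of k3 k2 k3 k1]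
  show ?thesis
    using assms s01[of k1] s01[of k2] s01[of k3] E_odd[of k2 k1] E_odd'[of k2 k1] E_odd[of k3 k2] E_odd'[of k3 k2]
    by (elim disjE) (simp add: gl_defs; simp add: gl_norm M; simp add: algebra_simps mult_2)+
qed

end

section \<open>Brackets at distant nodes\<close>

lemma sign_left: "x * ((-1) ^ n * y) = (-1) ^ n * (x * y)" for x y :: 'a
  by (cases "even n") auto

lemma sg_left: "x * (sg i * y) = sg i * (x * y)"
  by (simp add: sg_def sign_left)

text \<open>Without matching indices the bracket of the matrix units vanishes, and the boundary term
  of \<open>E_L\<close> vanishes because the truncation at \<open>r\<close> does not separate
  \<open>a\<close> from \<open>b\<close>.\<close>

lemma E_super_commute:
  assumes "a \<in> {1..N}" "b \<in> {1..N}" "c \<in> {1..N}" "d \<in> {1..N}" "b \<noteq> c" "a \<noteq> d"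
  shows "E a b * E c d = ks a b c d * (E c d * E a b)"
    and "r \<le> N \<Longrightarrow> b \<le> r \<longleftrightarrow> a \<le> r \<Longrightarrow> E a b * L r c d = ks a b c d * (L r c d * E a b)"
  using EE'[of a b c d] E_L[of a b c d r] assms by auto

lemma ks_diag [simp]: "ks a b c c = 1"
  by (simp add: ks_def flip: mult_2)

lemma sign_pt: "(-1) ^ (pt i * pt j) = ks i (i + 1) j (j + 1)" "ks (i + 1) i j (j + 1) = ks i (i + 1) j (j + 1)"
    "ks i (i + 1) (j + 1) j = ks i (i + 1) j (j + 1)" "ks (i + 1) i (j + 1) j = ks i (i + 1) j (j + 1)"
  using s01[of i] s01[of "i + 1"] s01[of j] s01[of "j + 1"] by (auto simp: pt_def ks_def)

lemma ks_sym: "ks a b c d = ks c d a b"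
  by (simp add: ks_def mult.commute)

context
  fixes a b i j :: nat
  assumes i: "1 \<le> i" "i + 1 \<le> N" and j: "1 \<le> j" "j + 1 \<le> N"
    and far: "j + 1 < i \<or> i + 1 < j"
    and ab: "a = j \<and> b = j + 1 \<or> a = j + 1 \<and> b = j"
begin

text \<open>For distant nodes j and j+1 are both different from i and i+1, and they lie on the same
  side of each of the truncations at i-1, i, i+1 and N.\<close>

lemma far_commute:
  assumes "c \<in> {i, i + 1}" "d \<in> {i, i + 1}"
  shows "E a b * E c d = ks a b c d * (E c d * E a b)"
    and "r \<in> {i - 1, i, i + 1, N} \<Longrightarrow> E a b * L r c d = ks a b c d * (L r c d * E a b)"
proof -
  have "a \<in> {1..N}" "b \<in> {1..N}" "c \<in> {1..N}" "d \<in> {1..N}" "b \<noteq> c" "a \<noteq> d"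
    using assms i j far ab by auto
  note * = E_super_commute[OF this]
  show "E a b * E c d = ks a b c d * (E c d * E a b)" by (rule *(1))
  assume "r \<in> {i - 1, i, i + 1, N}"
  then have "r \<le> N" "b \<le> r \<longleftrightarrow> a \<le> r" using i j far ab by auto
  then show "E a b * L r c d = ks a b c d * (L r c d * E a b)" by (rule *(2))
qed

lemma far_th2: "E a b * th2 i = th2 i * E a b"
proof -
  note c = far_commute[of i i] far_commute[of "i + 1" "i + 1", folded Suc_eq_plus1]
  show ?thesis
    using i by (simp add: th2_def outer_simps h_def ring_distribs mult.assoc central_left sg_left c)
qed

lemma far_w:
  assumes "c \<in> {i, i + 1}" "d \<in> {i, i + 1}"
  shows "E a b * outer i {i, i + 1} c d = ks a b c d * (outer i {i, i + 1} c d * E a b)"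
    and "E a b * h i = h i * E a b"
    and "E a b * (E c d * h i) = ks a b c d * (E c d * (h i * E a b))"
    and "E a b * (h i * E c d) = ks a b c d * (h i * (E c d * E a b))"
proof -
  note c = far_commute[of i i] far_commute[of "i + 1" "i + 1", folded Suc_eq_plus1]
    far_commute[OF assms, folded Suc_eq_plus1]
  have s: "x * (ks a b c d * y) = ks a b c d * (x * y)" for x y by (simp add: ks_def sign_left)
  show "E a b * outer i {i, i + 1} c d = ks a b c d * (outer i {i, i + 1} c d * E a b)"
    using i by (simp add: outer_simps ring_distribs c)
  show h: "E a b * h i = h i * E a b"
    by (simp add: h_def ring_distribs mult.assoc sg_left c)
  have "E a b * (E c d * h i) = ks a b c d * (E c d * E a b) * h i"
    by (simp add: c flip: mult.assoc)
  then show "E a b * (E c d * h i) = ks a b c d * (E c d * (h i * E a b))"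
    by (simp add: mult.assoc h)
  have "E a b * (h i * E c d) = h i * (E a b * E c d)"
    by (simp add: h flip: mult.assoc)
  then show "E a b * (h i * E c d) = ks a b c d * (h i * (E c d * E a b))"
    by (simp add: c s)
qed

lemma far_w2:
  shows "E a b * wp2 i = ks a b i (i + 1) * (wp2 i * E a b)"
    and "E a b * wm2 i = ks a b (i + 1) i * (wm2 i * E a b)"
proof -
  have s: "of_int z * (ks a b c d * y) = ks a b c d * (of_int z * y)" "sg k * (ks a b c d * y) = ks a b c d * (sg k * y)"
    for c d z k y by (simp_all add: ks_def sign_left)
  note c = far_commute[of i "i + 1"] far_commute[of "i + 1" i] far_w[of i "i + 1"] far_w[of "i + 1" i]
  note c = c[folded Suc_eq_plus1]
  show "E a b * wp2 i = ks a b i (i + 1) * (wp2 i * E a b)"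
    unfolding wp2_def by (simp add: ring_distribs mult.assoc central_left sg_left[of "E a b"] s c)
  show "E a b * wm2 i = ks a b (i + 1) i * (wm2 i * E a b)"
    unfolding wm2_def by (simp add: ring_distribs mult.assoc central_left sg_left[of "E a b"] s c)
qed

end

section \<open>Weights under the diagonal matrix units\<close>

definition weight :: "nat \<Rightarrow> 'a \<Rightarrow> int \<Rightarrow> bool" where
  "weight a x z \<longleftrightarrow> E a a * x = x * E a a + of_int z * x"

lemma weight_lin:
  "weight a x z \<Longrightarrow> weight a y z \<Longrightarrow> weight a (x + y) z"
  "weight a x z \<Longrightarrow> weight a y z \<Longrightarrow> weight a (x - y) z"
  "weight a x z \<Longrightarrow> weight a (of_int c * x) z"
  "weight a x z \<Longrightarrow> weight a (sg k * x) z"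
  "weight a 0 z"
proof -
  have "of_int u * (of_int v * y) = of_int v * (of_int u * y)" for u v and y :: 'a
    by (simp add: mult.commute flip: mult.assoc of_int_mult)
  then show "weight a x z \<Longrightarrow> weight a (of_int c * x) z"
    by (simp add: weight_def ring_distribs central_left mult.assoc)
  show "weight a x z \<Longrightarrow> weight a (sg k * x) z"
    using sg_left[where x = "of_int z"] by (simp add: weight_def ring_distribs sg_left mult.assoc)
qed (simp_all add: weight_def ring_distribs)

lemma weight_minus: "weight a x z \<Longrightarrow> weight a (- x) z"
  using weight_lin(2)[of a 0 z x] by (simp add: weight_lin)

lemma weight_sum: "(\<And>k. k \<in> A \<Longrightarrow> weight a (f k) z) \<Longrightarrow> weight a (sum f A) z"
  by (induction A rule: infinite_finite_induct) (simp_all add: weight_lin)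

lemma weight_mult:
  assumes "weight a x z" "weight a y w"
  shows "weight a (x * y) (z + w)"
proof -
  have "E a a * (x * y) = x * (E a a * y) + of_int z * (x * y)"
    using assms(1) by (simp add: weight_def distrib_right mult.assoc flip: mult.assoc[of "E a a"])
  then show ?thesis
    using assms(2) of_int_left(1)[of x w y] by (simp add: weight_def ring_distribs mult.assoc add_ac)
qed

lemma weight_E:
  "a \<in> {1..N} \<Longrightarrow> c \<in> {1..N} \<Longrightarrow> d \<in> {1..N} \<Longrightarrow> weight a (E c d) (of_bool (a = c) - of_bool (a = d))"
  using EE'[of a a c d] by (auto simp: weight_def ks_sym[of a a])

lemma weight_outer:
  assumes "a \<in> {1..N}" "c \<in> {1..N}" "d \<in> {1..N}"
  shows "weight a (outer i D c d) (of_bool (a = c) - of_bool (a = d))"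
  unfolding outer_def
proof (rule weight_sum)
  fix k assume k: "k \<in> {1..N} - D"
  have "weight a (E c k * E k d) (of_bool (a = c) - of_bool (a = k) + (of_bool (a = k) - of_bool (a = d)))"
    using k assms by (intro weight_mult weight_E) auto
  then show "weight a (sg k * of_int (sgn (int k - int i)) * (E c k * E k d)) (of_bool (a = c) - of_bool (a = d))"
    by (simp add: mult.assoc weight_lin)
qed

lemma weight_h: "a \<in> {1..N} \<Longrightarrow> 1 \<le> i \<Longrightarrow> i + 1 \<le> N \<Longrightarrow> weight a (h i) 0"
  unfolding h_def using weight_E[of a i i] weight_E[of a "i + 1" "i + 1"] by (auto intro!: weight_lin)

lemma weight_th2:
  "a \<in> {1..N} \<Longrightarrow> 1 \<le> i \<Longrightarrow> i + 1 \<le> N \<Longrightarrow> weight a (th2 i) 0"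
  unfolding th2_def using weight_outer[of a i i i] weight_outer[of a "i + 1" "i + 1" "i + 1"] weight_h[of a i]
  by (auto intro!: weight_lin weight_minus simp flip: of_int_minus)

lemma weight_wp2:
  assumes "a \<in> {1..N}" "1 \<le> i" "i + 1 \<le> N"
  shows "weight a (wp2 i) (of_bool (a = i) - of_bool (a = i + 1))"
  unfolding wp2_def of_int_minus[symmetric] 
  using weight_mult[OF weight_h[OF assms] weight_E[of a i "i + 1"]] assms
  by (intro weight_lin weight_outer weight_E) auto

lemma weight_wm2:
  assumes "a \<in> {1..N}" "1 \<le> i" "i + 1 \<le> N"
  shows "weight a (wm2 i) (of_bool (a = i + 1) - of_bool (a = i))"
  unfolding wm2_def of_int_minus[symmetric] mult.assoc
  using weight_mult[OF weight_E[of a "i + 1" i] weight_h[OF assms]] assms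
  by (intro weight_lin weight_outer weight_E) auto

text \<open>Weights are additive in products, so brackets of \<open>h i\<close> with the quadratic
  elements follow from the weights of matrix units alone, without any reordering.\<close>

lemma h_weight:
  assumes "weight i x z" "weight (i + 1) x w"
  shows "br 0 q (h i) x = of_int (sg_int i * z - sg_int (i + 1) * w) * x"
  using assms by (simp add: weight_def br_def h_def ring_distribs mult.assoc sg_def sg_int_def sign_left[of x])

end

section \<open>Brackets at arbitrary pairs of nodes\<close>

context gl_ops begin

definition xp :: "nat \<Rightarrow> 'a" where "xp i = E i (i + 1)"
definition xm :: "nat \<Rightarrow> 'a" where "xm i = sg i * E (i + 1) i"

text \<open>Puts the nodes into the \<open>Suc\<close> shape in which the computations at equal and
  adjacent nodes are stated.\<close>

lemma node_cases:
  assumes "1 \<le> i" "1 \<le> (j :: nat)"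
  obtains k where "i = Suc k" "j = Suc k" | k where "i = Suc k" "j = Suc (Suc k)"
  | k where "i = Suc (Suc k)" "j = Suc k" | "j + 1 < i \<or> i + 1 < j"
proof -
  have "j = i \<or> j = Suc i \<or> i = Suc j \<or> j + 1 < i \<or> i + 1 < j" by linarith
  moreover have "i = Suc (i - 1)" "j = Suc (j - 1)" using assms by auto
  ultimately show thesis using that by metis
qed

lemmas signs = sign_pt(2-)[folded Suc_eq_plus1]

lemma ks_ks: "ks a b c d * (ks a b c d * x) = x"
  by (simp add: ks_def minus_one_power_iff)

lemmas x_defs = xp_def xm_def
context
  fixes i j :: nat
  assumes i: "1 \<le> i" "i + 1 \<le> N" and j: "1 \<le> j" "j + 1 \<le> N"
begin

lemma far_cart: "j + 1 < i \<or> i + 1 < j \<Longrightarrow> cart i j = 0"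
  by (auto simp: cart_def)

lemma th2_x:
  "br 0 (pt j) (th2 i) (xp j) = of_int (cart i j) * wp2 j"
  "br 0 (pt j) (th2 i) (xm j) = - of_int (cart i j) * wm2 j"
  by (rule node_cases[of i j]; use i j in \<open>simp add: x_defs th2_plus_same th2_plus_next th2_plus_prev
      th2_minus_same th2_minus_next th2_minus_prev\<close>;
      use far_th2[OF i j] in \<open>simp add: br_def far_cart sg_left mult.assoc\<close>)+

lemma w_x_mixed:
  "br (pt i) (pt j) (wp2 i) (xm j) = (if i = j then th2 i - h i * h i else 0)"
  "br (pt i) (pt j) (xp i) (wm2 j) = (if i = j then th2 i - h i * h i else 0)"
proof -
  show "br (pt i) (pt j) (wp2 i) (xm j) = (if i = j then th2 i - h i * h i else 0)"
  proof (rule node_cases[of i j])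
    assume far: "j + 1 < i \<or> i + 1 < j"
    then have "i \<noteq> j" by auto
    then show ?thesis
      using far_w2(1)[OF i j far, of "j + 1" j]
      by (simp add: br_def x_defs sign_pt signs ks_sym[of j "Suc j"] sg_left mult.assoc ks_ks)
  qed (use i j in \<open>simp_all add: x_defs wp2_minus_same wp2_minus_next wp2_minus_prev\<close>)
  show "br (pt i) (pt j) (xp i) (wm2 j) = (if i = j then th2 i - h i * h i else 0)"
  proof (rule node_cases[of i j])
    assume far: "j + 1 < i \<or> i + 1 < j"
    then have "i + 1 < j \<or> j + 1 < i" by blast
    from far_w2(2)[OF j i this, of i "i + 1"] far show ?thesis
      by (auto simp: br_def x_defs sign_pt signs)
  qed (use i j in \<open>simp_all add: x_defs plus_wm2_same plus_wm2_next plus_wm2_prev\<close>)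
qed

lemma w_x_comm:
  assumes adj: "\<And>k. 1 \<le> k \<Longrightarrow> k + 2 \<le> N \<Longrightarrow> s k = s (k + 1) \<or> s (k + 1) = s (k + 2)"
  shows "br (pt i) (pt j) (xp i) (wp2 j) - br (pt i) (pt j) (wp2 i) (xp j)
      = of_int (cart i j) * (xp i * xp j + xp j * xp i)"
    and "br (pt i) (pt j) (xm i) (wm2 j) - br (pt i) (pt j) (wm2 i) (xm j)
      = - of_int (cart i j) * (xm i * xm j + xm j * xm i)"
proof -
  have far: "br (pt i) (pt j) (xp i) (wp2 j) = 0" "br (pt i) (pt j) (wp2 i) (xp j) = 0"
    "br (pt i) (pt j) (xm i) (wm2 j) = 0" "br (pt i) (pt j) (wm2 i) (xm j) = 0"
    if far: "j + 1 < i \<or> i + 1 < j"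
  proof -
    from far have far': "i + 1 < j \<or> j + 1 < i" by blast
    show "br (pt i) (pt j) (xp i) (wp2 j) = 0"
      using far_w2(1)[OF j i far', of i "i + 1"] by (simp add: br_def x_defs sign_pt)
    show "br (pt i) (pt j) (wp2 i) (xp j) = 0"
      using far_w2(1)[OF i j far, of j "j + 1"] by (simp add: br_def x_defs sign_pt ks_sym[of j] ks_ks)
    show "br (pt i) (pt j) (xm i) (wm2 j) = 0"
      using far_w2(2)[OF j i far', of "i + 1" i]
      by (simp add: br_def x_defs signs sign_pt sg_left mult.assoc)
    show "br (pt i) (pt j) (wm2 i) (xm j) = 0"
      using far_w2(2)[OF i j far, of "j + 1" j]
      by (simp add: br_def x_defs sign_pt signs ks_sym[of j "Suc j"] sg_left mult.assoc ks_ks)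
  qed
  show "br (pt i) (pt j) (xp i) (wp2 j) - br (pt i) (pt j) (wp2 i) (xp j)
      = of_int (cart i j) * (xp i * xp j + xp j * xp i)"
  proof (rule node_cases[of i j])
    assume "j + 1 < i \<or> i + 1 < j"
    then show ?thesis by (simp add: far far_cart)
  qed (use i j adj in \<open>simp_all add: x_defs wp2_comm_same wp2_comm_next wp2_comm_prev\<close>)
  show "br (pt i) (pt j) (xm i) (wm2 j) - br (pt i) (pt j) (wm2 i) (xm j)
      = - of_int (cart i j) * (xm i * xm j + xm j * xm i)"
  proof (rule node_cases[of i j])
    assume "j + 1 < i \<or> i + 1 < j"
    then show ?thesis by (simp add: far far_cart)
  qed (use i j adj in \<open>simp_all add: x_defs wm2_comm_same wm2_comm_next wm2_comm_prev\<close>)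
qed

lemma h_w:
  "br 0 q (h i) (th2 j) = 0"
  "br 0 q (h i) (wp2 j) = of_int (cart i j) * wp2 j"
  "br 0 q (h i) (wm2 j) = - of_int (cart i j) * wm2 j"
proof -
  have a: "i \<in> {1..N}" "i + 1 \<in> {1..N}" using i by auto
  show "br 0 q (h i) (th2 j) = 0"
    using h_weight[OF weight_th2 weight_th2, OF a(1) j a(2) j, of q] by simp
  have c: "sg_int i * (of_bool (i = j) - of_bool (i = j + 1)) - sg_int (i + 1) * (of_bool (i + 1 = j) - of_bool (i + 1 = j + 1)) = cart i j"
    by (auto simp: cart_def)
  show "br 0 q (h i) (wp2 j) = of_int (cart i j) * wp2 j"
    using h_weight[OF weight_wp2 weight_wp2, OF a(1) j a(2) j, of q] unfolding c .
  have c: "sg_int i * (of_bool (i = j + 1) - of_bool (i = j)) - sg_int (i + 1) * (of_bool (i + 1 = j + 1) - of_bool (i + 1 = j)) = - cart i j"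
    by (auto simp: cart_def)
  show "br 0 q (h i) (wm2 j) = - of_int (cart i j) * wm2 j"
    using h_weight[OF weight_wm2 weight_wm2, OF a(1) j a(2) j, of q] unfolding c by simp
qed

end

end

section \<open>Operators that transform like the matrix units\<close>

locale gl_pair = gl_ops +
  fixes J :: "nat \<Rightarrow> nat \<Rightarrow> 'a"
  assumes EJ: "\<lbrakk>a \<in> {1..N}; b \<in> {1..N}; c \<in> {1..N}; d \<in> {1..N}\<rbrakk> \<Longrightarrow>
      E a b * J c d = (if b = c then J a d else 0)
        + (-1) ^ ((s a + s b) * (s c + s d)) * (J c d * E a b - (if a = d then J c b else 0))"
begin

definition jp :: "nat \<Rightarrow> 'a" where "jp i = J i (i + 1)"
definition jm :: "nat \<Rightarrow> 'a" where "jm i = sg i * J (i + 1) i"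
definition jh :: "nat \<Rightarrow> 'a" where "jh i = sg i * J i i - sg (i + 1) * J (i + 1) (i + 1)"

lemma br_E_J:
  assumes "a \<in> {1..N}" "b \<in> {1..N}" "c \<in> {1..N}" "d \<in> {1..N}" "(-1) ^ (q * r) = ks a b c d"
  shows "br q r (E a b) (J c d) = (if b = c then J a d else 0) - ks a b c d * (if a = d then J c b else 0)"
    and "br r q (J c d) (E a b) = (if d = a then J c b else 0) - ks a b c d * (if b = c then J a d else 0)"
proof -
  have E: "E a b * J c d = (if b = c then J a d else 0) + ks a b c d * (J c d * E a b - (if a = d then J c b else 0))"
    unfolding ks_def by (rule EJ) fact+
  show "br q r (E a b) (J c d) = (if b = c then J a d else 0) - ks a b c d * (if a = d then J c b else 0)"
    by (simp add: br_def E assms(5) algebra_simps)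
  show "br r q (J c d) (E a b) = (if d = a then J c b else 0) - ks a b c d * (if b = c then J a d else 0)"
    by (simp add: br_def E mult.commute[of r] assms(5) right_diff_distrib distrib_left ks_ks)
qed

lemma weight_J:
  assumes "a \<in> {1..N}" "c \<in> {1..N}" "d \<in> {1..N}"
  shows "weight a (J c d) (of_bool (a = c) - of_bool (a = d))"
  using br_E_J(1)[of a a c d 0 0] assms by (auto simp: weight_def br_def ks_sym[of a a] algebra_simps)

lemma br_scale:
  "br q r (sg k * x) y = sg k * br q r x y" "br q r x (sg k * y) = sg k * br q r x y"
  "br q r (x - z) y = br q r x y - br q r z y"
proof -
  have "(-1) ^ n * (sg k * z) = sg k * ((-1) ^ n * z)" for n z
    by (rule sg_left)
  then show "br q r (sg k * x) y = sg k * br q r x y" "br q r x (sg k * y) = sg k * br q r x y"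
    by (simp_all add: br_def sg_left[of x] sg_left[of y] mult.assoc right_diff_distrib)
  show "br q r (x - z) y = br q r x y - br q r z y"
    by (simp add: br_def algebra_simps)
qed

context
  fixes i j :: nat
  assumes i: "1 \<le> i" "i + 1 \<le> N" and j: "1 \<le> j" "j + 1 \<le> N"
begin

private lemma range: "i \<in> {1..N}" "i + 1 \<in> {1..N}" "j \<in> {1..N}" "j + 1 \<in> {1..N}"
  using i j by auto

lemma sg_ks: "sg i * ks i (i + 1) i (i + 1) = sg (i + 1)"
  using s01[of i] s01[of "i + 1"] by (auto simp: sg_def ks_def)

lemma x_j_mixed:
  "br (pt i) (pt j) (jp i) (xm j) = (if i = j then jh i else 0)"
  "br (pt i) (pt j) (xp i) (jm j) = (if i = j then jh i else 0)"
proof -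
  have k: "(-1) ^ (pt j * pt i) = ks (j + 1) j i (i + 1)"
    using sign_pt(1)[of i j] sign_pt(3)[of i j] by (simp add: mult.commute[of "pt j"] ks_sym[of i])
  show "br (pt i) (pt j) (jp i) (xm j) = (if i = j then jh i else 0)"
    using br_E_J(2)[OF range(4,3,1,2) k] sg_ks sign_pt(3)[of i i]
    by (auto simp: jp_def xm_def jh_def br_scale right_diff_distrib ks_sym[of "Suc j"] simp flip: mult.assoc)
  have k: "(-1) ^ (pt i * pt j) = ks i (i + 1) (j + 1) j"
    using sign_pt(1)[of i j] sign_pt(3)[of i j] by simp
  show "br (pt i) (pt j) (xp i) (jm j) = (if i = j then jh i else 0)"
    using br_E_J(1)[OF range(1,2,4,3) k] sg_ks sign_pt(3)[of i i]
    by (auto simp: jm_def xp_def jh_def br_scale right_diff_distrib simp flip: mult.assoc)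
qed

lemma h_j:
  "br 0 0 (h i) (jh j) = 0"
  "br 0 q (h i) (jp j) = of_int (cart i j) * jp j"
  "br 0 q (h i) (jm j) = - of_int (cart i j) * jm j"
proof -
  have w: "weight a (jh j) 0" if "a \<in> {1..N}" for a
    unfolding jh_def using that weight_J[of a j j] weight_J[of a "j + 1" "j + 1"] range
    by (auto intro!: weight_lin)
  show "br 0 0 (h i) (jh j) = 0" using h_weight[OF w w, OF range(1,2)] by simp
  have c: "sg_int i * (of_bool (i = j) - of_bool (i = j + 1)) - sg_int (i + 1) * (of_bool (i + 1 = j) - of_bool (i + 1 = j + 1)) = cart i j"
    by (auto simp: cart_def)
  show "br 0 q (h i) (jp j) = of_int (cart i j) * jp j"
    unfolding jp_def using h_weight[OF weight_J weight_J, OF range(1,3,4) range(2,3,4)] unfolding c .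
  have c: "sg_int i * (of_bool (i = j + 1) - of_bool (i = j)) - sg_int (i + 1) * (of_bool (i + 1 = j + 1) - of_bool (i + 1 = j)) = - cart i j"
    by (auto simp: cart_def)
  have "weight a (jm j) (of_bool (a = j + 1) - of_bool (a = j))" if "a \<in> {1..N}" for a
    unfolding jm_def using that range by (intro weight_lin weight_J)
  from h_weight[OF this this, OF range(1,2)] show "br 0 q (h i) (jm j) = - of_int (cart i j) * jm j"
    unfolding c by simp
qed

lemma jh_x:
  "br 0 q (jh i) (xp j) = of_int (cart i j) * jp j"
  "br 0 q (jh i) (xm j) = - of_int (cart i j) * jm j"
proof -
  have k: "(-1) ^ (q * 0) = ks a b i i" "(-1) ^ (q * 0) = ks a b (i + 1) (i + 1)" for a b by simp_all
  show "br 0 q (jh i) (xp j) = of_int (cart i j) * jp j"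
    using br_E_J(2)[OF range(3,4,1,1) k(1)] br_E_J(2)[OF range(3,4,2,2) k(2)]
    by (auto simp: jh_def xp_def jp_def cart_def br_scale sg_int_def distrib_right simp flip: sg_def)
  show "br 0 q (jh i) (xm j) = - of_int (cart i j) * jm j"
    using br_E_J(2)[OF range(4,3,1,1) k(1)] br_E_J(2)[OF range(4,3,2,2) k(2)]
      sg_left[of "sg j" i "J (j + 1) j"] sg_left[of "sg j" "i + 1" "J (j + 1) j"]
    by (auto simp: jh_def xm_def jm_def cart_def br_scale sg_int_def distrib_right right_diff_distrib simp flip: sg_def)
qed

text \<open>Both sides are the same combination of operators \<open>J\<close> with composite
  indices. In the Yangian relation that compares [X_i1, X_j0] with [X_i0, X_j1] the \<open>J\<close>
  parts therefore cancel.\<close>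

lemma j_x_comm:
  "br (pt i) (pt j) (jp i) (xp j) = br (pt i) (pt j) (xp i) (jp j)"
  "br (pt i) (pt j) (jm i) (xm j) = br (pt i) (pt j) (xm i) (jm j)"
proof -
  have k: "(-1) ^ (pt j * pt i) = ks j (j + 1) i (i + 1)" "(-1) ^ (pt j * pt i) = ks (j + 1) j (i + 1) i"
    "(-1) ^ (pt i * pt j) = ks i (i + 1) j (j + 1)" "(-1) ^ (pt i * pt j) = ks (i + 1) i (j + 1) j"
    using sign_pt(1)[of j i] sign_pt(4)[of j i] sign_pt(1)[of i j] sign_pt(4)[of i j] by auto
  show "br (pt i) (pt j) (jp i) (xp j) = br (pt i) (pt j) (xp i) (jp j)"
    unfolding jp_def xp_def br_E_J(2)[OF range(3,4,1,2) k(1)] br_E_J(1)[OF range(1,2,3,4) k(3)]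
    by (subst ks_sym) auto
  show "br (pt i) (pt j) (jm i) (xm j) = br (pt i) (pt j) (xm i) (jm j)"
    unfolding jm_def xm_def br_scale br_E_J(2)[OF range(4,3,2,1) k(2)] br_E_J(1)[OF range(2,1,4,3) k(4)]
    by (subst ks_sym) auto
qed

end

end

section \<open>Relations of degree zero\<close>

context gl_ops
begin

text \<open>With \<open>E\<close> in the role of \<open>J\<close>, the brackets between
  \<open>E\<close> and \<open>J\<close> specialise to the degree-zero relations.\<close>

lemma gl_pair_self: "gl_pair N s E E"
  by unfold_locales (rule EE)

lemma br_E:
  assumes "a \<in> {1..N}" "b \<in> {1..N}" "c \<in> {1..N}" "d \<in> {1..N}" "(-1) ^ (q * r) = ks a b c d"
  shows "br q r (E a b) (E c d) = (if b = c then E a d else 0) - ks a b c d * (if a = d then E c b else 0)"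
proof -
  interpret gl_pair N s E E by (rule gl_pair_self)
  show ?thesis by (rule br_E_J(1)[OF assms])
qed

lemma br_sg:
  "br q r (sg k * x) y = sg k * br q r x y" "br q r x (sg k * y) = sg k * br q r x y"
proof -
  interpret gl_pair N s E E by (rule gl_pair_self)
  show "br q r (sg k * x) y = sg k * br q r x y" "br q r x (sg k * y) = sg k * br q r x y"
    by (rule br_scale)+
qed

lemma x_x_mixed:
  assumes "1 \<le> i" "i + 1 \<le> N" "1 \<le> j" "j + 1 \<le> N"
  shows "br (pt i) (pt j) (xp i) (xm j) = (if i = j then h i else 0)"
proof -
  interpret gl_pair N s E E by (rule gl_pair_self)
  show ?thesis using x_j_mixed(1)[OF assms] by (simp add: jp_def xp_def jh_def h_def)
qed

lemma h_x:
  assumes "1 \<le> i" "i + 1 \<le> N" "1 \<le> j" "j + 1 \<le> N"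
  shows "br 0 q (h i) (xp j) = of_int (cart i j) * xp j" "br 0 q (h i) (xm j) = - of_int (cart i j) * xm j"
    "br 0 0 (h i) (h j) = 0"
proof -
  interpret gl_pair N s E E by (rule gl_pair_self)
  show "br 0 q (h i) (xp j) = of_int (cart i j) * xp j" "br 0 q (h i) (xm j) = - of_int (cart i j) * xm j"
    "br 0 0 (h i) (h j) = 0"
    using h_j(2)[OF assms, of q] h_j(3)[OF assms, of q] h_j(1)[OF assms]
    by (simp_all add: jp_def xp_def jm_def xm_def jh_def h_def)
qed

lemma x_x_same:
  assumes "1 \<le> i" "i + 1 \<le> N" "s i \<noteq> s (i + 1)"
  shows "br 1 1 (xp i) (xp i) = 0" "br 1 1 (xm i) (xm i) = 0"
  using E_odd[of i "i + 1"] E_odd[of "i + 1" i] assms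
  by (simp_all add: br_def xp_def xm_def sg_left mult.assoc)

lemma x_x_far:
  assumes "1 \<le> i" "i + 1 \<le> N" "1 \<le> j" "j + 1 \<le> N" "j + 1 < i \<or> i + 1 < j"
  shows "br (pt i) (pt j) (xp i) (xp j) = 0" "br (pt i) (pt j) (xm i) (xm j) = 0"
  using assms br_E[of i "i + 1" j "j + 1" "pt i" "pt j"] br_E[of "i + 1" i "j + 1" j "pt i" "pt j"]
  by (auto simp: xp_def xm_def br_sg sign_pt signs)

lemma br_next:
  assumes "1 \<le> i" "i + 2 \<le> N"
  shows "br (pt i) (pt (i + 1)) (xp i) (xp (i + 1)) = E i (i + 2)"
    "br (pt (i + 1)) (pt i) (xp (i + 1)) (xp i) = - ks i (i + 1) (i + 1) (i + 2) * E i (i + 2)"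
    "br (pt i) (pt (i + 1)) (xm i) (xm (i + 1)) = - sg i * (sg (i + 1) * (ks i (i + 1) (i + 1) (i + 2) * E (i + 2) i))"
    "br (pt (i + 1)) (pt i) (xm (i + 1)) (xm i) = sg i * (sg (i + 1) * E (i + 2) i)"
  using assms br_E[of i "i + 1" "i + 1" "i + 2" "pt i" "pt (i + 1)"]
    br_E[of "i + 1" "i + 2" i "i + 1" "pt (i + 1)" "pt i"]
    br_E[of "i + 1" i "i + 2" "i + 1" "pt i" "pt (i + 1)"]
    br_E[of "i + 2" "i + 1" "i + 1" i "pt (i + 1)" "pt i"]
    sign_pt[of i "i + 1"] sign_pt[of "i + 1" i] ks_sym[of "i + 1" "i + 2" i "i + 1"]
    sg_left[of "sg (i + 1)" i "E (i + 2) i"]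
    sg_left[of "sg (i + 1)" i "ks i (i + 1) (i + 1) (i + 2) * E (i + 2) i"]
  by (simp_all add: xp_def xm_def br_sg)

lemma serre_sign:
  "(-1) ^ (pt i * ((pt i + pt (i + 1)) mod 2)) = ks i (i + 1) i (i + 2)"
  "(-1) ^ (pt i * ((pt i + pt (i + 1)) mod 2)) = ks (i + 1) i (i + 2) i"
  "(-1) ^ (pt (i + 1) * ((pt (i + 1) + pt i) mod 2)) = ks (i + 1) (i + 2) i (i + 2)"
  "(-1) ^ (pt (i + 1) * ((pt (i + 1) + pt i) mod 2)) = ks (i + 2) (i + 1) (i + 2) i"
  "(-1) ^ (((pt i + pt (i + 1)) mod 2) * ((pt (i + 1) + pt (i + 2)) mod 2)) = ks i (i + 2) (i + 1) (i + 3)"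
  "(-1) ^ (((pt i + pt (i + 1)) mod 2) * ((pt (i + 1) + pt (i + 2)) mod 2)) = ks (i + 2) i (i + 3) (i + 1)"
  using s01[of i] s01[of "i + 1"] s01[of "i + 2"] s01[of "i + 3"]
  by (elim disjE; simp add: pt_def ks_def eval_nat_numeral)+

lemma br_sign: "br q r x (ks a b c d * y) = ks a b c d * br q r x y" "br q r (ks a b c d * y) x = ks a b c d * br q r y x"
  "br q r x (- y) = - br q r x y" "br q r (- y) x = - br q r y x"
  by (simp_all add: ks_def br_def minus_one_power_iff)

text \<open>The bracket of two neighbours is, up to sign, a matrix unit whose indices are two apart;
  it has no matching index with either neighbour, so the outer bracket is zero.\<close>

lemma serre:
  assumes "1 \<le> i" "i + 2 \<le> N"
  shows "br (pt i) ((pt i + pt (i + 1)) mod 2) (xp i) (br (pt i) (pt (i + 1)) (xp i) (xp (i + 1))) = 0"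
    "br (pt (i + 1)) ((pt (i + 1) + pt i) mod 2) (xp (i + 1)) (br (pt (i + 1)) (pt i) (xp (i + 1)) (xp i)) = 0"
    "br (pt i) ((pt i + pt (i + 1)) mod 2) (xm i) (br (pt i) (pt (i + 1)) (xm i) (xm (i + 1))) = 0"
    "br (pt (i + 1)) ((pt (i + 1) + pt i) mod 2) (xm (i + 1)) (br (pt (i + 1)) (pt i) (xm (i + 1)) (xm i)) = 0"
  unfolding br_next[OF assms] using assms
    br_E[OF _ _ _ _ serre_sign(1)[of i]] br_E[OF _ _ _ _ serre_sign(2)[of i]]
    br_E[OF _ _ _ _ serre_sign(3)[of i]] br_E[OF _ _ _ _ serre_sign(4)[of i]]
  by (simp_all add: xp_def xm_def br_sg br_sign)

lemma odd_serre:
  assumes "1 \<le> i" "i + 3 \<le> N"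
  shows "br ((pt i + pt (i + 1)) mod 2) ((pt (i + 1) + pt (i + 2)) mod 2)
      (br (pt i) (pt (i + 1)) (xp i) (xp (i + 1))) (br (pt (i + 1)) (pt (i + 2)) (xp (i + 1)) (xp (i + 2))) = 0"
    "br ((pt i + pt (i + 1)) mod 2) ((pt (i + 1) + pt (i + 2)) mod 2)
      (br (pt i) (pt (i + 1)) (xm i) (xm (i + 1))) (br (pt (i + 1)) (pt (i + 2)) (xm (i + 1)) (xm (i + 2))) = 0"
  using assms br_next[of i] br_next[of "i + 1"]
    br_E[OF _ _ _ _ serre_sign(5)[of i]] br_E[OF _ _ _ _ serre_sign(6)[of i]]
  by (simp_all add: br_sg br_sign eval_nat_numeral)

end

section \<open>Right modules over the degenerate double affine Hecke algebra\<close>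

lemma daha_rel_closed: "daha_rel l t c \<subseteq> carrier (free_algebra (dgens l))"
proof
  have one: "1 \<in> carrier (free_algebra (dgens l))"
    using ring.ring_simprules(6)[OF free_algebra_ring[of "dgens l"]] by (simp add: free_algebra_def)
  have gens: "dperm \<sigma> \<in> carrier (free_algebra (dgens l))" if "\<sigma> permutes {1..l}" for \<sigma>
    using that by (intro gen_closed) (auto simp: dgens_def)
  have gens': "dx i \<in> carrier (free_algebra (dgens l))" "dxinv i \<in> carrier (free_algebra (dgens l))"
    "dy i \<in> carrier (free_algebra (dgens l))" if "i \<in> {1..l}" for i
    using that by (auto intro!: gen_closed simp: dgens_def)
  have range: "\<sigma> i \<in> {1..l}" if "\<sigma> permutes {1..l}" "i \<in> {1..l}" for \<sigma> i
    using permutes_in_image[OF that(1), of i] that(2) by blast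
  note cl = free_algebra_closed free_algebra_add_closed free_algebra_zero_closed free_algebra_sum_closed
    cscale_closed one gens gens' permutes_id permutes_inv permutes_compose permutes_swap_id
  have neg: "- x \<in> carrier (free_algebra (dgens l))" if "x \<in> carrier (free_algebra (dgens l))" for x
    using free_algebra_closed(2)[OF free_algebra_zero_closed that] by simp
  fix x assume "x \<in> daha_rel l t c"
  then show "x \<in> carrier (free_algebra (dgens l))"
  proof cases
    case (perm_x \<sigma> i)
    then show ?thesis using range[OF perm_x(2,3)] by (auto intro!: cl simp del: atLeastAtMost_iff)
  next
    case (perm_y \<sigma> i)
    then show ?thesis using range[OF perm_y(2,3)] by (auto intro!: cl simp del: atLeastAtMost_iff)
  qed (auto intro!: cl neg simp del: atLeastAtMost_iff)
qed

locale daha_right_module = right_algebra_module "daha l t c" M act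
  for l :: nat and t c :: complex and M :: "(complex, 'm) module" and act :: "'m \<Rightarrow> dgen free_alg set \<Rightarrow> 'm"
begin

abbreviation "FA \<equiv> carrier (free_algebra (dgens l))"
abbreviation "cl \<equiv> daha_class l t c"

text \<open>Acting through representatives in the free algebra lets sums and products be written in
  its type class instead of with cosets.\<close>

definition ract :: "'m \<Rightarrow> dgen free_alg \<Rightarrow> 'm" where "ract x f = act x (cl f)"

sublocale cl: ring_hom_ring "free_algebra (dgens l)" "daha l t c" "daha_class l t c"
  using presented_algebra_ring_hom[OF daha_rel_closed] by (simp add: daha_def daha_class_def[abs_def])

lemma FA_simps [simp]: "f \<oplus>\<^bsub>free_algebra G\<^esub> g = f + g" "f \<otimes>\<^bsub>free_algebra G\<^esub> g = f * g"
  "\<one>\<^bsub>free_algebra G\<^esub> = 1" "\<zero>\<^bsub>free_algebra G\<^esub> = 0"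
  by (simp_all add: free_algebra_def)

lemma FA_one [simp]: "1 \<in> FA"
  using cl.R.one_closed by simp

lemma FA_perm [simp]: "\<sigma> permutes {1..l} \<Longrightarrow> dperm \<sigma> \<in> FA"
  by (intro gen_closed) (auto simp: dgens_def)

lemma FA_x [simp]: "i \<in> {1..l} \<Longrightarrow> dx i \<in> FA" and FA_y [simp]: "i \<in> {1..l} \<Longrightarrow> dy i \<in> FA"
  by (auto intro!: gen_closed simp: dgens_def)

lemmas FA_closed = free_algebra_closed free_algebra_add_closed free_algebra_zero_closed free_algebra_sum_closed
    cscale_closed

lemma FA_transpose [simp]: "i \<in> {1..l} \<Longrightarrow> j \<in> {1..l} \<Longrightarrow> dperm (transpose i j) \<in> FA"
  by (simp add: permutes_swap_id)

lemma ract_closed [simp]: "x \<in> carrier M \<Longrightarrow> f \<in> FA \<Longrightarrow> ract x f \<in> carrier M"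
  by (simp add: ract_def act_closed)

lemma ract_linear:
  assumes "x \<in> carrier M" "f \<in> FA"
  shows "g \<in> FA \<Longrightarrow> ract x (f + g) = ract x f \<oplus>\<^bsub>M\<^esub> ract x g"
    and "g \<in> FA \<Longrightarrow> ract x (f * g) = ract (ract x f) g"
    and "ract x (cscale k f) = k \<odot>\<^bsub>M\<^esub> ract x f"
    and "y \<in> carrier M \<Longrightarrow> ract (x \<oplus>\<^bsub>M\<^esub> y) f = ract x f \<oplus>\<^bsub>M\<^esub> ract y f"
    and "ract (k \<odot>\<^bsub>M\<^esub> x) f = k \<odot>\<^bsub>M\<^esub> ract x f"
proof -
  show "g \<in> FA \<Longrightarrow> ract x (f + g) = ract x f \<oplus>\<^bsub>M\<^esub> ract x g"
    using assms cl.hom_add[of f g] by (simp add: ract_def act_add_right)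
  show "g \<in> FA \<Longrightarrow> ract x (f * g) = ract (ract x f) g"
    using assms cl.hom_mult[of f g] by (simp add: ract_def act_mult)
  show "ract x (cscale k f) = k \<odot>\<^bsub>M\<^esub> ract x f"
    using presented_class_cscale[OF daha_rel_closed assms(2), of t c k]
      act_smult_right[OF assms(1) cl.hom_closed[OF assms(2)], of k]
    by (simp add: ract_def daha_class_def daha_def)
  show "y \<in> carrier M \<Longrightarrow> ract (x \<oplus>\<^bsub>M\<^esub> y) f = ract x f \<oplus>\<^bsub>M\<^esub> ract y f"
    "ract (k \<odot>\<^bsub>M\<^esub> x) f = k \<odot>\<^bsub>M\<^esub> ract x f"
    using assms by (simp_all add: ract_def act_add_left act_smult_left)
qed

lemma ract_one: "x \<in> carrier M \<Longrightarrow> ract x 1 = x"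
  using cl.hom_one act_one by (simp add: ract_def)

sublocale M: module complex_ring M
  by (rule vector_space)

text \<open>The linear relations that turn formal combinations of elements of \<open>M\<close> into
  elements of \<open>M\<close>. They allow right multiplications to be treated as elements of the
  ring of operators, with basis vectors outside the carrier sent to 0.\<close>

definition module_rels :: "('m \<Rightarrow>\<^sub>0 complex) set" where
  "module_rels = {Poly_Mapping.single (x \<oplus>\<^bsub>M\<^esub> y) 1 - Poly_Mapping.single x 1 - Poly_Mapping.single y 1 | x y.
      x \<in> carrier M \<and> y \<in> carrier M}
    \<union> {Poly_Mapping.single (k \<odot>\<^bsub>M\<^esub> x) 1 - Poly_Mapping.single x k | k x. x \<in> carrier M}"

definition right_op :: "dgen free_alg \<Rightarrow> 'm linop" where
  "right_op f = desc module_rels (lin (\<lambda>x. if x \<in> carrier M then Poly_Mapping.single (ract x f) 1 else 0))"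

lemma rep_add:
  assumes "x \<in> carrier M" "y \<in> carrier M"
  shows "rep module_rels (x \<oplus>\<^bsub>M\<^esub> y) = rep module_rels x + rep module_rels y"
proof -
  have "Poly_Mapping.single (x \<oplus>\<^bsub>M\<^esub> y) 1 - Poly_Mapping.single x 1 - Poly_Mapping.single y 1 \<in> module_rels"
    using assms by (auto simp: module_rels_def)
  from proj_rel[OF this] show ?thesis by (simp add: app_diff diff_eq_eq)
qed

lemma rep_smult:
  assumes "x \<in> carrier M"
  shows "rep module_rels (k \<odot>\<^bsub>M\<^esub> x) = cscale k (rep module_rels x)"
proof -
  have "Poly_Mapping.single (k \<odot>\<^bsub>M\<^esub> x) 1 - cscale k (Poly_Mapping.single x 1) \<in> module_rels"
    using assms by (auto simp: module_rels_def cscale_simps)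
  from proj_rel[OF this] show ?thesis by (simp add: app_diff app_linear)
qed

lemma right_op_single: "app (right_op f) (Poly_Mapping.single x 1) = (if x \<in> carrier M then rep module_rels (ract x f) else 0)"
  by (simp add: right_op_def desc_def)

lemma carrier_smult [simp]: "x \<in> carrier M \<Longrightarrow> k \<odot>\<^bsub>M\<^esub> x \<in> carrier M"
  by (rule M.smult_closed) (simp_all add: ring_of_type_algebra_def)

lemma right_op_proj:
  assumes "f \<in> FA"
  shows "app (right_op f) (app (proj (cvec.span module_rels)) u) = app (right_op f) u"
  unfolding right_op_def
proof (rule desc_proj, fold right_op_def)
  fix u assume "u \<in> module_rels"
  then show "app (right_op f) u = 0"
    unfolding module_rels_def
  proof (elim UnE CollectE exE conjE)
    fix x y assume "x \<in> carrier M" "y \<in> carrier M"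
      and u: "u = Poly_Mapping.single (x \<oplus>\<^bsub>M\<^esub> y) 1 - Poly_Mapping.single x 1 - Poly_Mapping.single y 1"
    then show "app (right_op f) u = 0"
      unfolding u app_diff right_op_single using assms by (simp add: ract_linear rep_add)
  next
    fix k x assume "x \<in> carrier M" and "u = Poly_Mapping.single (k \<odot>\<^bsub>M\<^esub> x) 1 - Poly_Mapping.single x k"
    then have x: "x \<in> carrier M" and u: "u = Poly_Mapping.single (k \<odot>\<^bsub>M\<^esub> x) 1 - cscale k (Poly_Mapping.single x 1)"
      by (simp_all add: cscale_simps)
    show "app (right_op f) u = 0"
      unfolding u app_diff app_linear right_op_single using assms x by (simp add: ract_linear rep_smult)
  qed
qed

text \<open>A right action reverses products, so every relation of the Hecke algebra is read
  backwards in the operators below.\<close>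

lemma right_op_mult:
  assumes "f \<in> FA" "g \<in> FA"
  shows "right_op (f * g) = right_op g * right_op f"
  by (rule linop_eq_on_single) (use assms in \<open>simp add: right_op_single right_op_proj ract_linear\<close>)

lemma right_op_add:
  assumes "f \<in> FA" "g \<in> FA"
  shows "right_op (f + g) = right_op f + right_op g"
  by (rule linop_eq_on_single) (use assms in \<open>simp add: right_op_single ract_linear rep_add\<close>)

lemma right_op_cscale:
  assumes "f \<in> FA"
  shows "right_op (cscale k f) = smul k (right_op f)"
  by (rule linop_eq_on_single) (use assms in \<open>simp add: right_op_single ract_linear rep_smult cscale_simps\<close>)

lemma right_op_zero: "right_op 0 = 0"
  using right_op_cscale[of 0 0] by (simp add: cscale_simps smul_simps free_algebra_zero_closed)

lemma right_op_diff:
  assumes "f \<in> FA" "g \<in> FA"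
  shows "right_op (f - g) = right_op f - right_op g"
  using right_op_add[of "f - g" g] assms by (simp add: FA_closed)

lemma right_op_sum: "(\<And>a. a \<in> A \<Longrightarrow> f a \<in> FA) \<Longrightarrow> right_op (sum f A) = (\<Sum>a\<in>A. right_op (f a))"
  by (induction A rule: infinite_finite_induct) (simp_all add: right_op_zero right_op_add FA_closed)

lemma right_op_rel:
  assumes "f - g \<in> daha_rel l t c" "f \<in> FA" "g \<in> FA"
  shows "right_op f = right_op g"
proof -
  have e: "cl (f - g) = cl 0"
    unfolding daha_class_def by (rule presented_class_rel[OF daha_rel_closed assms(1)])
  have "right_op (f - g) = right_op 0" unfolding right_op_def ract_def e ..
  then show ?thesis using assms by (simp add: right_op_diff right_op_zero)
qed

text \<open>\<open>right_op 1\<close> is a unit for these operators only: it projects and kills the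
  basis vectors outside the carrier, and so need not be the identity of the operator ring.\<close>

lemma right_op_one: "f \<in> FA \<Longrightarrow> right_op 1 * right_op f = right_op f" "f \<in> FA \<Longrightarrow> right_op f * right_op 1 = right_op f"
  by (simp_all flip: right_op_mult)

lemma right_op_eqD:
  assumes "right_op f = right_op g" "x \<in> carrier M"
  shows "rep module_rels (ract x f) = rep module_rels (ract x g)"
  using assms right_op_single[of f x] right_op_single[of g x] by simp

text \<open>An additive and homogeneous map vanishes on the span of \<open>module_rels\<close>, so
  it cannot separate elements with the same image. This carries operator identities over to
  tensors.\<close>

lemma rep_eqD:
  assumes "rep module_rels x = rep module_rels y"
    and "\<And>x y. x \<in> carrier M \<Longrightarrow> y \<in> carrier M \<Longrightarrow> \<phi> (x \<oplus>\<^bsub>M\<^esub> y) = \<phi> x + \<phi> y"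
    and "\<And>k x. x \<in> carrier M \<Longrightarrow> \<phi> (k \<odot>\<^bsub>M\<^esub> x) = cscale k (\<phi> x)"
  shows "\<phi> x = \<phi> y"
proof -
  have "app (proj (cvec.span module_rels)) (Poly_Mapping.single x 1 - Poly_Mapping.single y 1) = 0"
    using assms(1) by (simp add: app_diff)
  then have "Poly_Mapping.single x 1 - Poly_Mapping.single y 1 \<in> cvec.span module_rels"
    by (simp add: proj_span_iff)
  moreover have "lin_ext \<phi> u = 0" if "u \<in> module_rels" for u
    using that unfolding module_rels_def
    by (auto simp: lin_ext_single_diff lin_ext_single cscale_simps assms(2,3))
  ultimately have "lin_ext \<phi> (Poly_Mapping.single x 1 - Poly_Mapping.single y 1) = 0"
    by (rule span_lin_ext_zero[rotated])
  then show ?thesis by (simp add: lin_ext_single_diff lin_ext_single cscale_simps)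
qed

definition xy_op :: "nat \<Rightarrow> 'm linop" where "xy_op i = right_op (dx i * dy i)"
text \<open>The parameter is absorbed into the transposition, so that
  \<open>transposition_ops\<close> involves no scalars.\<close>

definition swap_op :: "nat \<Rightarrow> nat \<Rightarrow> 'm linop" where "swap_op i j = smul c (right_op (dperm (transpose i j)))"

lemma right_op_perm:
  assumes "\<sigma> permutes {1..l}" "\<tau> permutes {1..l}"
  shows "right_op (dperm \<sigma>) * right_op (dperm \<tau>) = right_op (dperm (\<tau> \<circ> \<sigma>))"
proof -
  have "right_op (dperm \<tau> * dperm \<sigma>) = right_op (dperm (\<tau> \<circ> \<sigma>))"
    using assms by (intro right_op_rel daha_rel.perm_mult) (simp_all add: FA_closed permutes_compose)
  then show ?thesis using assms by (simp add: right_op_mult)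
qed

lemma right_op_perm_inv:
  assumes "\<sigma> permutes {1..l}" "g \<in> FA"
  shows "right_op (dperm \<sigma>) * (right_op (dperm (Hilbert_Choice.inv \<sigma>)) * right_op g) = right_op g"
proof -
  have "right_op (dperm id) = right_op 1"
    by (rule right_op_rel) (simp_all add: daha_rel.perm_id permutes_id)
  then show ?thesis
    using assms right_op_perm[OF assms(1) permutes_inv[OF assms(1)]]
    by (simp add: right_op_one permutes_inv_o flip: mult.assoc)
qed

lemma permutes_range: "\<sigma> permutes {1..l} \<Longrightarrow> i \<in> {1..l} \<Longrightarrow> \<sigma> i \<in> {1..l}"
  using permutes_in_image[of \<sigma> "{1..l}" i] by blast

text \<open>The relation \<sigma> x_i \<sigma>^-1 = x_(\<sigma> i), read backwards and with the
  inverse moved to the other side.\<close>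

lemma right_op_perm_x:
  assumes "\<sigma> permutes {1..l}" "i \<in> {1..l}"
  shows "right_op (dperm \<sigma>) * right_op (dx (\<sigma> i)) = right_op (dx i) * right_op (dperm \<sigma>)"
    and "right_op (dperm \<sigma>) * right_op (dy (\<sigma> i)) = right_op (dy i) * right_op (dperm \<sigma>)"
proof -
  note c = assms permutes_inv[OF assms(1)] permutes_range[OF assms]
  have "right_op (dperm \<sigma> * dx i * dperm (Hilbert_Choice.inv \<sigma>)) = right_op (dx (\<sigma> i))"
    by (rule right_op_rel) (use c in \<open>simp_all add: daha_rel.perm_x FA_closed del: atLeastAtMost_iff\<close>)
  then have "right_op (dx (\<sigma> i)) = right_op (dperm (Hilbert_Choice.inv \<sigma>)) * right_op (dperm \<sigma> * dx i)"
    using c by (simp add: right_op_mult FA_closed(1) del: atLeastAtMost_iff)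
  then show "right_op (dperm \<sigma>) * right_op (dx (\<sigma> i)) = right_op (dx i) * right_op (dperm \<sigma>)"
    using c right_op_perm_inv[OF assms(1), of "dperm \<sigma> * dx i"] by (simp add: right_op_mult FA_closed(1) del: atLeastAtMost_iff)
  have "right_op (dperm \<sigma> * dy i * dperm (Hilbert_Choice.inv \<sigma>)) = right_op (dy (\<sigma> i))"
    by (rule right_op_rel) (use c in \<open>simp_all add: daha_rel.perm_y FA_closed del: atLeastAtMost_iff\<close>)
  then have "right_op (dy (\<sigma> i)) = right_op (dperm (Hilbert_Choice.inv \<sigma>)) * right_op (dperm \<sigma> * dy i)"
    using c by (simp add: right_op_mult FA_closed(1) del: atLeastAtMost_iff)
  then show "right_op (dperm \<sigma>) * right_op (dy (\<sigma> i)) = right_op (dy i) * right_op (dperm \<sigma>)"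
    using c right_op_perm_inv[OF assms(1), of "dperm \<sigma> * dy i"] by (simp add: right_op_mult FA_closed(1) del: atLeastAtMost_iff)
qed

lemma right_op_perm_xy:
  assumes "\<sigma> permutes {1..l}" "i \<in> {1..l}"
  shows "right_op (dperm \<sigma>) * xy_op (\<sigma> i) = xy_op i * right_op (dperm \<sigma>)"
proof -
  note r = permutes_range[OF assms]
  have "right_op (dperm \<sigma>) * xy_op (\<sigma> i) = right_op (dperm \<sigma>) * right_op (dy (\<sigma> i)) * right_op (dx (\<sigma> i))"
    using r by (simp add: xy_op_def right_op_mult mult.assoc)
  also have "\<dots> = right_op (dy i) * (right_op (dperm \<sigma>) * right_op (dx (\<sigma> i)))"
    by (simp add: right_op_perm_x[OF assms] mult.assoc)
  finally show ?thesis
    using assms by (simp add: right_op_perm_x[OF assms] xy_op_def right_op_mult mult.assoc)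
qed

lemma transpose_conj: "inj f \<Longrightarrow> transpose (f a) (f b) \<circ> f = f \<circ> transpose a b"
  by (auto simp: fun_eq_iff transpose_def inj_eq)

lemma right_op_perm_swap:
  assumes "\<sigma> permutes {1..l}" "i \<in> {1..l}" "j \<in> {1..l}"
  shows "right_op (dperm \<sigma>) * swap_op (\<sigma> i) (\<sigma> j) = swap_op i j * right_op (dperm \<sigma>)"
  using assms permutes_range[OF assms(1)]
  by (simp add: swap_op_def smul_simps right_op_perm permutes_swap_id transpose_conj[OF permutes_inj[OF assms(1)]])

sublocale transposition_ops l swap_op xy_op
proof
  fix i j assume ij: "i \<in> {1..l}" "j \<in> {1..l}"
  then show "swap_op i j = swap_op j i" by (simp add: swap_op_def transpose_commute)
  assume ne: "i \<noteq> j"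
  have t: "transpose i j permutes {1..l}" by (rule permutes_swap_id) fact+
  note r = permutes_range[OF t]
  fix a assume a: "a \<in> {1..l}"
  show "swap_op i j * xy_op a = xy_op (transpose i j a) * swap_op i j"
    using right_op_perm_xy[OF t r[OF a]] by (simp add: swap_op_def smul_simps transpose_involutory)
  fix b assume b: "b \<in> {1..l}" "a \<noteq> b"
  show "swap_op i j * swap_op a b = swap_op (transpose i j a) (transpose i j b) * swap_op i j"
    using right_op_perm_swap[OF t r[OF a] r[OF b(1)]]
    by (simp add: swap_op_def[of i j] smul_simps transpose_involutory)
next
  fix i j assume ij: "i \<in> {1..l}" "j \<in> {1..l}" "i \<noteq> j"
  let ?x = "\<lambda>i. right_op (dx i)" and ?y = "\<lambda>i. right_op (dy i)"
  have xx: "?x i * ?x j = ?x j * ?x i" and yy: "?y i * ?y j = ?y j * ?y i"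
    using right_op_rel[OF daha_rel.xx[of j l i]] right_op_rel[OF daha_rel.yy[of j l i]] ij
    by (simp_all add: FA_closed right_op_mult)
  \<comment> \<open>Because products are reversed, the relation for y_j x_i - x_i y_j becomes one
    for X_i Y_j - Y_j X_i.\<close>
  have yx: "?x i * ?y j = ?y j * ?x i - swap_op i j" if "i \<in> {1..l}" "j \<in> {1..l}" "i \<noteq> j" for i j
  proof -
    have n: "- cscale c (dperm (transpose i j)) = cscale (- c) (dperm (transpose i j))"
      by (simp add: cscale_minus_left)
    have m: "right_op (- cscale c (dperm (transpose i j))) = - swap_op i j"
      unfolding n by (simp only: right_op_cscale[OF FA_transpose[OF that(1,2)]] swap_op_def smul_simps)
    have "right_op (dy j * dx i - dx i * dy j) = right_op (- cscale c (dperm (transpose i j)))"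
    proof (rule right_op_rel[OF daha_rel.yx_neq[OF that]])
      show "dy j * dx i - dx i * dy j \<in> FA" "- cscale c (dperm (transpose i j)) \<in> FA"
        unfolding n by (intro FA_closed FA_x FA_y FA_transpose that)+
    qed
    then show ?thesis
      using that m
      by (simp add: right_op_diff FA_closed right_op_mult right_op_cscale swap_op_def smul_simps diff_eq_eq del: atLeastAtMost_iff)
  qed
  have S: "swap_op j i = swap_op i j" by (simp add: swap_op_def transpose_commute)
  have tr: "transpose i j permutes {1..l}" using ij by (simp add: permutes_swap_id)
  have Sx: "swap_op i j * ?x i = ?x j * swap_op i j" "swap_op i j * ?x j = ?x i * swap_op i j"
    using right_op_perm_x(1)[OF tr ij(1)] right_op_perm_x(1)[OF tr ij(2)] by (simp_all add: swap_op_def smul_simps)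
  have z: "xy_op i = ?y i * ?x i" "xy_op j = ?y j * ?x j" using ij by (simp_all add: xy_op_def right_op_mult)
  \<comment> \<open>Interchanging the two inner factors costs one swap. The remaining product of
    four factors is symmetric in \<open>i\<close> and \<open>j\<close>, as the x and the y commute
    among themselves, and drops out of the commutator.\<close>
  have "xy_op i * xy_op j = ?y i * (?x i * ?y j) * ?x j" by (simp add: z mult.assoc)
  also have "\<dots> = ?y i * ?y j * (?x i * ?x j) - ?y i * (swap_op i j * ?x j)"
    by (simp only: yx[OF ij]) (simp add: algebra_simps)
  finally have 1: "xy_op i * xy_op j = ?y i * ?y j * (?x i * ?x j) - xy_op i * swap_op i j"
    by (simp add: Sx z mult.assoc)
  have "xy_op j * xy_op i = ?y j * (?x j * ?y i) * ?x i" by (simp add: z mult.assoc)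
  also have "\<dots> = ?y j * ?y i * (?x j * ?x i) - ?y j * (swap_op i j * ?x i)"
    using ij(3) by (simp only: yx[OF ij(2,1) ij(3)[symmetric]] S) (simp add: algebra_simps)
  finally have 2: "xy_op j * xy_op i = ?y j * ?y i * (?x j * ?x i) - xy_op j * swap_op i j"
    by (simp add: Sx z mult.assoc)
  show "xy_op i * xy_op j - xy_op j * xy_op i = (xy_op j - xy_op i) * swap_op i j"
    unfolding 1 2 xx yy by (simp add: left_diff_distrib)
qed

lemma frak_y_closed [simp]: "i \<in> {1..l} \<Longrightarrow> frak_y l t c i \<in> FA"
proof -
  assume i: "i \<in> {1..l}"
  have "(\<Sum>j\<in>{1..<i}. dperm (transpose i j)) \<in> FA"
    "(\<Sum>j\<in>{1..l} - {i}. cscale (nsign j i) (dperm (transpose i j))) \<in> FA"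
    using i by (intro free_algebra_sum_closed; intro cscale_closed FA_transpose; auto)+
  then show ?thesis
    unfolding frak_y_def calU_def using i by (intro FA_closed(1,3,6) FA_one FA_x FA_y)
qed

text \<open>For j < i the coefficient is c - c/2 and for j > i it is c/2: the sign term turns the
  one-sided sum in \<open>calU\<close> into a sum symmetric in all j \<noteq> i.\<close>

lemma right_op_frak_y:
  assumes "i \<in> {1..l}"
  shows "right_op (frak_y l t c i) = smul (t / 2) (right_op 1) + xy_op i + smul (1 / 2) (\<Sum>j\<in>{1..l} - {i}. swap_op i j)"
proof -
  let ?s = "\<lambda>j. dperm (transpose i j)"
  have "cscale c (\<Sum>j\<in>{1..<i}. ?s j) = (\<Sum>j\<in>{1..l} - {i}. if j < i then cscale c (?s j) else 0)"
    unfolding cscale_sum by (rule sum.mono_neutral_cong_left) (use assms in auto)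
  also have "\<dots> + cscale (c / 2) (\<Sum>j\<in>{1..l} - {i}. cscale (nsign j i) (?s j))
      = cscale (c / 2) (\<Sum>j\<in>{1..l} - {i}. ?s j)"
    unfolding cscale_sum sum.distrib[symmetric]
  proof (intro sum.cong refl)
    fix j assume "j \<in> {1..l} - {i}"
    then have "(if j < i then c else 0) + c / 2 * nsign j i = c / 2" by (auto simp: nsign_def)
    from arg_cong[OF this, of "\<lambda>u. cscale u (?s j)"]
    show "(if j < i then cscale c (?s j) else 0) + cscale (c / 2) (cscale (nsign j i) (?s j)) = cscale (c / 2) (?s j)"
      by (simp add: cscale_simps split: if_splits)
  qed
  finally have "frak_y l t c i = cscale (t / 2) 1 + dx i * dy i + cscale (c / 2) (\<Sum>j\<in>{1..l} - {i}. ?s j)"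
    by (simp add: frak_y_def calU_def add.assoc)
  moreover have P: "\<And>j. j \<in> {1..l} - {i} \<Longrightarrow> ?s j \<in> FA" using assms by (intro FA_transpose) auto
  moreover have "cscale (t / 2) 1 \<in> FA" "dx i * dy i \<in> FA"
    using assms by (intro FA_closed FA_one FA_x FA_y; assumption)+
  moreover have "(\<Sum>j\<in>{1..l} - {i}. ?s j) \<in> FA"
    by (rule free_algebra_sum_closed) (rule P)
  moreover from this have "cscale (c / 2) (\<Sum>j\<in>{1..l} - {i}. ?s j) \<in> FA"
    by (rule cscale_closed)
  moreover have "cscale (t / 2) 1 + dx i * dy i \<in> FA"
    using assms by (intro FA_closed FA_one FA_x FA_y)
  ultimately show ?thesis
    by (simp only: right_op_add right_op_cscale right_op_sum FA_one) (simp add: xy_op_def swap_op_def smul_simps smul_sum)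
qed

text \<open>The symmetric form makes conjugation by \<open>\<sigma>\<close> a mere renaming of
  indices. This is the compatibility needed over the group algebra.\<close>

lemma right_op_perm_frak_y:
  assumes "\<sigma> permutes {1..l}" "i \<in> {1..l}"
  shows "right_op (dperm \<sigma> * frak_y l t c i) = right_op (frak_y l t c (\<sigma> i) * dperm \<sigma>)"
proof -
  have "(\<Sum>j\<in>{1..l} - {\<sigma> i}. swap_op (\<sigma> i) j) = (\<Sum>j\<in>{1..l} - {i}. swap_op (\<sigma> i) (\<sigma> j))"
    by (rule sum.reindex_bij_witness[of _ \<sigma> "Hilbert_Choice.inv \<sigma>"])
      (use assms permutes_range permutes_inverses[OF assms(1)] permutes_inv[OF assms(1)]
        injD[OF permutes_inj[OF assms(1)]] in \<open>auto simp del: atLeastAtMost_iff\<close>)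
  then have "right_op (dperm \<sigma>) * (\<Sum>j\<in>{1..l} - {\<sigma> i}. swap_op (\<sigma> i) j) = (\<Sum>j\<in>{1..l} - {i}. swap_op i j) * right_op (dperm \<sigma>)"
    using right_op_perm_swap[OF assms] by (simp add: sum_distrib_left sum_distrib_right)
  then show ?thesis
    using assms permutes_range[OF assms]
    by (simp add: right_op_mult right_op_frak_y distrib_left distrib_right smul_simps right_op_perm_xy right_op_one)
qed

text \<open>For pairwise disjoint \<open>A\<close>, \<open>C\<close>, \<open>C'\<close> covering the positions, with \<open>C\<close> the positions of
  the smaller and \<open>C'\<close> those of the larger entries of a word, this is a partial sum of
  Cherednik operators.\<close>

definition level_sum :: "nat set \<Rightarrow> nat set \<Rightarrow> nat set \<Rightarrow> dgen free_alg" where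
  "level_sum A C C' = (\<Sum>b\<in>A. frak_y l t c b - cscale (c / 2)
      ((\<Sum>a\<in>C'. dperm (transpose a b)) - (\<Sum>a\<in>C. dperm (transpose a b))))"

lemma level_sum_closed: "A \<subseteq> {1..l} \<Longrightarrow> C \<subseteq> {1..l} \<Longrightarrow> C' \<subseteq> {1..l} \<Longrightarrow> level_sum A C C' \<in> FA"
  unfolding level_sum_def by (intro FA_closed frak_y_closed FA_transpose) auto

text \<open>In \<open>frak_y\<close> every transposition with \<open>b\<close> has coefficient c/2.
  Subtracting the sum over \<open>C'\<close> and adding the one over \<open>C\<close> leaves c/2 on
  \<open>A\<close>, c on \<open>C\<close> and 0 on \<open>C'\<close>. Doubling yields
  \<open>level_op\<close>, apart from the constant t for each element of \<open>A\<close>.\<close>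

lemma right_op_level_sum:
  assumes "A \<union> C \<union> C' = {1..l}" "A \<inter> C = {}" "A \<inter> C' = {}" "C \<inter> C' = {}"
  shows "smul 2 (right_op (level_sum A C C')) = smul (t * of_nat (card A)) (right_op 1) + level_op A C"
proof -
  have sub: "A \<subseteq> {1..l}" "C \<subseteq> {1..l}" "C' \<subseteq> {1..l}" using assms(1) by auto
  then have fin: "finite A" "finite C" "finite C'" using finite_subset by blast+
  have two: "smul 2 x = 2 * x" for x :: "'m linop" using smul_of_int[of 2 x] by simp
  have 1: "smul 2 (right_op (frak_y l t c b - cscale (c / 2)
      ((\<Sum>a\<in>C'. dperm (transpose a b)) - (\<Sum>a\<in>C. dperm (transpose a b)))))
    = smul t (right_op 1) + 2 * xy_op b + (\<Sum>a\<in>A - {b}. swap_op b a) + 2 * (\<Sum>a\<in>C. swap_op b a)" if b: "b \<in> A" for b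
  proof -
    have S: "smul c (\<Sum>a\<in>D. right_op (dperm (transpose a b))) = (\<Sum>a\<in>D. swap_op b a)" for D
      by (simp add: smul_sum swap_op_def transpose_commute)
    have "{1..l} - {b} = (A - {b}) \<union> (C \<union> C')" using assms b by auto
    then have "(\<Sum>j\<in>{1..l} - {b}. swap_op b j) = (\<Sum>a\<in>A - {b}. swap_op b a) + ((\<Sum>a\<in>C. swap_op b a) + (\<Sum>a\<in>C'. swap_op b a))"
      using fin assms by (simp only:) (subst sum.union_disjoint; auto simp: sum.union_disjoint)+
    moreover have "b \<in> {1..l}" "\<And>a. a \<in> C \<Longrightarrow> a \<in> {1..l}" "\<And>a. a \<in> C' \<Longrightarrow> a \<in> {1..l}" using sub b by auto
    moreover from this have "right_op (frak_y l t c b - cscale (c / 2) ((\<Sum>a\<in>C'. dperm (transpose a b)) - (\<Sum>a\<in>C. dperm (transpose a b))))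
      = right_op (frak_y l t c b) - smul (1 / 2) ((\<Sum>a\<in>C'. swap_op b a) - (\<Sum>a\<in>C. swap_op b a))"
      unfolding S[symmetric]
      by (simp add: right_op_diff right_op_cscale right_op_sum FA_closed smul_simps del: atLeastAtMost_iff)
    moreover have "smul 2 (smul (1 / 2) x) = x" "smul 2 (smul (t / 2) x) = smul t x" for x :: "'m linop"
      by (simp_all add: smul_simps)
    ultimately show ?thesis
      by (simp add: right_op_frak_y smul_simps(1,2) two[symmetric] del: atLeastAtMost_iff)
        (simp add: two algebra_simps mult_2)
  qed
  have inner_swaps: "inner_swaps A = (\<Sum>b\<in>A. \<Sum>a\<in>A - {b}. swap_op b a)"
    unfolding inner_swaps_def using fin
    by (subst sum.Sigma) (auto intro!: sum.cong)
  have "right_op (level_sum A C C') = (\<Sum>b\<in>A. right_op (frak_y l t c b - cscale (c / 2)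
      ((\<Sum>a\<in>C'. dperm (transpose a b)) - (\<Sum>a\<in>C. dperm (transpose a b)))))"
    unfolding level_sum_def by (rule right_op_sum) (use sub in \<open>intro FA_closed frak_y_closed FA_transpose; blast\<close>)
  then have "smul 2 (right_op (level_sum A C C')) = (\<Sum>b\<in>A. smul t (right_op 1) + 2 * xy_op b + (\<Sum>a\<in>A - {b}. swap_op b a) + 2 * (\<Sum>a\<in>C. swap_op b a))"
    by (simp add: smul_sum 1 cong: sum.cong)
  moreover have "(\<Sum>b\<in>A. smul t (right_op 1)) = smul (t * of_nat (card A)) (right_op 1)"
    using smul_of_int[of "int (card A)" "smul t (right_op 1)"] by (simp add: smul_simps mult.commute)
  ultimately show ?thesis
    by (simp add: sum.distrib level_op_def inner_swaps sum_z_def cross_swaps_def sum_distrib_left)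
qed

lemma right_op_level_sum_commute:
  assumes A: "A \<union> C \<union> C' = {1..l}" "A \<inter> C = {}" "A \<inter> C' = {}" "C \<inter> C' = {}"
    and B: "B \<union> D \<union> D' = {1..l}" "B \<inter> D = {}" "B \<inter> D' = {}" "D \<inter> D' = {}"
    and "A \<union> C \<subseteq> D"
  shows "right_op (level_sum A C C' * level_sum B D D') = right_op (level_sum B D D' * level_sum A C C')"
proof -
  have sub: "A \<subseteq> {1..l}" "C \<subseteq> {1..l}" "C' \<subseteq> {1..l}" "B \<subseteq> {1..l}" "D \<subseteq> {1..l}" "D' \<subseteq> {1..l}"
    using A B by auto
  let ?a = "right_op (level_sum A C C')" and ?b = "right_op (level_sum B D D')"
  have cl: "level_sum A C C' \<in> FA" "level_sum B D D' \<in> FA" using level_sum_closed[OF sub(1-3)] level_sum_closed[OF sub(4-6)] .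
  have X: "level_op A C = smul 2 ?a - smul (t * of_nat (card A)) (right_op 1)" "level_op B D = smul 2 ?b - smul (t * of_nat (card B)) (right_op 1)"
    using right_op_level_sum[OF A] right_op_level_sum[OF B] by simp_all
  have "level_op A C * level_op B D = level_op B D * level_op A C" using sub assms by (intro X_commute) auto
  \<comment> \<open>The factor 4 comes from doubling both level sums; the multiples of
    \<open>right_op 1\<close> commute with everything here and cancel.\<close>
  then have "smul 4 (?a * ?b) = smul 4 (?b * ?a)"
    unfolding X using cl by (simp add: algebra_simps smul_simps right_op_one mult.commute)
  then have "smul (1 / 4) (smul 4 (?a * ?b)) = smul (1 / 4) (smul 4 (?b * ?a))" by simp
  then show ?thesis using cl by (simp add: smul_simps right_op_mult)
qed

end

section \<open>Operators on the tensor power\<close>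

definition E_op :: "nat \<Rightarrow> nat \<Rightarrow> nat \<Rightarrow> nat \<Rightarrow> nat \<Rightarrow> nat list linop" where
  "E_op m p a b k = lin (\<lambda>w. if w ! (k - 1) = b
     then Poly_Mapping.single (w[k - 1 := a])
            ((-1) ^ ((par m p a + par m p b) * (\<Sum>j = 1..<k. par m p (w ! (j - 1)))))
     else 0)"

definition perm_op :: "nat \<Rightarrow> nat \<Rightarrow> nat \<Rightarrow> (nat \<Rightarrow> nat) \<Rightarrow> nat list linop" where
  "perm_op m p l \<sigma> = lin (\<lambda>w. Poly_Mapping.single (permute_word l \<sigma> w) ((-1) ^ koszul_exp m p l \<sigma> w))"

lemma E_at_op: "E_at m p a b k v = app (E_op m p a b k) v"
  by (simp add: E_at_def E_op_def app_lin)

lemma perm_act_op: "perm_act m p l \<sigma> v = app (perm_op m p l \<sigma>) v"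
  by (simp add: perm_act_def perm_op_def app_lin)

definition words :: "nat \<Rightarrow> nat \<Rightarrow> nat \<Rightarrow> nat list set" where
  "words m n l = {w. length w = l \<and> set w \<subseteq> {1..m + n}}"

lemma tensor_power_carrier: "carrier (tensor_power m n l) = {v. Poly_Mapping.keys v \<subseteq> words m n l}"
  by (simp add: tensor_power_def free_space_def words_def)

lemma linop_eq_on_words:
  assumes "\<And>w. w \<in> words m n l \<Longrightarrow> app f (Poly_Mapping.single w 1) = app g (Poly_Mapping.single w 1)"
    and "v \<in> carrier (tensor_power m n l)"
  shows "app f v = app g v"
  using assms by (subst (1 2) app_expand) (auto intro!: sum.cong simp: tensor_power_carrier)

lemma single_word: "w \<in> words m n l \<Longrightarrow> Poly_Mapping.single w c \<in> carrier (tensor_power m n l)"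
  by (simp add: tensor_power_carrier)

lemma tensor_power_closed:
  "v \<in> carrier (tensor_power m n l) \<Longrightarrow> u \<in> carrier (tensor_power m n l) \<Longrightarrow> v + u \<in> carrier (tensor_power m n l)"
  "v \<in> carrier (tensor_power m n l) \<Longrightarrow> u \<in> carrier (tensor_power m n l) \<Longrightarrow> v - u \<in> carrier (tensor_power m n l)"
  "v \<in> carrier (tensor_power m n l) \<Longrightarrow> cscale c v \<in> carrier (tensor_power m n l)"
  "0 \<in> carrier (tensor_power m n l)"
  using Poly_Mapping.keys_add[of v u] keys_diff_subset[of v u] keys_cscale[of c v]
  by (auto simp: tensor_power_carrier)

lemma tensor_power_sum_closed:
  "(\<And>a. a \<in> A \<Longrightarrow> f a \<in> carrier (tensor_power m n l)) \<Longrightarrow> sum f A \<in> carrier (tensor_power m n l)"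
  by (induction A rule: infinite_finite_induct) (simp_all add: tensor_power_closed)

lemma linop_tensor_closed:
  assumes "\<And>w. w \<in> words m n l \<Longrightarrow> app f (Poly_Mapping.single w 1) \<in> carrier (tensor_power m n l)"
    and "v \<in> carrier (tensor_power m n l)"
  shows "app f v \<in> carrier (tensor_power m n l)"
proof -
  have "w \<in> words m n l" if "w \<in> Poly_Mapping.keys v" for w
    using that assms(2) by (auto simp: tensor_power_carrier)
  then show ?thesis
    by (subst app_expand) (intro tensor_power_sum_closed tensor_power_closed(3) assms(1))
qed

section \<open>Matrix units at a tensor position\<close>

context
  fixes m n p l :: nat
begin

private abbreviation s :: "nat \<Rightarrow> nat" where "s \<equiv> par m p"
private abbreviation (input) wd :: "nat list \<Rightarrow> nat \<Rightarrow> nat" where "wd w k \<equiv> w ! (k - 1)"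

definition parity_before :: "nat list \<Rightarrow> nat \<Rightarrow> nat" where "parity_before w k = (\<Sum>j = 1..<k. s (w ! (j - 1)))"

lemma E_op_word:
  "app (E_op m p a b k) (Poly_Mapping.single w c)
    = (if wd w k = b then Poly_Mapping.single (w[k - 1 := a]) (c * (-1) ^ ((s a + s b) * parity_before w k)) else 0)"
  by (simp add: E_op_def app_lin lin_ext_single parity_before_def cscale_simps)

lemma words_update: "w \<in> words m n l \<Longrightarrow> a \<in> {1..m + n} \<Longrightarrow> w[i := a] \<in> words m n l"
  unfolding words_def using set_update_subset_insert[of w i a] by auto

lemma wd_update:
  assumes "w \<in> words m n l" "j \<in> {1..l}" "k \<in> {1..l}"
  shows "wd (w[k - 1 := a]) j = (if j = k then a else wd w j)"
  using assms by (auto simp: words_def nth_list_update)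

text \<open>Each side carries the parity of the letter missing from it, which avoids truncated
  subtraction.\<close>

lemma parity_before_update:
  assumes "w \<in> words m n l" "j \<in> {1..l}" "k \<in> {1..l}"
  shows "parity_before (w[k - 1 := a]) j + (if k < j then s (wd w k) else 0) = parity_before w j + (if k < j then s a else 0)"
proof (cases "k < j")
  case True
  have u: "s (wd (w[k - 1 := a]) i) = (if i = k then s a else s (wd w i))" if "i \<in> {1..<j}" for i
    using wd_update[OF assms(1), of i k] assms that by auto
  have k: "k \<in> {1..<j}" using True assms by auto
  have "parity_before (w[k - 1 := a]) j = s a + (\<Sum>i\<in>{1..<j} - {k}. s (wd w i))"
    unfolding parity_before_def by (subst sum.remove[OF _ k]) (use u[OF k] u in \<open>auto intro!: sum.cong\<close>)
  moreover have "parity_before w j = s (wd w k) + (\<Sum>i\<in>{1..<j} - {k}. s (wd w i))"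
    unfolding parity_before_def by (rule sum.remove) (use k in auto)
  ultimately show ?thesis using True by simp
next
  case False
  have "s (wd (w[k - 1 := a]) i) = s (wd w i)" if "i \<in> {1..<j}" for i
    using wd_update[OF assms(1), of i k] assms False that by auto
  then show ?thesis using False by (simp add: parity_before_def)
qed

lemma E_op_closed:
  assumes "a \<in> {1..m + n}" "v \<in> carrier (tensor_power m n l)"
  shows "app (E_op m p a b k) v \<in> carrier (tensor_power m n l)"
  using assms(2)
  by (rule linop_tensor_closed[rotated]) (use assms(1) in \<open>auto simp: E_op_word tensor_power_closed intro!: single_word words_update\<close>)

lemma E_op_same:
  assumes "k \<in> {1..l}" "v \<in> carrier (tensor_power m n l)"
  shows "app (E_op m p a b k) (app (E_op m p c d k) v) = (if b = c then app (E_op m p a d k) v else 0)"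
proof -
  have "app (E_op m p a b k * E_op m p c d k) v = app (if b = c then E_op m p a d k else 0) v"
  proof (rule linop_eq_on_words[OF _ assms(2)])
    fix w assume w: "w \<in> words m n l"
    have "parity_before (w[k - 1 := c]) k = parity_before w k" using parity_before_update[OF w assms(1) assms(1), of c] by simp
    moreover have "(-1 :: complex) ^ ((s c + s d) * q) * (-1) ^ ((s a + s c) * q) = (-1) ^ ((s a + s d) * q)" for q
      by (simp add: minus_one_power_iff even_mult_iff even_add) 
    ultimately show "app (E_op m p a b k * E_op m p c d k) (Poly_Mapping.single w 1)
        = app (if b = c then E_op m p a d k else 0) (Poly_Mapping.single w 1)"
      using wd_update[OF w assms(1) assms(1), of c] by (simp add: E_op_word)
  qed
  then show ?thesis by (simp split: if_splits)
qed

text \<open>The operator at the left position changes the parity that the one at the right position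
  sees, modulo 2 by the sum of the parities of its two indices. This produces exactly the Koszul
  sign.\<close>

lemma E_op_diff:
  assumes "j \<in> {1..l}" "k \<in> {1..l}" "j \<noteq> k" "v \<in> carrier (tensor_power m n l)"
  shows "app (E_op m p a b j) (app (E_op m p c d k) v)
    = cscale ((-1) ^ ((s a + s b) * (s c + s d))) (app (E_op m p c d k) (app (E_op m p a b j) v))"
proof -
  have "app (E_op m p a b j * E_op m p c d k) v = app (smul ((-1) ^ ((s a + s b) * (s c + s d))) (E_op m p c d k * E_op m p a b j)) v"
  proof (rule linop_eq_on_words[OF _ assms(4)])
    fix w assume w: "w \<in> words m n l"
    have 1: "parity_before (w[k - 1 := c]) j + (if k < j then s (wd w k) else 0) = parity_before w j + (if k < j then s c else 0)"
      and 2: "parity_before (w[j - 1 := a]) k + (if j < k then s (wd w j) else 0) = parity_before w k + (if j < k then s a else 0)"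
      using parity_before_update[OF w] assms by auto
    have "w[k - 1 := c, j - 1 := a] = w[j - 1 := a, k - 1 := c]"
      using assms by (intro list_update_swap) auto
    moreover have "(-1 :: complex) ^ ((s c + s d) * parity_before w k) * (-1) ^ ((s a + s b) * parity_before (w[k - 1 := c]) j)
        = (-1) ^ ((s a + s b) * (s c + s d)) * ((-1) ^ ((s a + s b) * parity_before w j) * (-1) ^ ((s c + s d) * parity_before (w[j - 1 := a]) k))"
      if "wd w j = b" "wd w k = d"
    proof (cases "j < k")
      case True
      then have "parity_before (w[k - 1 := c]) j = parity_before w j" "parity_before (w[j - 1 := a]) k + s b = parity_before w k + s a" using 1 2 that by auto
      then show ?thesis
        by (simp add: minus_one_power_iff even_mult_iff even_add) (metis even_add)
    next
      case False
      then have "parity_before (w[k - 1 := c]) j + s d = parity_before w j + s c" "parity_before (w[j - 1 := a]) k = parity_before w k" using 1 2 that assms(3) by auto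
      then show ?thesis
        by (simp add: minus_one_power_iff even_mult_iff even_add) (metis even_add)
    qed
    ultimately show "app (E_op m p a b j * E_op m p c d k) (Poly_Mapping.single w 1)
      = app (smul ((-1) ^ ((s a + s b) * (s c + s d))) (E_op m p c d k * E_op m p a b j)) (Poly_Mapping.single w 1)"
      using wd_update[OF w assms(1,2), of c] wd_update[OF w assms(2,1), of a] assms(3)
      by (auto simp: E_op_word cscale_simps mult.assoc)
  qed
  then show ?thesis by simp
qed

lemma E_tot_op: "E_tot m p l a b v = app (\<Sum>k = 1..l. E_op m p a b k) v"
  by (simp add: E_tot_def E_at_op app_sum_left)

text \<open>All positions other than \<open>k\<close> supercommute; the two delta terms come from
  position \<open>k\<close> alone.\<close>

lemma E_tot_E_op:
  assumes "k \<in> {1..l}" "v \<in> carrier (tensor_power m n l)"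
  shows "E_tot m p l a b (app (E_op m p c d k) v)
    = (if b = c then app (E_op m p a d k) v else 0)
      + cscale ((-1) ^ ((s a + s b) * (s c + s d)))
          (app (E_op m p c d k) (E_tot m p l a b v) - (if a = d then app (E_op m p c b k) v else 0))"
proof -
  let ?e = "cscale ((-1) ^ ((s a + s b) * (s c + s d)))"
  have split: "(\<Sum>j = 1..l. f j) = f k + (\<Sum>j\<in>{1..l} - {k}. f j)" for f :: "nat \<Rightarrow> tensor"
    by (rule sum.remove) (use assms(1) in auto)
  have "E_tot m p l a b (app (E_op m p c d k) v)
      = (if b = c then app (E_op m p a d k) v else 0)
        + (\<Sum>j\<in>{1..l} - {k}. ?e (app (E_op m p c d k) (app (E_op m p a b j) v)))"
    unfolding E_tot_op app_sum_left split using assms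
    by (intro arg_cong2[where f = "(+)"] sum.cong refl) (auto simp: E_op_same intro!: E_op_diff)
  moreover have "app (E_op m p c d k) (E_tot m p l a b v) = (if d = a then app (E_op m p c b k) v else 0)
      + (\<Sum>j\<in>{1..l} - {k}. app (E_op m p c d k) (app (E_op m p a b j) v))"
    unfolding E_tot_op app_sum_left app_sum split using assms by (simp add: E_op_same app_linear app_sum)
  ultimately show ?thesis by (auto simp: cscale_sum)
qed

section \<open>The signed permutation action and the graded flip\<close>

lemma permute_word_words:
  assumes "\<sigma> permutes {1..l}" "w \<in> words m n l"
  shows "permute_word l \<sigma> w \<in> words m n l"
proof -
  have "wd w (Hilbert_Choice.inv \<sigma> j) \<in> set w" if "j \<in> {1..l}" for j
    using permutes_in_image[OF permutes_inv[OF assms(1)], of j] that assms(2)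
    by (intro nth_mem) (auto simp: words_def)
  then have "set (permute_word l \<sigma> w) \<subseteq> set w" by (auto simp: permute_word_def)
  then show ?thesis using assms(2) by (auto simp: words_def permute_word_def)
qed

lemma perm_op_word:
  "app (perm_op m p l \<sigma>) (Poly_Mapping.single w c) = Poly_Mapping.single (permute_word l \<sigma> w) (c * (-1) ^ koszul_exp m p l \<sigma> w)"
  by (simp add: perm_op_def app_lin lin_ext_single cscale_simps)

lemma perm_op_closed:
  assumes "\<sigma> permutes {1..l}" "v \<in> carrier (tensor_power m n l)"
  shows "app (perm_op m p l \<sigma>) v \<in> carrier (tensor_power m n l)"
  using assms(2)
  by (rule linop_tensor_closed[rotated]) (simp add: perm_op_word single_word permute_word_words[OF assms(1)])

lemma perm_op_E_op:
  assumes s: "\<sigma> permutes {1..l}" and k: "k \<in> {1..l}" and v: "v \<in> carrier (tensor_power m n l)"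
  shows "app (E_op m p a b (\<sigma> k)) (app (perm_op m p l \<sigma>) v) = app (perm_op m p l \<sigma>) (app (E_op m p a b k) v)"
proof -
  let ?D = "{1..l}"
  note iv = permutes_inverses[OF s]
  have sD: "\<sigma> j \<in> ?D" if "j \<in> ?D" for j using permutes_in_image[OF s] that by blast
  have iD: "Hilbert_Choice.inv \<sigma> j \<in> ?D" if "j \<in> ?D" for j
    using permutes_in_image[OF permutes_inv[OF s]] that by blast
  have "app (E_op m p a b (\<sigma> k) * perm_op m p l \<sigma>) v = app (perm_op m p l \<sigma> * E_op m p a b k) v"
  proof (rule linop_eq_on_words[OF _ v])
    fix w assume w: "w \<in> words m n l"
    let ?w = "permute_word l \<sigma> w" and ?u = "w[k - 1 := a]"
    have wd: "wd ?w (\<sigma> j) = wd w j" if "j \<in> ?D" for j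
      using permute_word_nth[OF sD[OF that], of \<sigma> w] iv by simp
    have u: "wd ?u j = (if j = k then a else wd w j)" if "j \<in> ?D" for j by (rule wd_update[OF w that k])
    have words: "?w[\<sigma> k - 1 := a] = permute_word l \<sigma> ?u"
    proof (rule nth_equalityI)
      have len: "length ?w = l" "length (permute_word l \<sigma> ?u) = l" by (simp_all add: permute_word_def)
      then show "length (?w[\<sigma> k - 1 := a]) = length (permute_word l \<sigma> ?u)" by simp
      fix i assume "i < length (?w[\<sigma> k - 1 := a])"
      then have i: "i + 1 \<in> ?D" using len by auto
      have "permute_word l \<sigma> ?u ! i = wd ?u (Hilbert_Choice.inv \<sigma> (i + 1))"
        using permute_word_nth[OF i, of \<sigma> ?u] by simp
      also have "\<dots> = (if Hilbert_Choice.inv \<sigma> (i + 1) = k then a else wd w (Hilbert_Choice.inv \<sigma> (i + 1)))"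
        by (rule u[OF iD[OF i]])
      also have "\<dots> = (if i + 1 = \<sigma> k then a else ?w ! i)"
        using permute_word_nth[OF i, of \<sigma> w] iv by (metis add_diff_cancel_right')
      also have "\<dots> = ?w[\<sigma> k - 1 := a] ! i"
        using i sD[OF k] len by (auto simp: nth_list_update)
      finally show "?w[\<sigma> k - 1 := a] ! i = permute_word l \<sigma> ?u ! i" by simp
    qed
    define v where "v j = s (wd w j)" for j
    define I where "I i j = (if i < j then if \<sigma> j < \<sigma> i then 1 else 0 else (0 :: nat))" for i j
    have split: "(\<Sum>i\<in>?D. f i) = f k + (\<Sum>i\<in>?D - {k}. f i)" for f :: "nat \<Rightarrow> nat"
      by (rule sum.remove) (use k in auto)
    \<comment> \<open>Inversions are sorted by whether they involve position \<open>k\<close>.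
      \<open>R\<close> collects those that do not; the others contribute \<open>A\<close> times the
      parity of the letter at \<open>k\<close>, the only letter that the matrix unit
      changes.\<close>
    define R where "R = (\<Sum>i\<in>?D - {k}. \<Sum>j\<in>?D - {k}. I i j * (v i * v j))"
    define A where "A = (\<Sum>j\<in>?D - {k}. (I k j + I j k) * v j)"
    have K: "koszul_exp m p l \<sigma> x = s (wd x k) * A + R"
      if x: "\<And>j. j \<in> ?D - {k} \<Longrightarrow> s (wd x j) = v j" for x
    proof -
      have "koszul_exp m p l \<sigma> x = (\<Sum>i\<in>?D. \<Sum>j\<in>?D. I i j * (s (wd x i) * s (wd x j)))"
        unfolding koszul_exp_alt by (intro sum.cong refl) (auto simp: I_def)
      also have "\<dots> = (\<Sum>j\<in>?D - {k}. I k j * (s (wd x k) * v j)) + (\<Sum>i\<in>?D - {k}. I i k * (v i * s (wd x k))) + R"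
        unfolding split R_def using x by (simp add: sum.distrib I_def[of k k])
      finally show ?thesis
        by (simp add: A_def sum_distrib_left sum.distrib distrib_right distrib_left mult_ac)
    qed
    have Kw: "koszul_exp m p l \<sigma> w = s (wd w k) * A + R"
      by (rule K) (simp add: v_def)
    have Ku: "koszul_exp m p l \<sigma> ?u = s a * A + R"
      using K[of ?u] u u[OF k] by (simp add: v_def)
    have P: "parity_before w k = (\<Sum>j\<in>?D - {k}. if j < k then v j else 0)"
      unfolding parity_before_def v_def by (rule sum.mono_neutral_cong_left) (use k in auto)
    have "parity_before ?w (\<sigma> k) = (\<Sum>j\<in>?D. if j < \<sigma> k then s (wd ?w j) else 0)"
      unfolding parity_before_def by (rule sum.mono_neutral_cong_left) (use sD[OF k] in auto)
    also have "\<dots> = (\<Sum>j\<in>?D. if \<sigma> j < \<sigma> k then v j else 0)"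
      by (rule sum.reindex_bij_witness[of _ \<sigma> "Hilbert_Choice.inv \<sigma>"])
        (use iv iD sD wd permute_word_nth[of _ l \<sigma> w] in \<open>auto simp: v_def simp del: atLeastAtMost_iff\<close>)
    finally have P': "parity_before ?w (\<sigma> k) = (\<Sum>j\<in>?D - {k}. if \<sigma> j < \<sigma> k then v j else 0)"
      unfolding split by simp
    \<comment> \<open>\<open>A\<close> counts the odd letters whose order relative to position
      \<open>k\<close> is reversed by \<open>\<sigma>\<close>. These are the letters that stand
      before it either in the old or in the new word but not in both, whence the congruence modulo
      2.\<close>
    have "even (A + parity_before w k + parity_before ?w (\<sigma> k))"
      unfolding A_def P P' sum.distrib[symmetric]
    proof (rule dvd_sum)
      fix j assume "j \<in> ?D - {k}"
      then have "j \<noteq> k" "\<sigma> j \<noteq> \<sigma> k" using injD[OF permutes_inj[OF s]] by auto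
      then show "even ((I k j + I j k) * v j + (if j < k then v j else 0) + (if \<sigma> j < \<sigma> k then v j else 0))"
        by (auto simp: I_def)
    qed
    then have "(-1 :: complex) ^ koszul_exp m p l \<sigma> w * (-1) ^ ((s a + s b) * parity_before ?w (\<sigma> k))
        = (-1) ^ ((s a + s b) * parity_before w k) * (-1) ^ koszul_exp m p l \<sigma> ?u" if "wd w k = b"
      unfolding Kw Ku that by (auto simp: minus_one_power_iff even_mult_iff even_add)
    then show "app (E_op m p a b (\<sigma> k) * perm_op m p l \<sigma>) (Poly_Mapping.single w 1)
        = app (perm_op m p l \<sigma> * E_op m p a b k) (Poly_Mapping.single w 1)"
      using wd[OF k] words by (simp add: E_op_word perm_op_word)
  qed
  then show ?thesis by simp
qed

text \<open>The inversions are (j, k) together with (j, i) and (i, k) for every i strictly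
  between.\<close>

lemma koszul_transpose:
  assumes "j \<in> {1..l}" "k \<in> {1..l}" "j < k"
  shows "koszul_exp m p l (transpose j k) w
    = s (wd w j) * s (wd w k) + (s (wd w j) + s (wd w k)) * (\<Sum>i\<in>{j<..<k}. s (wd w i))"
proof -
  have inv: "{(a, b). a \<in> {1..l} \<and> b \<in> {1..l} \<and> a < b \<and> transpose j k b < transpose j k a}
      = insert (j, k) (Pair j ` {j<..<k} \<union> (\<lambda>i. (i, k)) ` {j<..<k})" (is "?L = ?R")
  proof (intro equalityI subsetI)
    fix x assume "x \<in> ?L"
    then show "x \<in> ?R" using assms by (auto simp: transpose_def split: if_splits)
  next
    fix x assume "x \<in> ?R"
    then show "x \<in> ?L" using assms by (auto simp: transpose_def)
  qed
  show ?thesis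
    unfolding koszul_exp_def inv using assms
    by (subst sum.insert; (subst sum.union_disjoint)?)
      (auto simp: sum.reindex inj_on_def sum_distrib_left sum_distrib_right distrib_right distrib_left sum.distrib mult_ac)
qed

lemma parity_before_split:
  assumes "1 \<le> j" "j < k"
  shows "parity_before w k = parity_before w j + (s (wd w j) + (\<Sum>i\<in>{j<..<k}. s (wd w i)))"
proof -
  have "{1..<k} = {1..<j} \<union> insert j {j<..<k}" using assms by auto
  then show ?thesis unfolding parity_before_def by (simp only:) (subst sum.union_disjoint; auto)
qed

text \<open>The components of the graded flip \<open>\<Sum>\<^sub>q (-1)\<^bsup>|q|\<^esup> E(i,q) \<otimes> E(q,i)\<close>.\<close>

lemma E_op_flip:
  assumes j: "j \<in> {1..l}" and k: "k \<in> {1..l}" and ne: "j \<noteq> k" and w: "w \<in> words m n l"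
  shows "cscale (psgn m p q) (app (E_op m p i q j) (app (E_op m p q i k) (Poly_Mapping.single w 1)))
    = (if wd w j = q \<and> wd w k = i then app (perm_op m p l (transpose j k)) (Poly_Mapping.single w 1) else 0)"
proof (cases "wd w j = q \<and> wd w k = i")
  case True
  then have q: "wd w j = q" and i: "wd w k = i" by auto
  have len: "length w = l" using w by (simp add: words_def)
  have words: "w[k - 1 := q, j - 1 := i] = permute_word l (transpose j k) w"
  proof (rule nth_equalityI)
    show "length (w[k - 1 := q, j - 1 := i]) = length (permute_word l (transpose j k) w)"
      by (simp add: len permute_word_def)
    fix u assume "u < length (w[k - 1 := q, j - 1 := i])"
    then have u: "u + 1 \<in> {1..l}" by (simp add: len)
    have "permute_word l (transpose j k) w ! u = wd w (transpose j k (u + 1))"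
      using permute_word_nth[OF u, of "transpose j k" w] by simp
    then show "w[k - 1 := q, j - 1 := i] ! u = permute_word l (transpose j k) w ! u"
      using u j k ne q i len by (auto simp: nth_list_update transpose_def)
  qed
  have up: "parity_before (w[k - 1 := q]) j + (if k < j then s i else 0) = parity_before w j + (if k < j then s q else 0)"
    using parity_before_update[OF w j k, of q] unfolding i .
  have sq: "s q = 0 \<or> s q = 1" "s i = 0 \<or> s i = 1" by (auto simp: par_def)
  have "(-1 :: complex) ^ s q * ((-1) ^ ((s q + s i) * parity_before w k) * (-1) ^ ((s i + s q) * parity_before (w[k - 1 := q]) j))
      = (-1) ^ koszul_exp m p l (transpose j k) w"
  proof (cases "j < k")
    case True
    then show ?thesis
      using up sq parity_before_split[of j k w] j unfolding koszul_transpose[OF j k True] q i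
      by (auto simp: minus_one_power_iff)
  next
    case False
    then have "k < j" using ne by simp
    then show ?thesis
      using up sq parity_before_split[of k j w] k unfolding transpose_commute[of j k] koszul_transpose[OF k j \<open>k < j\<close>] q i
      by (auto simp: minus_one_power_iff)
  qed
  then show ?thesis
    using True words wd_update[OF w j k, of q] ne by (simp add: E_op_word perm_op_word cscale_simps psgn_def)
next
  case False
  then show ?thesis
    using wd_update[OF w j k, of q] ne by (auto simp: E_op_word cscale_simps)
qed

lemma E_op_diag:
  "app (E_op m p i i k) (Poly_Mapping.single w 1) = (if wd w k = i then Poly_Mapping.single w 1 else 0)"
  by (auto simp: E_op_word)

end

section \<open>Operators on the tensor product\<close>

locale schur_weyl = daha_right_module l t c M act
  for l :: nat and t c :: complex and M :: "(complex, 'm) module" and act :: "'m \<Rightarrow> dgen free_alg set \<Rightarrow> 'm" +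
  fixes m n p :: nat
begin

abbreviation "N \<equiv> carrier (tensor_power m n l)"
abbreviation "Eop \<equiv> E_op m p"

definition tensor_rels :: "(('m \<times> tensor) \<Rightarrow>\<^sub>0 complex) set" where
  "tensor_rels = tensor_rel (perm_algebra l) M (\<lambda>x r. act x (perm_to_daha l t c r)) (tensor_power m n l) (perm_algebra_act m p l)"

text \<open>The pure tensor of \<open>x\<close> and \<open>v\<close>, realised by the projection as
  a vector of the free space.\<close>

abbreviation tau :: "'m \<Rightarrow> tensor \<Rightarrow> (('m \<times> tensor) \<Rightarrow>\<^sub>0 complex)" where
  "tau x v \<equiv> rep tensor_rels (x, v)"

lemma N_simps: "v \<oplus>\<^bsub>tensor_power m n l\<^esub> w = v + w" "k \<odot>\<^bsub>tensor_power m n l\<^esub> v = cscale k v"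
  by (simp_all add: tensor_power_def free_space_def)

lemma tau_add_left: "x \<in> carrier M \<Longrightarrow> y \<in> carrier M \<Longrightarrow> v \<in> N \<Longrightarrow> tau (x \<oplus>\<^bsub>M\<^esub> y) v = tau x v + tau y v"
  using proj_rel[OF tensor_rel.add_left[of x M y v "tensor_power m n l" "perm_algebra l" "\<lambda>x r. act x (perm_to_daha l t c r)"
      "perm_algebra_act m p l"], folded tensor_rels_def] by (simp add: app_diff diff_eq_eq add.commute)

lemma tau_add_right: "x \<in> carrier M \<Longrightarrow> v \<in> N \<Longrightarrow> w \<in> N \<Longrightarrow> tau x (v + w) = tau x v + tau x w"
  using proj_rel[OF tensor_rel.add_right[of x M v "tensor_power m n l" w "perm_algebra l" "\<lambda>x r. act x (perm_to_daha l t c r)"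
      "perm_algebra_act m p l"], folded tensor_rels_def] by (simp add: app_diff diff_eq_eq add.commute N_simps)

lemma single_cscale: "Poly_Mapping.single a k = cscale k (Poly_Mapping.single a 1)"
  by (simp add: cscale_simps)

lemma tau_smult_left: "x \<in> carrier M \<Longrightarrow> v \<in> N \<Longrightarrow> tau (k \<odot>\<^bsub>M\<^esub> x) v = cscale k (tau x v)"
  using proj_rel[OF tensor_rel.smult_left[of x M v "tensor_power m n l" k "perm_algebra l" "\<lambda>x r. act x (perm_to_daha l t c r)"
      "perm_algebra_act m p l"], folded tensor_rels_def]
  by (simp add: app_diff single_cscale[of _ k] app_linear)

lemma tau_smult_right: "x \<in> carrier M \<Longrightarrow> v \<in> N \<Longrightarrow> tau x (cscale k v) = cscale k (tau x v)"
  using proj_rel[OF tensor_rel.smult_right[of x M v "tensor_power m n l" k "perm_algebra l" "\<lambda>x r. act x (perm_to_daha l t c r)"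
      "perm_algebra_act m p l"], folded tensor_rels_def]
  by (simp add: app_diff single_cscale[of _ k] app_linear N_simps)

lemma tau_balanced:
  assumes "x \<in> carrier M" "v \<in> N" "\<sigma> permutes {1..l}"
  shows "tau (ract x (dperm \<sigma>)) v = tau x (app (perm_op m p l \<sigma>) v)"
proof -
  let ?r = "Poly_Mapping.single \<sigma> (1 :: complex)"
  have "?r \<in> perm_algebra l" using assms(3) by (simp add: perm_algebra_def)
  from proj_rel[OF tensor_rel.balanced[OF assms(1) this assms(2), of "\<lambda>x r. act x (perm_to_daha l t c r)"
      "perm_algebra_act m p l"], folded tensor_rels_def]
  show ?thesis
    by (simp add: app_diff perm_to_daha_def perm_algebra_act_def lin_ext_single cscale_simps ract_def perm_act_op)
qed

lemma tau_zero_right: "x \<in> carrier M \<Longrightarrow> tau x 0 = 0"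
  using tau_smult_right[of x 0 0] by (simp add: cscale_simps tensor_power_closed)

lemma tau_diff_right:
  assumes "x \<in> carrier M" "v \<in> N" "w \<in> N"
  shows "tau x (v - w) = tau x v - tau x w"
  using tau_add_right[of x "v - w" w] assms by (simp add: tensor_power_closed)

lemma tau_sum_right:
  assumes "x \<in> carrier M" "\<And>a. a \<in> A \<Longrightarrow> f a \<in> N"
  shows "tau x (sum f A) = (\<Sum>a\<in>A. tau x (f a))"
  using assms(2)
  by (induction A rule: infinite_finite_induct) (simp_all add: tau_zero_right tau_add_right tensor_power_sum_closed assms(1))

lemma tau_ract_lin:
  assumes "x \<in> carrier M" "v \<in> N" "f \<in> FA"
  shows "g \<in> FA \<Longrightarrow> tau (ract x (f + g)) v = tau (ract x f) v + tau (ract x g) v"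
    and "tau (ract x (cscale k f)) v = cscale k (tau (ract x f) v)"
  using assms by (simp_all add: ract_linear tau_add_left tau_smult_left)

lemma tau_ract_zero: "x \<in> carrier M \<Longrightarrow> v \<in> N \<Longrightarrow> tau (ract x 0) v = 0"
  using tau_ract_lin(2)[of x v 0 0] by (simp add: cscale_simps free_algebra_zero_closed)

lemma tau_ract_sum:
  assumes "x \<in> carrier M" "v \<in> N" "\<And>a. a \<in> A \<Longrightarrow> f a \<in> FA"
  shows "tau (ract x (sum f A)) v = (\<Sum>a\<in>A. tau (ract x (f a)) v)"
  using assms(3)
  by (induction A rule: infinite_finite_induct) (simp_all add: tau_ract_zero tau_ract_lin FA_closed assms(1,2))

text \<open>For fixed \<open>v\<close> the tensor is additive and homogeneous in its first argument,
  so identities between right multiplications pass to tensors.\<close>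

lemma tau_ract_cong:
  assumes "right_op f = right_op g" "x \<in> carrier M" "v \<in> N"
  shows "tau (ract x f) v = tau (ract x g) v"
  by (rule rep_eqD[where \<phi> = "\<lambda>x. tau x v", OF right_op_eqD[OF assms(1,2)]])
    (use assms(3) in \<open>auto simp: tau_add_left tau_smult_left\<close>)

lemmas Eop_closed = E_op_closed[of _ m n _ l]

text \<open>The condition on the coefficients under which sum_k f_k \<otimes> E^(k) respects the
  balanced relations. Constant 1 gives the matrix units and \<open>frak_y\<close> gives the
  operators J.\<close>

definition equivariant :: "(nat \<Rightarrow> dgen free_alg) \<Rightarrow> bool" where
  "equivariant f \<longleftrightarrow> (\<forall>k\<in>{1..l}. f k \<in> FA)
    \<and> (\<forall>\<sigma> k. \<sigma> permutes {1..l} \<longrightarrow> k \<in> {1..l} \<longrightarrow> right_op (dperm \<sigma> * f k) = right_op (f (\<sigma> k) * dperm \<sigma>))"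

definition weighted_E_gen :: "(nat \<Rightarrow> dgen free_alg) \<Rightarrow> nat \<Rightarrow> nat \<Rightarrow> ('m \<times> tensor) \<Rightarrow> (('m \<times> tensor) \<Rightarrow>\<^sub>0 complex)" where
  "weighted_E_gen f a b = (\<lambda>(x, v). if x \<in> carrier M \<and> v \<in> N
     then \<Sum>k = 1..l. Poly_Mapping.single (ract x (f k), app (Eop a b k) v) 1 else 0)"

definition weighted_E :: "(nat \<Rightarrow> dgen free_alg) \<Rightarrow> nat \<Rightarrow> nat \<Rightarrow> ('m \<times> tensor) linop" where
  "weighted_E f a b = desc tensor_rels (lin (weighted_E_gen f a b))"

lemma weighted_E_single:
  "app (weighted_E f a b) (Poly_Mapping.single (x, v) 1) = (if x \<in> carrier M \<and> v \<in> N
     then \<Sum>k = 1..l. tau (ract x (f k)) (app (Eop a b k) v) else 0)"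
  by (simp add: weighted_E_def desc_def weighted_E_gen_def app_sum)

text \<open>Moving \<open>\<sigma>\<close> across the tensor sign turns the k-th summand into the
  one with index \<open>\<sigma> k\<close>; the sum is then reindexed by
  \<open>\<sigma>\<close>.\<close>

lemma tau_equivariant:
  assumes f: "equivariant f" and x: "x \<in> carrier M" and v: "v \<in> N" and a: "a \<in> {1..m + n}"
    and s: "\<sigma> permutes {1..l}"
  shows "(\<Sum>k = 1..l. tau (ract (ract x (dperm \<sigma>)) (f k)) (app (Eop a b k) v))
    = (\<Sum>k = 1..l. tau (ract x (f k)) (app (Eop a b k) (app (perm_op m p l \<sigma>) v)))"
proof -
  have "tau (ract (ract x (dperm \<sigma>)) (f k)) (app (Eop a b k) v)
      = tau (ract x (f (\<sigma> k))) (app (Eop a b (\<sigma> k)) (app (perm_op m p l \<sigma>) v))" if k: "k \<in> {1..l}" for k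
  proof -
    have fk: "f k \<in> FA" "f (\<sigma> k) \<in> FA" "right_op (dperm \<sigma> * f k) = right_op (f (\<sigma> k) * dperm \<sigma>)"
      using f k s permutes_range[OF s k] by (auto simp: equivariant_def)
    have v': "app (Eop a b k) v \<in> N" using a v by (rule E_op_closed)
    have "tau (ract (ract x (dperm \<sigma>)) (f k)) (app (Eop a b k) v) = tau (ract x (dperm \<sigma> * f k)) (app (Eop a b k) v)"
      using x s fk by (simp add: ract_linear)
    also have "\<dots> = tau (ract x (f (\<sigma> k) * dperm \<sigma>)) (app (Eop a b k) v)"
      using fk(3) x v' by (rule tau_ract_cong)
    also have "\<dots> = tau (ract x (f (\<sigma> k))) (app (perm_op m p l \<sigma>) (app (Eop a b k) v))"
      using x s fk v' by (simp add: ract_linear tau_balanced)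
    finally show ?thesis by (simp add: perm_op_E_op[OF s k v])
  qed
  then have "(\<Sum>k = 1..l. tau (ract (ract x (dperm \<sigma>)) (f k)) (app (Eop a b k) v))
      = (\<Sum>k = 1..l. tau (ract x (f (\<sigma> k))) (app (Eop a b (\<sigma> k)) (app (perm_op m p l \<sigma>) v)))"
    by (intro sum.cong) auto
  also have "\<dots> = (\<Sum>k = 1..l. tau (ract x (f k)) (app (Eop a b k) (app (perm_op m p l \<sigma>) v)))"
    using sum.permute[OF s, of "\<lambda>k. tau (ract x (f k)) (app (Eop a b k) (app (perm_op m p l \<sigma>) v))"] by (simp add: o_def)
  finally show ?thesis .
qed

lemma weighted_E_rel:
  assumes f: "equivariant f" and a: "a \<in> {1..m + n}" and u: "u \<in> tensor_rels"
  shows "app (weighted_E f a b) u = 0"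
proof -
  have fk: "f k \<in> FA" if "k \<in> {1..l}" for k using f that by (auto simp: equivariant_def)
  note cl = fk a Eop_closed tensor_power_closed
  from u[unfolded tensor_rels_def] show ?thesis
  proof cases
    case (add_left x y v)
    then show ?thesis using cl
      by (auto simp: app_diff weighted_E_single ract_linear tau_add_left simp flip: sum_subtractf intro!: sum.neutral)
  next
    case (add_right x v w)
    then show ?thesis using cl
      by (auto simp: app_diff weighted_E_single N_simps app_linear tau_add_right simp flip: sum_subtractf intro!: sum.neutral)
  next
    case (smult_left x v k)
    then show ?thesis using cl
      by (auto simp: app_diff single_cscale[of _ k] app_linear weighted_E_single ract_linear tau_smult_left cscale_sum simp flip: sum_subtractf intro!: sum.neutral)
  next
    case (smult_right x v k)
    then show ?thesis using cl
      by (auto simp: app_diff single_cscale[of _ k] app_linear weighted_E_single N_simps tau_smult_right cscale_sum simp flip: sum_subtractf intro!: sum.neutral)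
  next
    \<comment> \<open>\<open>r\<close> is a combination of permutations and both actions are linear
      in it, so \<open>tau_equivariant\<close> is applied to one permutation at a time.\<close>
    case (balanced x r v)
    have x: "x \<in> carrier M" and v: "v \<in> N" by fact+
    let ?S = "Poly_Mapping.keys r" and ?r = "Poly_Mapping.lookup r"
    have S: "\<sigma> permutes {1..l}" if "\<sigma> \<in> ?S" for \<sigma>
      using balanced(3) that by (auto simp: perm_algebra_def)
    have R: "lin_ext dperm r = (\<Sum>\<sigma>\<in>?S. cscale (?r \<sigma>) (dperm \<sigma>))" by (simp add: lin_ext_def)
    have RFA: "lin_ext dperm r \<in> FA" unfolding R by (intro FA_closed FA_perm S)
    have 1: "tau (ract (ract x (lin_ext dperm r)) (f k)) u
        = (\<Sum>\<sigma>\<in>?S. cscale (?r \<sigma>) (tau (ract (ract x (dperm \<sigma>)) (f k)) u))" if "k \<in> {1..l}" "u \<in> N" for k u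
    proof -
      have "tau (ract (ract x (lin_ext dperm r)) (f k)) u = tau (ract x (lin_ext dperm r * f k)) u"
        using x RFA fk[OF that(1)] by (simp add: ract_linear)
      also have "lin_ext dperm r * f k = (\<Sum>\<sigma>\<in>?S. cscale (?r \<sigma>) (dperm \<sigma> * f k))"
        by (simp add: R sum_distrib_right cscale_conv_mult mult.assoc)
      also have "tau (ract x (\<Sum>\<sigma>\<in>?S. cscale (?r \<sigma>) (dperm \<sigma> * f k))) u
          = (\<Sum>\<sigma>\<in>?S. cscale (?r \<sigma>) (tau (ract x (dperm \<sigma> * f k)) u))"
        using x that fk[OF that(1)] S by (simp add: tau_ract_sum FA_closed tau_ract_lin)
      finally show ?thesis using x fk[OF that(1)] S by (simp add: ract_linear)
    qed
    have A: "perm_algebra_act m p l r v = (\<Sum>\<sigma>\<in>?S. cscale (?r \<sigma>) (app (perm_op m p l \<sigma>) v))"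
      by (simp add: perm_algebra_act_def lin_ext_def perm_act_op)
    have AN: "perm_algebra_act m p l r v \<in> N"
      unfolding A by (intro tensor_power_sum_closed tensor_power_closed(3) perm_op_closed S v)
    have "app (weighted_E f a b) (Poly_Mapping.single (ract x (lin_ext dperm r), v) 1)
        = (\<Sum>\<sigma>\<in>?S. cscale (?r \<sigma>) (\<Sum>k = 1..l. tau (ract (ract x (dperm \<sigma>)) (f k)) (app (Eop a b k) v)))"
      using x v RFA a by (simp add: weighted_E_single 1 Eop_closed cscale_sum sum.swap[of _ _ ?S])
    also have "\<dots> = (\<Sum>\<sigma>\<in>?S. cscale (?r \<sigma>) (\<Sum>k = 1..l. tau (ract x (f k)) (app (Eop a b k) (app (perm_op m p l \<sigma>) v))))"
      using tau_equivariant[OF f x v a S] by simp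
    also have "\<dots> = (\<Sum>k = 1..l. tau (ract x (f k)) (app (Eop a b k) (perm_algebra_act m p l r v)))"
      unfolding A app_sum app_linear cscale_sum
      using x v a S fk
      by (subst sum.swap) (simp add: tau_sum_right tau_smult_right Eop_closed perm_op_closed tensor_power_closed)
    also have "\<dots> = app (weighted_E f a b) (Poly_Mapping.single (x, perm_algebra_act m p l r v) 1)"
      using x AN by (simp add: weighted_E_single)
    finally show ?thesis
      using balanced(1) by (simp add: app_diff ract_def perm_to_daha_def)
  qed
qed

text \<open>These operators factor through the quotient by the tensor relations and vanish on junk basis
  vectors, so that an identity between them can be tested on the \<open>tau x v\<close>.\<close>

definition good :: "('m \<times> tensor) linop set" where
  "good = {A. A * proj (cvec.span tensor_rels) = A \<and> (\<forall>q. q \<notin> carrier M \<times> N \<longrightarrow> app A (Poly_Mapping.single q 1) = 0)}"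

lemma good_weighted_E: "equivariant f \<Longrightarrow> a \<in> {1..m + n} \<Longrightarrow> weighted_E f a b \<in> good"
  unfolding good_def
proof (intro CollectI conjI allI impI)
  assume *: "equivariant f" "a \<in> {1..m + n}"
  show "weighted_E f a b * proj (cvec.span tensor_rels) = weighted_E f a b"
    by (rule linop_eqI) (simp add: weighted_E_def, rule desc_proj, simp add: weighted_E_rel[OF *] flip: weighted_E_def)
  fix q assume "q \<notin> carrier M \<times> N"
  then show "app (weighted_E f a b) (Poly_Mapping.single q 1) = 0"
    by (cases q) (auto simp: weighted_E_single)
qed

lemma good_closed:
  "A \<in> good \<Longrightarrow> B \<in> good \<Longrightarrow> A + B \<in> good" "A \<in> good \<Longrightarrow> B \<in> good \<Longrightarrow> A - B \<in> good"
  "B \<in> good \<Longrightarrow> C * B \<in> good" "A \<in> good \<Longrightarrow> smul k A \<in> good" "0 \<in> good"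
  by (auto simp: good_def distrib_right left_diff_distrib mult.assoc smul_simps cscale_simps)

lemma good_sum: "(\<And>a. a \<in> S \<Longrightarrow> f a \<in> good) \<Longrightarrow> sum f S \<in> good"
  by (induction S rule: infinite_finite_induct) (simp_all add: good_closed)

lemma good_tau: "A \<in> good \<Longrightarrow> app A (tau x v) = app A (Poly_Mapping.single (x, v) 1)"
  unfolding good_def by (metis (mono_tags, lifting) app_simps(6) mem_Collect_eq)

lemma good_eqI:
  assumes "A \<in> good" "B \<in> good"
    and "\<And>x v. x \<in> carrier M \<Longrightarrow> v \<in> N \<Longrightarrow> app A (tau x v) = app B (tau x v)"
  shows "A = B"
proof (rule linop_eq_on_single)
  fix q :: "'m \<times> tensor"
  show "app A (Poly_Mapping.single q 1) = app B (Poly_Mapping.single q 1)"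
  proof (cases "q \<in> carrier M \<times> N")
    case True
    then show ?thesis
      using assms good_tau[of A "fst q" "snd q"] good_tau[of B "fst q" "snd q"] by auto
  next
    case False
    then show ?thesis using assms(1,2) by (cases q) (auto simp: good_def)
  qed
qed

lemma tau_expand:
  assumes "x \<in> carrier M" "v \<in> N"
  shows "tau x v = (\<Sum>w\<in>Poly_Mapping.keys v. cscale (Poly_Mapping.lookup v w) (tau x (Poly_Mapping.single w 1)))"
proof -
  have w: "Poly_Mapping.single w 1 \<in> N" if "w \<in> Poly_Mapping.keys v" for w
    using that assms(2) by (auto simp: tensor_power_carrier)
  have "tau x v = tau x (\<Sum>w\<in>Poly_Mapping.keys v. cscale (Poly_Mapping.lookup v w) (Poly_Mapping.single w 1))"
    by (simp add: cscale_simps sum_single_keys)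
  then show ?thesis
    using assms w by (simp add: tau_sum_right tau_smult_right tensor_power_closed del: cscale_simps(8))
qed

lemma good_eq_on_wordsI:
  assumes "A \<in> good" "B \<in> good"
    and "\<And>x w. x \<in> carrier M \<Longrightarrow> w \<in> words m n l \<Longrightarrow>
      app A (tau x (Poly_Mapping.single w 1)) = app B (tau x (Poly_Mapping.single w 1))"
  shows "A = B"
proof (rule good_eqI[OF assms(1,2)])
  fix x v assume "x \<in> carrier M" "v \<in> N"
  then show "app A (tau x v) = app B (tau x v)"
    using assms(3)
    by (subst (1 2) tau_expand) (auto simp: app_sum app_linear tensor_power_carrier intro!: sum.cong)
qed

text \<open>Zero for a first index out of range, so that membership in \<open>good\<close> holds
  without side conditions.\<close>

definition E_act :: "nat \<Rightarrow> nat \<Rightarrow> ('m \<times> tensor) linop" where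
  "E_act a b = (if a \<in> {1..m + n} then weighted_E (\<lambda>_. 1) a b else 0)"

definition J_act :: "nat \<Rightarrow> nat \<Rightarrow> ('m \<times> tensor) linop" where
  "J_act a b = (if a \<in> {1..m + n} then weighted_E (frak_y l t c) a b else 0)"

lemma equivariant_one: "equivariant (\<lambda>_. 1)"
  by (simp add: equivariant_def)

lemma equivariant_y: "equivariant (frak_y l t c)"
  by (simp add: equivariant_def right_op_perm_frak_y del: atLeastAtMost_iff)

lemma E_act_good: "E_act a b \<in> good" and J_act_good: "J_act a b \<in> good"
  by (auto simp: E_act_def J_act_def good_weighted_E equivariant_one equivariant_y good_closed)

lemma weighted_E_tau:
  assumes "equivariant f" "a \<in> {1..m + n}" "x \<in> carrier M" "v \<in> N"
  shows "app (weighted_E f a b) (tau x v) = (\<Sum>k = 1..l. tau (ract x (f k)) (app (Eop a b k) v))"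
  using assms by (simp add: good_tau[OF good_weighted_E] weighted_E_single)

lemma E_tot_closed: "a \<in> {1..m + n} \<Longrightarrow> v \<in> N \<Longrightarrow> E_tot m p l a b v \<in> N"
  unfolding E_tot_op app_sum_left by (intro tensor_power_sum_closed Eop_closed)

lemma E_act_tau:
  assumes "a \<in> {1..m + n}" "x \<in> carrier M" "v \<in> N"
  shows "app (E_act a b) (tau x v) = tau x (E_tot m p l a b v)"
  using assms weighted_E_tau[OF equivariant_one assms]
  by (simp add: E_act_def ract_one E_tot_op app_sum_left tau_sum_right Eop_closed)

lemma J_act_tau:
  assumes "a \<in> {1..m + n}" "x \<in> carrier M" "v \<in> N"
  shows "app (J_act a b) (tau x v) = (\<Sum>k = 1..l. tau (ract x (frak_y l t c k)) (app (Eop a b k) v))"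
  using assms weighted_E_tau[OF equivariant_y assms] by (simp add: J_act_def)

lemma sign_smul: "(-1) ^ k * A = smul ((-1) ^ k) A"
  by (simp add: smul_sign)

text \<open>\<open>E_act\<close> leaves the module element alone, so the relation holds summand by
  summand, by \<open>E_tot_E_op\<close> at each position.\<close>

lemma E_act_weighted_E:
  assumes f: "equivariant f" and "a \<in> {1..m + n}" "b \<in> {1..m + n}" "c' \<in> {1..m + n}" "d \<in> {1..m + n}"
  shows "E_act a b * weighted_E f c' d = (if b = c' then weighted_E f a d else 0)
    + (-1) ^ ((par m p a + par m p b) * (par m p c' + par m p d)) * (weighted_E f c' d * E_act a b - (if a = d then weighted_E f c' b else 0))"
    (is "?L = ?R")
proof (rule good_eqI)
  show "?L \<in> good" "?R \<in> good"
    unfolding sign_smul using assms by (auto intro!: good_closed good_weighted_E E_act_good)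
  fix x v assume x: "x \<in> carrier M" and v: "v \<in> N"
  let ?e = "cscale ((-1) ^ ((par m p a + par m p b) * (par m p c' + par m p d)))"
  have fk: "ract x (f k) \<in> carrier M" if "k \<in> {1..l}" for k
    using f x that by (auto simp: equivariant_def)
  have "app ?L (tau x v) = (\<Sum>k = 1..l. tau (ract x (f k)) (E_tot m p l a b (app (Eop c' d k) v)))"
    using assms x v fk by (simp add: weighted_E_tau app_sum E_act_tau Eop_closed)
  also have "\<dots> = (\<Sum>k = 1..l. (if b = c' then tau (ract x (f k)) (app (Eop a d k) v) else 0)
      + ?e (tau (ract x (f k)) (app (Eop c' d k) (E_tot m p l a b v))
          - (if a = d then tau (ract x (f k)) (app (Eop c' b k) v) else 0)))"
  proof (intro sum.cong refl)
    fix k assume k: "k \<in> {1..l}"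
    have cl: "app (Eop c' d k) (E_tot m p l a b v) \<in> N" "app (Eop c' b k) v \<in> N" "app (Eop a d k) v \<in> N"
      by (intro Eop_closed E_tot_closed assms v)+
    show "tau (ract x (f k)) (E_tot m p l a b (app (Eop c' d k) v))
        = (if b = c' then tau (ract x (f k)) (app (Eop a d k) v) else 0)
      + ?e (tau (ract x (f k)) (app (Eop c' d k) (E_tot m p l a b v))
          - (if a = d then tau (ract x (f k)) (app (Eop c' b k) v) else 0))"
      unfolding E_tot_E_op[OF k v] using fk[OF k] cl
      by (auto simp: tau_add_right tau_diff_right tau_smult_right tau_zero_right tensor_power_closed)
  qed
  also have "\<dots> = app ?R (tau x v)"
    unfolding sign_smul using assms x v
    by (auto simp: E_act_tau weighted_E_tau E_tot_closed sum.distrib sum_subtractf cscale_sum cscale_diff)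
  finally show "app ?L (tau x v) = app ?R (tau x v)" .
qed

sublocale gl: gl_pair "m + n" "par m p" E_act J_act
proof
  show "par m p i = 0 \<or> par m p i = 1" for i by (simp add: par_def)
  show E_act: "E_act a b * E_act c' d = (if b = c' then E_act a d else 0)
      + (-1) ^ ((par m p a + par m p b) * (par m p c' + par m p d)) * (E_act c' d * E_act a b - (if a = d then E_act c' b else 0))"
    "E_act a b * J_act c' d = (if b = c' then J_act a d else 0)
      + (-1) ^ ((par m p a + par m p b) * (par m p c' + par m p d)) * (J_act c' d * E_act a b - (if a = d then J_act c' b else 0))"
    if *: "a \<in> {1..m + n}" "b \<in> {1..m + n}" "c' \<in> {1..m + n}" "d \<in> {1..m + n}" for a b c' d
    using E_act_weighted_E[OF equivariant_one *] E_act_weighted_E[OF equivariant_y *] *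
    by (simp_all add: E_act_def J_act_def del: atLeastAtMost_iff split del: if_split cong: if_cong)
  fix a b assume ab: "a \<in> {1..m + n}" "b \<in> {1..m + n}"
  assume "par m p a \<noteq> par m p b"
  then have "a \<noteq> b" "odd ((par m p a + par m p b) * (par m p a + par m p b))"
    by (auto simp: par_def split: if_splits)
  \<comment> \<open>The commutation relation only says that the square is its own negative; the
    scalar 1/2 removes the factor 2.\<close>
  then have "E_act a b * E_act a b = - (E_act a b * E_act a b)"
    using E_act(1)[OF ab ab] by simp
  then have "E_act a b * E_act a b + E_act a b * E_act a b = 0" by (simp add: eq_neg_iff_add_eq_0)
  then have "smul 2 (E_act a b * E_act a b) = 0" using smul_add_left[of 1 1 "E_act a b * E_act a b"] by (simp add: smul_simps)
  then have "smul (1 / 2) (smul 2 (E_act a b * E_act a b)) = 0" by (simp add: smul_simps)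
  then show "E_act a b * E_act a b = 0" by (simp add: smul_simps)
qed

end

section \<open>The relations of the Yangian\<close>

context schur_weyl
begin

section \<open>Commuting diagonal operators\<close>

lemma sg_of_int_app: "app (gl.sg k * of_int z * A) u = cscale (psgn m p k * of_int z) (app A u)"
proof -
  have "gl.sg k * of_int z * A = smul ((-1) ^ par m p k) (smul (of_int z) A)"
    by (simp add: gl.sg_def smul_sign smul_of_int mult.assoc)
  then show ?thesis by (simp add: cscale_simps psgn_def)
qed

text \<open>The operators \<open>J(h\<^sub>i) - \<lambda>\<vartheta>\<^sub>i\<close> are combinations of these and of the \<open>H\<^sub>i\<^sub>,\<^sub>0\<close>.\<close>

definition diag_op :: "nat \<Rightarrow> ('m \<times> tensor) linop" where
  "diag_op i = J_act i i - smul (c / 2) (gl.outer i {i} i i)"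

definition pos :: "nat list \<Rightarrow> nat \<Rightarrow> nat set" where "pos w i = {b \<in> {1..l}. w ! (b - 1) = i}"
definition pos_lt :: "nat list \<Rightarrow> nat \<Rightarrow> nat set" where "pos_lt w i = {b \<in> {1..l}. w ! (b - 1) < i}"
definition pos_gt :: "nat list \<Rightarrow> nat \<Rightarrow> nat set" where "pos_gt w i = {b \<in> {1..l}. i < w ! (b - 1)}"

lemmas pos_defs = pos_def pos_lt_def pos_gt_def

abbreviation "word_sum w i \<equiv> level_sum (pos w i) (pos_lt w i) (pos_gt w i)"

lemma word_sum_closed: "word_sum w i \<in> FA"
  by (rule level_sum_closed) (auto simp: pos_defs)

text \<open>Both total actions are expanded over positions. Equal positions give a diagonal matrix
  unit and hence the scalar term; different positions give a component of the graded flip, which is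
  moved to the module side as a transposition.\<close>

lemma E_tot_flip:
  assumes x: "x \<in> carrier M" and w: "w \<in> words m n l" and i: "i \<in> {1..m + n}" and q: "q \<in> {1..m + n}"
  shows "cscale (psgn m p q) (tau x (E_tot m p l i q (E_tot m p l q i (Poly_Mapping.single w 1))))
    = (\<Sum>k\<in>pos w i. (\<Sum>j\<in>{1..l} - {k}. if w ! (j - 1) = q then tau (ract x (dperm (transpose j k))) (Poly_Mapping.single w 1) else 0)
        + cscale (psgn m p q) (tau x (Poly_Mapping.single w 1)))"
proof -
  let ?w = "Poly_Mapping.single w (1 :: complex)"
  have wN: "?w \<in> N" by (rule single_word[OF w])
  have cl: "app (Eop q i k) ?w \<in> N" "app (Eop i q j) (app (Eop q i k) ?w) \<in> N" for j k
    by (intro Eop_closed i q wN)+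
  have tr: "transpose j k permutes {1..l}" if "j \<in> {1..l}" "k \<in> {1..l}" for j k
    by (rule permutes_swap_id[OF that])
  have entry: "cscale (psgn m p q) (tau x (app (Eop i q j) (app (Eop q i k) ?w)))
      = (if j = k then if w ! (k - 1) = i then cscale (psgn m p q) (tau x ?w) else 0
         else if w ! (k - 1) = i then if w ! (j - 1) = q then tau (ract x (dperm (transpose j k))) ?w else 0 else 0)"
    if jk: "j \<in> {1..l}" "k \<in> {1..l}" for j k
  proof (cases "j = k")
    case True
    then show ?thesis
      using E_op_same[OF jk(2) wN, of p i q q i] x by (simp add: E_op_diag tau_zero_right cscale_simps)
  next
    case False
    have "cscale (psgn m p q) (tau x (app (Eop i q j) (app (Eop q i k) ?w)))
        = tau x (cscale (psgn m p q) (app (Eop i q j) (app (Eop q i k) ?w)))"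
      by (rule tau_smult_right[symmetric]) (rule x cl)+
    also have "\<dots> = (if w ! (k - 1) = i then if w ! (j - 1) = q then tau x (app (perm_op m p l (transpose j k)) ?w) else 0 else 0)"
      unfolding E_op_flip[OF jk False w] using x by (simp add: tau_zero_right)
    finally show ?thesis using False by (simp add: tau_balanced[OF x wN tr[OF jk]])
  qed
  have "cscale (psgn m p q) (tau x (E_tot m p l i q (E_tot m p l q i ?w)))
      = (\<Sum>k = 1..l. \<Sum>j = 1..l. cscale (psgn m p q) (tau x (app (Eop i q j) (app (Eop q i k) ?w))))"
    unfolding E_tot_op app_sum_left app_sum using x cl
    by (simp add: tau_sum_right tensor_power_sum_closed cscale_sum)
  also have "\<dots> = (\<Sum>k\<in>pos w i. \<Sum>j = 1..l. if j = k then cscale (psgn m p q) (tau x ?w)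
      else if w ! (j - 1) = q then tau (ract x (dperm (transpose j k))) ?w else 0)"
  proof (rule sum.mono_neutral_cong_right)
    show "\<forall>k\<in>{1..l} - pos w i. (\<Sum>j = 1..l. cscale (psgn m p q) (tau x (app (Eop i q j) (app (Eop q i k) ?w)))) = 0"
      by (intro ballI sum.neutral) (simp add: entry pos_def)
  qed (auto simp: pos_def entry intro!: sum.cong)
  also have "\<dots> = (\<Sum>k\<in>pos w i. (\<Sum>j\<in>{1..l} - {k}. if w ! (j - 1) = q then tau (ract x (dperm (transpose j k))) ?w else 0)
        + cscale (psgn m p q) (tau x ?w))"
  proof (rule sum.cong[OF refl])
    fix k assume "k \<in> pos w i"
    then have k: "k \<in> {1..l}" by (simp add: pos_def)
    show "(\<Sum>j = 1..l. if j = k then cscale (psgn m p q) (tau x ?w)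
      else if w ! (j - 1) = q then tau (ract x (dperm (transpose j k))) ?w else 0)
      = (\<Sum>j\<in>{1..l} - {k}. if w ! (j - 1) = q then tau (ract x (dperm (transpose j k))) ?w else 0)
        + cscale (psgn m p q) (tau x ?w)"
      by (subst sum.remove[OF _ k]) (auto simp: add.commute intro!: sum.cong)
  qed
  finally show ?thesis .
qed

text \<open>Moving the flips across the tensor product turns the quadratic part of \<open>diag_op\<close> into
  transpositions in the Hecke algebra, with signs that depend on the relative order of the entries
  of the word.\<close>

lemma diag_op_word:
  assumes x: "x \<in> carrier M" and w: "w \<in> words m n l" and i: "i \<in> {1..m + n}"
  shows "app (diag_op i) (tau x (Poly_Mapping.single w 1)) = tau (ract x (word_sum w i)) (Poly_Mapping.single w 1)
    - cscale (c / 2 * of_nat (card (pos w i)) * (\<Sum>q\<in>{1..m + n} - {i}. of_int (sgn (int q - int i)) * psgn m p q))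
        (tau x (Poly_Mapping.single w 1))"
proof -
  let ?w = "Poly_Mapping.single w (1 :: complex)" and ?Q = "{1..m + n} - {i}"
  let ?sg = "\<lambda>q. of_int (sgn (int q - int i)) :: complex"
  have wN: "?w \<in> N" by (rule single_word[OF w])
  have fin: "finite (pos w i)" by (simp add: pos_def)
  define F where "F j k = tau (ract x (dperm (transpose j k))) ?w" for j k
  have word: "w ! (j - 1) \<in> {1..m + n}" if "j \<in> {1..l}" for j
  proof -
    have "w ! (j - 1) \<in> set w" using w that by (intro nth_mem) (auto simp: words_def)
    then show ?thesis using w unfolding words_def by blast
  qed
  \<comment> \<open>At most one q matches the letter at \<open>j\<close>. If that letter is
    \<open>i\<close>, no q matches and the right-hand side vanishes as well, since the sign of 0 is
    0.\<close>
  have pick: "(\<Sum>q\<in>?Q. cscale (?sg q) (if w ! (j - 1) = q then F j k else 0)) = cscale (?sg (w ! (j - 1))) (F j k)"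
    if "j \<in> {1..l}" for j k
  proof (cases "w ! (j - 1) = i")
    case True
    then show ?thesis by (auto simp: cscale_simps intro!: sum.neutral)
  next
    case False
    then show ?thesis using word[OF that] by (subst sum.remove[of _ "w ! (j - 1)"]) (auto simp: cscale_simps intro!: sum.neutral)
  qed
  \<comment> \<open>Positions with the letter \<open>i\<close> itself, in particular
    \<open>k\<close>, do not contribute: their sign is 0.\<close>
  have sgn_split: "(\<Sum>j\<in>{1..l} - {k}. cscale (?sg (w ! (j - 1))) (F j k)) = (\<Sum>j\<in>pos_gt w i. F j k) - (\<Sum>j\<in>pos_lt w i. F j k)"
    if "k \<in> pos w i" for k
  proof -
    have "(\<Sum>j\<in>pos_gt w i. F j k) = (\<Sum>j\<in>{1..l} - {k}. if i < w ! (j - 1) then F j k else 0)"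
      "(\<Sum>j\<in>pos_lt w i. F j k) = (\<Sum>j\<in>{1..l} - {k}. if w ! (j - 1) < i then F j k else 0)"
      by (rule sum.mono_neutral_cong_left; use that in \<open>auto simp: pos_defs\<close>)+
    moreover have "cscale (?sg (w ! (j - 1))) (F j k)
        = (if i < w ! (j - 1) then F j k else 0) - (if w ! (j - 1) < i then F j k else 0)" for j
      by (cases i "w ! (j - 1)" rule: linorder_cases) (simp_all add: cscale_simps)
    ultimately show ?thesis by (simp only: sum_subtractf)
  qed
  have "app (gl.outer i {i} i i) (tau x ?w) = (\<Sum>q\<in>?Q. cscale (?sg q) (cscale (psgn m p q) (tau x (E_tot m p l i q (E_tot m p l q i ?w)))))"
    unfolding gl.outer_def app_sum_left
  proof (rule sum.cong[OF refl])
    fix q assume "q \<in> ?Q"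
    then have q: "q \<in> {1..m + n}" by simp
    show "app (gl.sg q * of_int (sgn (int q - int i)) * (E_act i q * E_act q i)) (tau x ?w)
        = cscale (?sg q) (cscale (psgn m p q) (tau x (E_tot m p l i q (E_tot m p l q i ?w))))"
      unfolding sg_of_int_app by (simp add: E_act_tau[OF q x wN] E_act_tau[OF i x E_tot_closed[OF q wN]] cscale_simps mult.commute)
  qed
  also have "\<dots> = (\<Sum>q\<in>?Q. \<Sum>k\<in>pos w i. (\<Sum>j\<in>{1..l} - {k}. cscale (?sg q) (if w ! (j - 1) = q then F j k else 0))
        + cscale (?sg q * psgn m p q) (tau x ?w))"
    by (intro sum.cong refl) (subst E_tot_flip[OF x w i, folded F_def], auto simp: cscale_sum cscale_simps(1,3) sum.distrib)
  also have "\<dots> = (\<Sum>k\<in>pos w i. \<Sum>q\<in>?Q. (\<Sum>j\<in>{1..l} - {k}. cscale (?sg q) (if w ! (j - 1) = q then F j k else 0))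
        + cscale (?sg q * psgn m p q) (tau x ?w))"
    by (rule sum.swap)
  also have "\<dots> = (\<Sum>k\<in>pos w i. (\<Sum>j\<in>{1..l} - {k}. \<Sum>q\<in>?Q. cscale (?sg q) (if w ! (j - 1) = q then F j k else 0)))
        + (\<Sum>k\<in>pos w i. \<Sum>q\<in>?Q. cscale (?sg q * psgn m p q) (tau x ?w))"
    unfolding sum.distrib by (intro arg_cong2[where f = "(+)"] sum.cong refl sum.swap)
  also have "(\<Sum>k\<in>pos w i. \<Sum>q\<in>?Q. cscale (?sg q * psgn m p q) (tau x ?w))
      = cscale (of_nat (card (pos w i)) * (\<Sum>q\<in>?Q. ?sg q * psgn m p q)) (tau x ?w)"
    by (rule poly_mapping_eqI) (simp add: lookup_sum lookup_cscale lookup_add sum_distrib_right mult.assoc)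
  also have "(\<Sum>k\<in>pos w i. (\<Sum>j\<in>{1..l} - {k}. \<Sum>q\<in>?Q. cscale (?sg q) (if w ! (j - 1) = q then F j k else 0)))
      = (\<Sum>k\<in>pos w i. (\<Sum>j\<in>pos_gt w i. F j k) - (\<Sum>j\<in>pos_lt w i. F j k))"
  proof (rule sum.cong[OF refl])
    fix k assume k: "k \<in> pos w i"
    show "(\<Sum>j\<in>{1..l} - {k}. \<Sum>q\<in>?Q. cscale (?sg q) (if w ! (j - 1) = q then F j k else 0))
        = (\<Sum>j\<in>pos_gt w i. F j k) - (\<Sum>j\<in>pos_lt w i. F j k)"
      unfolding sgn_split[OF k, symmetric] by (rule sum.cong[OF refl], rule pick) blast
  qed
  finally have Q: "app (gl.outer i {i} i i) (tau x ?w) = (\<Sum>k\<in>pos w i. (\<Sum>j\<in>pos_gt w i. F j k) - (\<Sum>j\<in>pos_lt w i. F j k))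
    + cscale (of_nat (card (pos w i)) * (\<Sum>q\<in>?Q. ?sg q * psgn m p q)) (tau x ?w)" .
  have "app (J_act i i) (tau x ?w) = (\<Sum>k = 1..l. if w ! (k - 1) = i then tau (ract x (frak_y l t c k)) ?w else 0)"
    unfolding J_act_tau[OF i x wN] E_op_diag using x by (intro sum.cong refl) (auto simp: tau_zero_right)
  also have "\<dots> = (\<Sum>k\<in>pos w i. tau (ract x (frak_y l t c k)) ?w)"
    by (rule sum.mono_neutral_cong_right) (auto simp: pos_def)
  finally have Y: "app (J_act i i) (tau x ?w) = \<dots>" .
  have mem: "k \<in> {1..l}" if "k \<in> pos w i \<or> k \<in> pos_gt w i \<or> k \<in> pos_lt w i" for k
    using that by (auto simp: pos_defs)
  have G: "tau (ract x (frak_y l t c k - cscale (c / 2) ((\<Sum>a\<in>pos_gt w i. dperm (transpose a k)) - (\<Sum>a\<in>pos_lt w i. dperm (transpose a k))))) ?w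
      = tau (ract x (frak_y l t c k)) ?w - cscale (c / 2) ((\<Sum>j\<in>pos_gt w i. F j k) - (\<Sum>j\<in>pos_lt w i. F j k))"
    (is "tau (ract x (?y - cscale _ (?g - ?l))) ?w = _") if "k \<in> pos w i" for k
  proof -
    have y: "?y \<in> FA" using that mem by simp
    have gl: "?g \<in> FA" "?l \<in> FA" by (rule free_algebra_sum_closed, rule FA_transpose; use that mem in blast)+
    have d: "tau (ract x (f - g)) ?w = tau (ract x f) ?w - tau (ract x g) ?w" if "f \<in> FA" "g \<in> FA" for f g
      using tau_ract_lin(1)[OF x wN _ that(2), of "f - g"] that by (simp add: FA_closed)
    have s: "tau (ract x (\<Sum>a\<in>S. dperm (transpose a k))) ?w = (\<Sum>a\<in>S. F a k)" if "S \<subseteq> {1..l}" for S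
      unfolding F_def by (rule tau_ract_sum[OF x wN]) (rule FA_transpose; use that mem \<open>k \<in> pos w i\<close> in blast)
    have sub: "pos_gt w i \<subseteq> {1..l}" "pos_lt w i \<subseteq> {1..l}" by (auto simp: pos_defs)
    show ?thesis
      unfolding d[OF y cscale_closed[OF FA_closed(2)[OF gl]]] tau_ract_lin(2)[OF x wN FA_closed(2)[OF gl]]
        d[OF gl] s[OF sub(1)] s[OF sub(2)] ..
  qed
  have "tau (ract x (word_sum w i)) ?w = (\<Sum>k\<in>pos w i. tau (ract x (frak_y l t c k)) ?w
      - cscale (c / 2) ((\<Sum>j\<in>pos_gt w i. F j k) - (\<Sum>j\<in>pos_lt w i. F j k)))"
    unfolding level_sum_def
  proof (subst tau_ract_sum[OF x wN])
    fix k assume "k \<in> pos w i"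
    then show "frak_y l t c k - cscale (c / 2)
        ((\<Sum>a\<in>pos_gt w i. dperm (transpose a k)) - (\<Sum>a\<in>pos_lt w i. dperm (transpose a k))) \<in> FA"
      by (intro FA_closed frak_y_closed FA_transpose mem) auto
  qed (rule sum.cong[OF refl], rule G)
  then show ?thesis
    by (simp add: diag_op_def Y Q cscale_simps(1,3) cscale_sum sum_subtractf sum.distrib mult.assoc algebra_simps)
qed

lemma diag_op_good: "diag_op i \<in> good"
  unfolding diag_op_def gl.outer_def by (intro good_closed good_sum J_act_good E_act_good)

text \<open>For i < j every letter that is at most \<open>i\<close> is smaller than
  \<open>j\<close>; this is the nesting required in
  \<open>right_op_level_sum_commute\<close>.\<close>

lemma word_sum_commute:
  assumes "i < j"
  shows "right_op (word_sum w i * word_sum w j) = right_op (word_sum w j * word_sum w i)"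
  by (rule right_op_level_sum_commute) (use assms in \<open>auto simp: pos_defs\<close>)

text \<open>Both operators keep the word and, up to a scalar depending only on the word, act on the
  module element by a word sum. Commutation therefore reduces to that of the two word sums.\<close>

lemma diag_op_commute:
  assumes "i \<in> {1..m + n}" "j \<in> {1..m + n}"
  shows "diag_op i * diag_op j = diag_op j * diag_op i"
proof (rule good_eq_on_wordsI)
  show "diag_op i * diag_op j \<in> good" "diag_op j * diag_op i \<in> good" by (intro good_closed(3) diag_op_good)+
  fix x w assume x: "x \<in> carrier M" and w: "w \<in> words m n l"
  note wN = single_word[OF w, of 1]
  have "right_op (word_sum w j * word_sum w i) = right_op (word_sum w i * word_sum w j)"
    using word_sum_commute[of i j w] word_sum_commute[of j i w] by (cases i j rule: linorder_cases) auto
  from tau_ract_cong[OF this x wN]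
  have "tau (ract (ract x (word_sum w j)) (word_sum w i)) (Poly_Mapping.single w 1) = tau (ract (ract x (word_sum w i)) (word_sum w j)) (Poly_Mapping.single w 1)"
    using x by (simp add: ract_linear word_sum_closed)
  then show "app (diag_op i * diag_op j) (tau x (Poly_Mapping.single w 1)) = app (diag_op j * diag_op i) (tau x (Poly_Mapping.single w 1))"
    using x w assms
    by (simp add: diag_op_word word_sum_closed app_diff app_linear cscale_diff cscale_simps(3) mult.commute)
qed

section \<open>Images of the Yangian generators\<close>

definition Ht :: "nat \<Rightarrow> ('m \<times> tensor) linop" where
  "Ht i = gl.jh i - smul (c / 2) (gl.th2 i)"

text \<open>The quadratic terms of \<open>th2 i\<close> belong to two consecutive operators
  \<open>diag_op\<close>; only the shift times \<open>h i\<close> is left over.\<close>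

lemma Ht_diag_op:
  assumes "1 \<le> i" "i + 1 \<le> m + n"
  shows "Ht i = gl.sg i * diag_op i - gl.sg (i + 1) * diag_op (i + 1) + smul (c / 2) (of_int (gl.shf (i - 1)) * gl.h i)"
proof -
  have s: "gl.sg k * smul d x = smul d (gl.sg k * x)" for k d x by (simp add: smul_simps)
  show ?thesis
    by (simp add: Ht_def diag_op_def gl.jh_def gl.th2_def right_diff_distrib s smul_simps(1-3) algebra_simps)
qed

lemma h_diag_op:
  assumes "1 \<le> i" "i + 1 \<le> m + n" "j \<in> {1..m + n}"
  shows "gl.h i * diag_op j = diag_op j * gl.h i"
proof -
  have w: "gl.weight a (J_act j j) 0" "gl.weight a (gl.outer j {j} j j) 0" if "a \<in> {1..m + n}" for a
    using gl.weight_J[of a j j] gl.weight_outer[of a j j j "{j}"] that assms(3) by simp_all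
  have "gl.br 0 0 (gl.h i) (J_act j j) = 0" "gl.br 0 0 (gl.h i) (gl.outer j {j} j j) = 0"
    using gl.h_weight[OF w(1) w(1), of i 0] gl.h_weight[OF w(2) w(2), of i 0] assms by auto
  then show ?thesis by (simp add: gl.br_def diag_op_def smul_simps right_diff_distrib left_diff_distrib)
qed

lemma h_h:
  assumes "1 \<le> i" "i + 1 \<le> m + n" "1 \<le> j" "j + 1 \<le> m + n"
  shows "gl.h i * gl.h j = gl.h j * gl.h i"
  using gl.h_x(3)[OF assms] by (simp add: gl.br_def)

lemma h_Ht:
  assumes "1 \<le> i" "i + 1 \<le> m + n" "1 \<le> j" "j + 1 \<le> m + n"
  shows "gl.h i * Ht j = Ht j * gl.h i"
  using gl.h_j(1)[OF assms] gl.h_w(1)[OF assms, of 0]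
  by (simp add: gl.br_def Ht_def smul_simps right_diff_distrib left_diff_distrib)

lemma Ht_Ht:
  assumes "1 \<le> i" "i + 1 \<le> m + n" "1 \<le> j" "j + 1 \<le> m + n"
  shows "Ht i * Ht j = Ht j * Ht i"
proof -
  have sg: "gl.sg k * x = smul ((-1) ^ par m p k) x" for k x by (simp add: gl.sg_def smul_sign)
  have comm: "(smul a1 A1 - smul a2 A2 + smul a3 (of_int z * H)) * (smul b1 B1 - smul b2 B2 + smul b3 (of_int y * H'))
      = (smul b1 B1 - smul b2 B2 + smul b3 (of_int y * H')) * (smul a1 A1 - smul a2 A2 + smul a3 (of_int z * H))"
    if "A1 * B1 = B1 * A1" "A1 * B2 = B2 * A1" "A2 * B1 = B1 * A2" "A2 * B2 = B2 * A2" "H * B1 = B1 * H" "H * B2 = B2 * H"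
      "H' * A1 = A1 * H'" "H' * A2 = A2 * H'" "H * H' = H' * H"
    for a1 a2 a3 b1 b2 b3 z y and A1 A2 B1 B2 H H' :: "('m \<times> tensor) linop"
    unfolding smul_of_int[symmetric]
    by (simp add: smul_simps(1-6) ring_distribs that mult_ac)
  show ?thesis
    unfolding Ht_diag_op[OF assms(1,2)] Ht_diag_op[OF assms(3,4)] sg
    by (rule comm; (intro diag_op_commute h_h h_diag_op)?; use assms in auto)
qed

text \<open>The formulas for J solved for the generators of degree one; \<open>wp2\<close> and
  \<open>wm2\<close> are doubled, hence c/2. For \<open>YH i 1\<close> the square removed in
  \<open>yH_tilde\<close> is added back.\<close>

fun gen_op :: "ygen \<Rightarrow> ('m \<times> tensor) linop" where
  "gen_op (YX Plus i r) = (if r = 0 then gl.xp i else gl.jp i - smul (c / 2) (gl.wp2 i))"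
| "gen_op (YX Minus i r) = (if r = 0 then gl.xm i else gl.jm i - smul (c / 2) (gl.wm2 i))"
| "gen_op (YH i r) = (if r = 0 then gl.h i else Ht i + smul (c / 2) (gl.h i * gl.h i))"

abbreviation "evp \<equiv> ev gen_op"
abbreviation "Ypar \<equiv> ygen_parity m p"

lemma cart_cartan: "gl.cart i j = cartan m p i j"
  by (simp add: gl.cart_def cartan_def gl.sg_int_def psgn_def)

lemma yX_hom: "yX e i r \<in> homogeneous Ypar (gl.pt i)"
  using gen_homogeneous[of "YX e i r" Ypar] by (simp add: gl.pt_def split: if_splits)

lemma yH_hom: "yH i r \<in> homogeneous Ypar 0"
  using gen_homogeneous[of "YH i r" Ypar] by simp

lemma evp_br:
  "x \<in> homogeneous Ypar a \<Longrightarrow> y \<in> homogeneous Ypar b \<Longrightarrow> evp (ybr m p x y) = gl.br a b (evp x) (evp y)"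
  by (simp add: ev_supercomm gl.br_def)

lemma br_smul:
  "gl.br q r (x - smul k y) z = gl.br q r x z - smul k (gl.br q r y z)"
  "gl.br q r z (x - smul k y) = gl.br q r z x - smul k (gl.br q r z y)"
  by (simp_all add: gl.br_def smul_simps right_diff_distrib left_diff_distrib sign_smul mult.commute)

lemma smul_cart: "smul (of_int z) x = of_int z * x" "smul (- of_int z) x = - of_int z * x"
  using smul_of_int[of "- z" x] by (simp_all add: smul_of_int)

lemma node_range: "i \<in> {1..m + n - 1} \<Longrightarrow> 1 \<le> i \<and> i + 1 \<le> m + n"
  by auto

lemma yH_tilde_hom: "yH_tilde c i \<in> homogeneous Ypar 0"
proof -
  have "cscale (c / 2) (yH i 0 * yH i 0) \<in> homogeneous Ypar 0"
    using homogeneous_mult[OF yH_hom yH_hom, of i 0 i 0] by (simp add: homogeneous_cscale)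
  then show ?thesis
    using yH_hom[of i 1] keys_diff_subset[of "yH i 1" "cscale (c / 2) (yH i 0 * yH i 0)"]
    by (auto simp: yH_tilde_def homogeneous_def)
qed

lemma evp_yH_tilde: "evp (yH_tilde c i) = Ht i"
  by (simp add: yH_tilde_def)

lemma evp_rel:
  assumes m: "2 \<le> m" and r: "r \<in> yangian_rel m n p c"
  shows "evp r = 0"
proof -
  \<comment> \<open>The even indices form one block of length m \<ge> 2 with odd indices outside, so
    two changes of parity never follow each other immediately.\<close>
  have adj: "par m p k = par m p (k + 1) \<or> par m p (k + 1) = par m p (k + 2)" for k
    using m by (auto simp: par_def)
  note hom = evp_br[OF yX_hom yX_hom] evp_br[OF yH_hom yX_hom] evp_br[OF yH_hom yH_hom] evp_br[OF yH_tilde_hom yX_hom]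
  from r show ?thesis
  proof cases
    case (HH i j r s)
    note ij = node_range[OF HH(2)] node_range[OF HH(3)]
    have c: "gl.h i * Ht j = Ht j * gl.h i" "gl.h j * Ht i = Ht i * gl.h j" "Ht i * Ht j = Ht j * Ht i"
      "gl.h i * gl.h j = gl.h j * gl.h i"
      using ij by (auto intro!: h_Ht Ht_Ht h_h)
    have square: "x * x * b = b * (x * x)" if "x * b = b * x" for x b :: "('m \<times> tensor) linop"
      by (simp only: mult.assoc that) (simp only: mult.assoc[symmetric] that)
    have comm: "(a + smul k (x * x)) * (b + smul k (y * y)) = (b + smul k (y * y)) * (a + smul k (x * x))"
      if "a * b = b * a" "x * b = b * x" "y * a = a * y" "x * y = y * x" for a b x y :: "('m \<times> tensor) linop" and k
      using that(1) square[OF that(2)] square[OF that(3)] square[OF square[OF that(4), symmetric], symmetric]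
      by (simp add: smul_simps ring_distribs mult.assoc)
    note comm[OF c(3,1,2,4), of "c / 2"]
    moreover have "gl.h i * (Ht j + smul (c / 2) (gl.h j * gl.h j)) = (Ht j + smul (c / 2) (gl.h j * gl.h j)) * gl.h i"
      "gl.h j * (Ht i + smul (c / 2) (gl.h i * gl.h i)) = (Ht i + smul (c / 2) (gl.h i * gl.h i)) * gl.h j"
      using c square[OF c(4)] square[OF c(4)[symmetric]] by (simp_all add: ring_distribs smul_simps)
    ultimately show ?thesis
      using HH(1,4,5) c(4) by (auto simp: hom gl.br_def)
  next
    case (XX00 i j)
    then show ?thesis using node_range[OF XX00(2)] node_range[OF XX00(3)] by (auto simp: hom gl.x_x_mixed)
  next
    case (XX10 i j)
    then show ?thesis using node_range[OF XX10(2)] node_range[OF XX10(3)]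
      by (auto simp: hom br_smul gl.x_j_mixed gl.w_x_mixed Ht_def smul_simps)
  next
    case (XX01 i j)
    then show ?thesis using node_range[OF XX01(2)] node_range[OF XX01(3)]
      by (auto simp: hom br_smul gl.x_j_mixed gl.w_x_mixed Ht_def smul_simps)
  next
    case (HX0 i j r e)
    then show ?thesis using node_range[OF HX0(2)] node_range[OF HX0(3)]
      by (cases e) (auto simp: hom br_smul gl.h_x gl.h_j gl.h_w cart_cartan smul_cart smul_simps left_diff_distrib mult_of_int_commute
          simp flip: smul_of_int)
  next
    case (HX1 i j e)
    then show ?thesis using node_range[OF HX1(2)] node_range[OF HX1(3)]
      by (cases e) (auto simp: hom evp_yH_tilde Ht_def br_smul gl.jh_x gl.th2_x cart_cartan smul_simps mult.commute
          simp flip: smul_of_int)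
  next
    case (XX i j e)
    have ij: "1 \<le> i" "i + 1 \<le> m + n" "1 \<le> j" "j + 1 \<le> m + n" using node_range[OF XX(2)] node_range[OF XX(3)] by auto
    \<comment> \<open>The \<open>J\<close> parts of the two brackets agree and cancel; the
      anticommutator comes from the quadratic corrections alone.\<close>
    note j = gl.j_x_comm[OF ij] and w = gl.w_x_comm[OF ij adj]
    have "gl.br (gl.pt i) (gl.pt j) (gl.wp2 i) (gl.xp j) = gl.br (gl.pt i) (gl.pt j) (gl.xp i) (gl.wp2 j) - smul (of_int (cartan m p i j)) (gl.xp i * gl.xp j + gl.xp j * gl.xp i)"
      "gl.br (gl.pt i) (gl.pt j) (gl.wm2 i) (gl.xm j) = gl.br (gl.pt i) (gl.pt j) (gl.xm i) (gl.wm2 j) + smul (of_int (cartan m p i j)) (gl.xm i * gl.xm j + gl.xm j * gl.xm i)"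
      using w unfolding smul_of_int cart_cartan by (simp_all add: algebra_simps)
    then show ?thesis using XX(1)
      by (cases e) (simp_all add: hom br_smul j anticomm_def smul_simps mult.commute)
  next
    case (Serre i j e)
    note ij = node_range[OF Serre(2)] node_range[OF Serre(3)]
    let ?x = "\<lambda>i. case e of Plus \<Rightarrow> gl.xp i | Minus \<Rightarrow> gl.xm i"
    have x: "evp (yX e i 0) = ?x i" for i by (cases e) simp_all
    have 1: "evp (ybr m p (yX e i 0) (yX e j 0)) = gl.br (gl.pt i) (gl.pt j) (?x i) (?x j)" by (cases e) (simp_all add: hom)
    have 2: "evp (ybr m p (yX e i 0) (ybr m p (yX e i 0) (yX e j 0)))
        = gl.br (gl.pt i) ((gl.pt i + gl.pt j) mod 2) (?x i) (gl.br (gl.pt i) (gl.pt j) (?x i) (?x j))"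
      by (simp only: evp_br[OF yX_hom homogeneous_supercomm[OF yX_hom yX_hom]] 1 x)
    \<comment> \<open>Adjacent nodes have Cartan entry 1 or -1 and hence a double bracket; for
      distant nodes the entry is 0 and a single bracket is left.\<close>
    consider "j = i + 1" | "i = j + 1" | "j + 1 < i \<or> i + 1 < j" using Serre(4) by linarith
    then show ?thesis
    proof cases
      case 1
      have a: "nat \<bar>cartan m p i j\<bar> = 1" by (auto simp: 1 cartan_def psgn_def par_def)
      show ?thesis
        using ij 1 gl.serre(1,3)[of i] Serre(1) 2 unfolding a by (cases e) (simp_all add: eval_nat_numeral)
    next
      case 2
      have a: "nat \<bar>cartan m p i j\<bar> = 1" by (auto simp: 2 cartan_def psgn_def par_def)
      show ?thesis
        using ij 2 gl.serre(2,4)[of j] Serre(1) \<open>evp (ybr m p (yX e i 0) (ybr m p (yX e i 0) (yX e j 0))) = _\<close>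
        unfolding a by (cases e) (simp_all add: eval_nat_numeral)
    next
      case 3
      have a: "cartan m p i j = 0" using 3 by (auto simp: cartan_def)
      show ?thesis
        using ij 3 gl.x_x_far[of i j] Serre(1) 1 unfolding a by (cases e) auto
    qed
  next
    case (odd_square i e)
    have "gl.pt i = 1" using odd_square(3) by (simp add: gl.pt_def)
    then show ?thesis
      using node_range[OF odd_square(2)] odd_square gl.x_x_same[of i] by (cases e) (auto simp: hom)
  next
    case (odd_Serre i e)
    let ?x = "\<lambda>i. case e of Plus \<Rightarrow> gl.xp i | Minus \<Rightarrow> gl.xm i"
    have x: "evp (yX e i 0) = ?x i" for i by (cases e) simp_all
    obtain k where k: "i = k + 1" "1 \<le> k" "k + 3 \<le> m + n" using odd_Serre(2,3) by (cases i) auto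
    have "evp (ybr m p (ybr m p (yX e (i - 1) 0) (yX e i 0)) (ybr m p (yX e i 0) (yX e (i + 1) 0)))
      = gl.br ((gl.pt k + gl.pt (k + 1)) mod 2) ((gl.pt (k + 1) + gl.pt (k + 2)) mod 2)
         (gl.br (gl.pt k) (gl.pt (k + 1)) (?x k) (?x (k + 1))) (gl.br (gl.pt (k + 1)) (gl.pt (k + 2)) (?x (k + 1)) (?x (k + 2)))"
      unfolding k(1) add_diff_cancel_right' add.assoc one_add_one
      by (simp only: evp_br[OF homogeneous_supercomm[OF yX_hom yX_hom] homogeneous_supercomm[OF yX_hom yX_hom]] hom x)
    then show ?thesis using odd_Serre(1) gl.odd_serre[OF k(2,3)] by (cases e) simp_all
  qed
qed

section \<open>Images of the quadratic elements and of J\<close>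

lemma evp_yE_up:
  assumes "1 \<le> i" "i + d + 1 \<le> m + n"
  shows "evp (yE_up m p i d) = E_act i (i + d + 1)"
  using assms
proof (induction d)
  case 0
  then show ?case by (simp add: gl.xp_def)
next
  case (Suc d)
  let ?a = "par m p i" and ?b = "par m p (i + d + 1)" and ?c = "par m p (i + d + 2)"
  have U: "yE_up m p i d \<in> homogeneous Ypar ((?a + ?b) mod 2)"
    using yE_up_props[of i d m n p] Suc.prems by simp
  have k: "(-1) ^ ((?a + ?b) mod 2 * gl.pt (i + d + 1)) = gl.ks i (i + d + 1) (i + d + 1) (i + d + 2)"
    using gl.s01[of i] gl.s01[of "i + d + 1"] gl.s01[of "i + d + 2"] by (auto simp: gl.pt_def gl.ks_def)
  show ?case
    using Suc gl.br_E[OF _ _ _ _ k] by (simp add: evp_br[OF U yX_hom] gl.xp_def)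
qed

lemma evp_yE_down:
  assumes "1 \<le> i" "i + d + 1 \<le> m + n"
  shows "evp (yE_down m p i d) = E_act (i + d + 1) i"
  using assms
proof (induction d)
  case 0
  then show ?case by (simp add: gl.xm_def gl.sg_def psgn_def smul_sign minus_one_power_iff smul_simps)
next
  case (Suc d)
  let ?a = "par m p i" and ?b = "par m p (i + d + 1)" and ?c = "par m p (i + d + 2)"
  have U: "yE_down m p i d \<in> homogeneous Ypar ((?a + ?b) mod 2)"
    using yE_down_props[of i d m n p] Suc.prems by simp
  have k: "(-1) ^ (gl.pt (i + d + 1) * ((?a + ?b) mod 2)) = gl.ks (i + d + 2) (i + d + 1) (i + d + 1) i"
    using gl.s01[of i] gl.s01[of "i + d + 1"] gl.s01[of "i + d + 2"] by (auto simp: gl.pt_def gl.ks_def)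
  have x: "evp (cscale (psgn m p (i + d + 1)) (yX Minus (i + d + 1) 0)) = E_act (i + d + 2) (i + d + 1)"
    by (simp add: gl.xm_def gl.sg_def psgn_def smul_sign minus_one_power_iff smul_simps)
  show ?case
    using Suc gl.br_E[OF _ _ _ _ k]
    unfolding yE_down.simps evp_br[OF homogeneous_cscale[OF yX_hom] U] x by simp
qed

lemma evp_yE:
  assumes "i \<in> {1..m + n}" "j \<in> {1..m + n}" "i \<noteq> j"
  shows "evp (yE m p i j) = E_act i j"
  using assms evp_yE_up[of i "j - i - 1"] evp_yE_down[of j "i - j - 1"] by (auto simp: yE_def)

lemma shift_shf: "shift m n p i = of_int (gl.shf i)"
  by (simp add: shift_def gl.shf_def gl.sg_int_def psgn_def)

lemma evp_outer:
  assumes "D \<subseteq> {1..m + n}" "c' \<in> D" "d \<in> D" "c' \<in> {1..m + n}" "d \<in> {1..m + n}"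
  shows "evp (\<Sum>k\<in>{1..m + n} - D. cscale (psgn m p k * nsign k i) (yE m p c' k * yE m p k d)) = gl.outer i D c' d"
  unfolding gl.outer_def ev_sum
proof (rule sum.cong[OF refl])
  fix k assume "k \<in> {1..m + n} - D"
  then have "k \<in> {1..m + n}" "c' \<noteq> k" "k \<noteq> d" using assms by auto
  then have "evp (cscale (psgn m p k * nsign k i) (yE m p c' k * yE m p k d))
      = smul (psgn m p k) (smul (of_int (sgn (int k - int i))) (E_act c' k * E_act k d))"
    using assms by (simp add: evp_yE nsign_def smul_simps)
  also have "\<dots> = gl.sg k * of_int (sgn (int k - int i)) * (E_act c' k * E_act k d)"
    by (simp add: smul_of_int psgn_def smul_sign gl.sg_def mult.assoc)
  finally show "evp (cscale (psgn m p k * nsign k i) (yE m p c' k * yE m p k d))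
      = gl.sg k * of_int (sgn (int k - int i)) * (E_act c' k * E_act k d)" .
qed

lemma psgn_half: "smul (psgn m p i / 2) x = smul (1 / 2) (gl.sg i * x)"
  by (simp add: gl.sg_def psgn_def smul_simps flip: smul_sign)

lemma shift_half: "smul (shift m n p i / 2) x = smul (1 / 2) (of_int (gl.shf i) * x)"
  by (simp add: shift_shf smul_simps flip: smul_of_int)

context
  fixes i assumes i: "i \<in> {1..m + n - 1}"
begin

lemma evp_vartheta: "evp (vartheta m n p i) = smul (1 / 2) (gl.th2 i)"
  using node_range[OF i] evp_outer[of "{i}" i i i] evp_outer[of "{i + 1}" "i + 1" "i + 1" "i + 1"]
  by (simp add: vartheta_def gl.th2_def psgn_half shift_half smul_simps(1,2,3,10) del: ev_sum)

lemma evp_varpi: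
  "evp (varpi_plus m n p i) = smul (1 / 2) (gl.wp2 i)"
  "evp (varpi_minus m n p i) = smul (1 / 2) (gl.wm2 i)"
  using node_range[OF i] evp_outer[of "{i, i + 1}" i "i + 1" i] evp_outer[of "{i, i + 1}" "i + 1" i i]
  by (simp_all add: varpi_plus_def varpi_minus_def gl.wp2_def gl.wm2_def gl.xp_def gl.xm_def
      psgn_half shift_half smul_simps(1,2,3,10) del: ev_sum)

lemma evp_J:
  "evp (J_h m n p c i) = gl.jh i"
  "evp (J_x_plus m n p c i) = gl.jp i"
  "evp (J_x_minus m n p c i) = gl.jm i"
  by (simp_all add: J_h_def J_x_plus_def J_x_minus_def evp_yH_tilde evp_vartheta evp_varpi Ht_def smul_simps)

end

end

section \<open>Quotients of free vector spaces\<close>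

lemma free_space_simps [simp]:
  "carrier (free_space B) = {f. Poly_Mapping.keys f \<subseteq> B}"
  "add (free_space B) = (+)" "ring.zero (free_space B) = 0" "module.smult (free_space B) = cscale"
  by (simp_all add: free_space_def)

lemma complex_ring_simps [simp]:
  "carrier complex_ring = UNIV" "monoid.mult complex_ring = times" "one complex_ring = 1"
  "ring.zero complex_ring = 0" "add complex_ring = (+)"
  by (simp_all add: ring_of_type_algebra_def)

lemma single_keys_subset: "b \<in> B \<Longrightarrow> Poly_Mapping.keys (Poly_Mapping.single b (k :: complex)) \<subseteq> B"
  by (simp split: if_splits)

lemma free_space_span:
  "{f. Poly_Mapping.keys f \<subseteq> B} = cvec.span ((\<lambda>b. Poly_Mapping.single b (1 :: complex)) ` B)"
proof (intro equalityI subsetI)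
  fix f :: "'a \<Rightarrow>\<^sub>0 complex" assume "f \<in> {f. Poly_Mapping.keys f \<subseteq> B}"
  then have "(\<Sum>b\<in>Poly_Mapping.keys f. cscale (Poly_Mapping.lookup f b) (Poly_Mapping.single b 1))
      \<in> cvec.span ((\<lambda>b. Poly_Mapping.single b (1 :: complex)) ` B)"
    by (intro cvec.span_sum cvec.span_scale cvec.span_base) auto
  then show "f \<in> cvec.span ((\<lambda>b. Poly_Mapping.single b (1 :: complex)) ` B)"
    by (simp add: cscale_simps sum_single_keys)
next
  fix f :: "'a \<Rightarrow>\<^sub>0 complex" assume "f \<in> cvec.span ((\<lambda>b. Poly_Mapping.single b (1 :: complex)) ` B)"
  then show "f \<in> {f. Poly_Mapping.keys f \<subseteq> B}"
  proof (induction rule: cvec.span_induct_alt)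
    case (step c x y)
    then have "Poly_Mapping.keys (cscale c x) \<subseteq> B" using keys_cscale[of c x] by auto
    then show ?case using Poly_Mapping.keys_add[of "cscale c x" y] step by auto
  qed simp
qed

lemma free_space_subspace: "cvec.subspace {f :: 'a \<Rightarrow>\<^sub>0 complex. Poly_Mapping.keys f \<subseteq> B}"
  unfolding free_space_span by simp

lemma free_space_module: "module complex_ring (free_space B)"
proof (rule moduleI)
  have sub: "x + y \<in> carrier (free_space B)" "cscale a x \<in> carrier (free_space B)" "- x \<in> carrier (free_space B)"
    if "x \<in> carrier (free_space B)" "y \<in> carrier (free_space B)" for x y :: "'a \<Rightarrow>\<^sub>0 complex" and a
    using that cvec.subspace_add[OF free_space_subspace, of x B y] cvec.subspace_scale[OF free_space_subspace, of x B a]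
    by (simp_all add: keys_minus)
  show "abelian_group (free_space B)"
  proof (rule abelian_groupI)
    fix x assume "x \<in> carrier (free_space B)"
    then show "\<exists>y\<in>carrier (free_space B). y \<oplus>\<^bsub>free_space B\<^esub> x = \<zero>\<^bsub>free_space B\<^esub>"
      by (intro bexI[of _ "- x"] sub) auto
  qed (use sub in \<open>auto simp: add_ac\<close>)
  show "a \<odot>\<^bsub>free_space B\<^esub> x \<in> carrier (free_space B)" if "x \<in> carrier (free_space B)" for a x
    using sub(2)[OF that that] by simp
qed (auto simp: cscale_simps)

text \<open>Links submodules of the record to subspaces of the type, so that \<open>lin_span\<close>
  becomes the span of \<open>cvec\<close>.\<close>

lemma submodule_free_space:
  "submodule W complex_ring (free_space B) \<longleftrightarrow> cvec.subspace W \<and> W \<subseteq> carrier (free_space B)"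
proof -
  interpret module complex_ring "free_space B" by (rule free_space_module)
  show ?thesis
  proof
    assume W: "submodule W complex_ring (free_space B)"
    note E = submoduleE[OF W]
    have "0 \<in> W" using E(2) E(4)[of 0] by (auto simp: cscale_simps)
    then show "cvec.subspace W \<and> W \<subseteq> carrier (free_space B)"
      using E(1,4,5) by (auto simp: cvec.subspace_def)
  next
    assume W: "cvec.subspace W \<and> W \<subseteq> carrier (free_space B)"
    have "\<ominus>\<^bsub>free_space B\<^esub> x = - x" if "x \<in> carrier (free_space B)" for x
      using that by (intro minus_equality) (auto simp: keys_minus)
    then show "submodule W complex_ring (free_space B)"
      using W cvec.subspace_neg[of W]
      by (intro submoduleI) (auto simp: cvec.subspace_0 cvec.subspace_add cvec.subspace_scale)
  qed
qed

lemma lin_span_free_space: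
  assumes "S \<subseteq> carrier (free_space B)"
  shows "lin_span (free_space B) S = cvec.span S"
proof (rule equalityI)
  have "cvec.span S \<subseteq> carrier (free_space B)"
    using assms cvec.span_minimal[OF _ free_space_subspace] by simp
  then show "lin_span (free_space B) S \<subseteq> cvec.span S"
    unfolding lin_span_def by (intro Inter_lower) (auto simp: submodule_free_space cvec.span_superset)
  show "cvec.span S \<subseteq> lin_span (free_space B) S"
    unfolding lin_span_def by (intro Inter_greatest cvec.span_minimal) (auto simp: submodule_free_space)
qed

locale free_space_quotient =
  fixes B :: "'a set" and S :: "('a \<Rightarrow>\<^sub>0 complex) set"
  assumes rel_closed: "S \<subseteq> carrier (free_space B)"
begin

abbreviation "Fr \<equiv> carrier (free_space B)"
abbreviation "K \<equiv> cvec.span S"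
abbreviation "Q \<equiv> quot_module (free_space B) K"

definition coset :: "('a \<Rightarrow>\<^sub>0 complex) \<Rightarrow> ('a \<Rightarrow>\<^sub>0 complex) set" where
  "coset u = K +>\<^bsub>free_space B\<^esub> u"

lemma coset_alt: "coset u = (\<lambda>h. h + u) ` K"
  by (auto simp: coset_def a_r_coset_def')

lemma coset_eq_iff: "coset u = coset v \<longleftrightarrow> u - v \<in> K"
proof
  assume "coset u = coset v"
  moreover have "u \<in> coset u" unfolding coset_alt by (rule image_eqI[of _ _ 0]) (simp_all add: cvec.span_zero)
  ultimately obtain h where "h \<in> K" "u = h + v" unfolding coset_alt by blast
  then show "u - v \<in> K" by simp
next
  assume d: "u - v \<in> K"
  have "h + u = (h + (u - v)) + v" "h + v = (h - (u - v)) + u" for h by simp_all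
  then show "coset u = coset v"
    unfolding coset_alt using cvec.span_add[OF _ d] cvec.span_diff[OF _ d] by (metis (no_types, lifting) image_cong image_eqI image_subsetI subset_antisym)
qed

lemma Fr_closed: "0 \<in> Fr" "u \<in> Fr \<Longrightarrow> v \<in> Fr \<Longrightarrow> u + v \<in> Fr" "u \<in> Fr \<Longrightarrow> v \<in> Fr \<Longrightarrow> u - v \<in> Fr"
    "u \<in> Fr \<Longrightarrow> cscale a u \<in> Fr"
  using cvec.subspace_add[OF free_space_subspace, of u B v] cvec.subspace_scale[OF free_space_subspace, of u B a]
    cvec.subspace_diff[OF free_space_subspace, of u B v] by simp_all

lemma Fr_sum: "(\<And>i. i \<in> I \<Longrightarrow> f i \<in> Fr) \<Longrightarrow> sum f I \<in> Fr"
  using cvec.subspace_sum[OF free_space_subspace, of I f B] by simp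

lemma carrier_Q: "carrier Q = coset ` Fr"
  by (auto simp: quot_module_simps FactRing_def A_RCOSETS_def' coset_def)

lemma coset_add: "coset u \<oplus>\<^bsub>Q\<^esub> coset v = coset (u + v)"
proof -
  have "coset u <+>\<^bsub>free_space B\<^esub> coset v = coset (u + v)"
  proof (intro equalityI subsetI)
    fix x assume "x \<in> coset u <+>\<^bsub>free_space B\<^esub> coset v"
    then obtain g h where "g \<in> K" "h \<in> K" "x = (g + u) + (h + v)"
      by (auto simp: set_add_def' coset_alt)
    then show "x \<in> coset (u + v)"
      unfolding coset_alt by (intro image_eqI[of _ _ "g + h"]) (auto simp: cvec.span_add)
  next
    fix x assume "x \<in> coset (u + v)"
    then obtain h where "h \<in> K" "x = (h + u) + (0 + v)" by (auto simp: coset_alt)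
    then show "x \<in> coset u <+>\<^bsub>free_space B\<^esub> coset v"
      using cvec.span_zero[of S] unfolding set_add_def' coset_alt free_space_simps by blast
  qed
  then show ?thesis by (simp add: quot_module_simps FactRing_def)
qed

lemma coset_zero: "\<zero>\<^bsub>Q\<^esub> = coset 0"
  by (simp add: quot_module_simps FactRing_def coset_alt)

lemma coset_smult: "a \<odot>\<^bsub>Q\<^esub> coset u = coset (cscale a u)"
proof -
  have "coset (cscale a x) = coset (cscale a u)" if "x \<in> coset u" for x
    using that cvec.span_scale[of _ S a] by (auto simp: coset_alt[of u] coset_eq_iff cscale_simps)
  moreover have "u \<in> coset u" unfolding coset_alt by (rule image_eqI[of _ _ 0]) (simp_all add: cvec.span_zero)
  ultimately have "(\<Union>x\<in>coset u. coset (cscale a x)) = coset (cscale a u)" by blast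
  then show ?thesis by (simp add: quot_module_simps coset_def)
qed

lemma coset_in_carrier [simp]: "u \<in> Fr \<Longrightarrow> coset u \<in> carrier Q"
  unfolding carrier_Q by blast

lemma carrier_QE: "x \<in> carrier Q \<Longrightarrow> (\<And>u. u \<in> Fr \<Longrightarrow> x = coset u \<Longrightarrow> P) \<Longrightarrow> P"
  unfolding carrier_Q by blast

lemma Q_module: "module complex_ring Q"
proof (rule moduleI)
  show "abelian_group Q"
  proof (rule abelian_groupI)
    fix x assume "x \<in> carrier Q"
    then obtain u where u: "u \<in> Fr" "x = coset u" by (rule carrier_QE)
    have "- u \<in> Fr" using u(1) by (simp add: keys_minus)
    then show "\<exists>y\<in>carrier Q. y \<oplus>\<^bsub>Q\<^esub> x = \<zero>\<^bsub>Q\<^esub>"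
      by (intro bexI[of _ "coset (- u)"]) (simp_all add: u(2) coset_add coset_zero del: free_space_simps)
  qed (auto elim!: carrier_QE simp: coset_add coset_zero Fr_closed add_ac simp del: free_space_simps)
qed (auto elim!: carrier_QE simp: coset_add coset_smult Fr_closed cscale_simps simp del: free_space_simps(1))

lemma coset_finsum:
  assumes "finite I" "\<And>i. i \<in> I \<Longrightarrow> f i \<in> Fr"
  shows "(\<Oplus>\<^bsub>Q\<^esub>i\<in>I. coset (f i)) = coset (sum f I)"
proof -
  interpret module complex_ring Q by (rule Q_module)
  show ?thesis
    using assms
    by (induction I) (simp_all add: Pi_def coset_add flip: coset_zero del: free_space_simps)
qed

lemma submodule_Q:
  assumes "submodule W complex_ring Q"
  shows "cvec.subspace {u \<in> Fr. coset u \<in> W}"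
proof -
  interpret module complex_ring Q by (rule Q_module)
  note E = submoduleE[OF assms]
  have "coset 0 \<in> W" using E(1,2) E(4)[of 0] by (fastforce simp: coset_smult cscale_simps elim!: carrier_QE)
  then show ?thesis
    using E(4,5) Fr_closed unfolding cvec.subspace_def
    by (auto simp flip: coset_add coset_smult simp del: free_space_simps)
qed

text \<open>Submodules of the quotient correspond to subspaces upstairs that contain the relations:
  pushing forward gives one inclusion, pulling back the other.\<close>

lemma lin_span_Q:
  assumes G: "G \<subseteq> Fr"
  shows "lin_span Q (coset ` G) = coset ` cvec.span (G \<union> S)"
proof (rule equalityI)
  interpret module complex_ring Q by (rule Q_module)
  have sub: "cvec.span (G \<union> S) \<subseteq> Fr"
    using G rel_closed cvec.span_minimal[OF _ free_space_subspace, of "G \<union> S" B] by simp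
  have "submodule (coset ` cvec.span (G \<union> S)) complex_ring Q"
  proof (rule submoduleI)
    show "\<ominus>\<^bsub>Q\<^esub> a \<in> coset ` cvec.span (G \<union> S)" if a: "a \<in> coset ` cvec.span (G \<union> S)" for a
    proof -
      obtain u where u: "u \<in> cvec.span (G \<union> S)" "a = coset u" using a by blast
      have "- u \<in> cvec.span (G \<union> S)" using u(1) by (rule cvec.span_neg)
      moreover from this have "\<ominus>\<^bsub>Q\<^esub> a = coset (- u)"
        using u sub by (intro minus_equality) (auto simp: coset_add coset_zero simp del: free_space_simps)
      ultimately show ?thesis by blast
    qed
  qed (use sub in \<open>auto simp: coset_zero coset_add coset_smult cvec.span_zero
      intro!: imageI cvec.span_add cvec.span_scale simp del: free_space_simps\<close>)
  moreover have "coset ` G \<subseteq> coset ` cvec.span (G \<union> S)" using cvec.span_superset[of "G \<union> S"] by blast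
  ultimately show "lin_span Q (coset ` G) \<subseteq> coset ` cvec.span (G \<union> S)"
    unfolding lin_span_def by blast
  show "coset ` cvec.span (G \<union> S) \<subseteq> lin_span Q (coset ` G)"
    unfolding lin_span_def
  proof (rule Inter_greatest)
    fix W assume "W \<in> {W. submodule W complex_ring Q \<and> coset ` G \<subseteq> W}"
    then have W: "submodule W complex_ring Q" "coset ` G \<subseteq> W" by auto
    have "coset u \<in> W" if "u \<in> S" for u
    proof -
      have "coset u = coset 0" using that by (simp add: coset_eq_iff cvec.span_base)
      then show ?thesis using cvec.subspace_0[OF submodule_Q[OF W(1)]] by simp
    qed
    then have "cvec.span (G \<union> S) \<subseteq> {u \<in> Fr. coset u \<in> W}"
      using W(2) G rel_closed by (intro cvec.span_minimal submodule_Q[OF W(1)]) blast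
    then show "coset ` cvec.span (G \<union> S) \<subseteq> W" by blast
  qed
qed

end

section \<open>Parity and invariance of the kernel\<close>

lemma free_algebra_induct [consumes 1, case_names one gen mult add scale]:
  assumes f: "f \<in> carrier (free_algebra G)" and one: "P 1" and gen: "\<And>g. g \<in> G \<Longrightarrow> P (gen g)"
    and mult: "\<And>x y. \<lbrakk>x \<in> carrier (free_algebra G); y \<in> carrier (free_algebra G); P x; P y\<rbrakk> \<Longrightarrow> P (x * y)"
    and add: "\<And>x y. \<lbrakk>x \<in> carrier (free_algebra G); y \<in> carrier (free_algebra G); P x; P y\<rbrakk> \<Longrightarrow> P (x + y)"
    and scale: "\<And>k x. \<lbrakk>x \<in> carrier (free_algebra G); P x\<rbrakk> \<Longrightarrow> P (cscale k x)"
  shows "P f"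
proof -
  have word: "Poly_Mapping.single (Free_Word ws) 1 \<in> carrier (free_algebra G) \<and> P (Poly_Mapping.single (Free_Word ws) 1)"
    if "set ws \<subseteq> G" for ws
    using that
  proof (induction ws)
    case Nil
    have "Poly_Mapping.single (Free_Word []) 1 = (1 :: 'a free_alg)"
      by (simp flip: single_one zero_free_word_def)
    then show ?case using one by (simp add: free_algebra_def)
  next
    case (Cons g ws)
    have "Poly_Mapping.single (Free_Word (g # ws)) 1 = gen g * Poly_Mapping.single (Free_Word ws) 1"
      by (simp add: gen_def mult_single plus_free_word_def)
    then show ?case using Cons by (auto intro!: mult gen free_algebra_closed(1) gen_closed)
  qed
  have "sum (\<lambda>w. cscale (Poly_Mapping.lookup f w) (Poly_Mapping.single w 1)) A \<in> carrier (free_algebra G)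
      \<and> P (sum (\<lambda>w. cscale (Poly_Mapping.lookup f w) (Poly_Mapping.single w 1)) A)"
    if "finite A" "A \<subseteq> Poly_Mapping.keys f" for A
    using that
  proof (induction A)
    case empty
    have "(1 :: 'a free_alg) \<in> carrier (free_algebra G)" by (simp add: free_algebra_def)
    from scale[OF this one, of 0] show ?case by (simp add: cscale_simps free_algebra_zero_closed)
  next
    case (insert w A)
    have "set (letters w) \<subseteq> G" using f insert.prems by (auto simp: free_algebra_def)
    from word[OF this] insert show ?case
      by (simp add: add scale free_algebra_add_closed cscale_closed del: cscale_simps(8))
  qed
  from this[of "Poly_Mapping.keys f"] show ?thesis by (simp add: cscale_simps sum_single_keys)
qed

lemma app_span:
  assumes "cvec.subspace weighted_E" "\<And>u. u \<in> D \<Longrightarrow> app A u \<in> weighted_E" "u \<in> cvec.span D"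
  shows "app A u \<in> weighted_E"
  using assms(3)
  by (induction rule: cvec.span_induct_alt)
    (simp_all add: app_linear assms(2) cvec.subspace_0[OF assms(1)] cvec.subspace_add[OF assms(1)] cvec.subspace_scale[OF assms(1)])

text \<open>\<open>P True\<close> plays the role of the odd part. With a constant family
  \<open>P\<close> the condition is invariance of a subspace, so one argument over the generators
  serves the grading, the carrier and the kernel alike.\<close>

definition graded_op :: "(bool \<Rightarrow> ('a \<Rightarrow>\<^sub>0 complex) set) \<Rightarrow> nat \<Rightarrow> 'a linop set" where
  "graded_op P e = {A. \<forall>d. \<forall>u\<in>P d. app A u \<in> P (d \<noteq> odd e)}"

lemma graded_op_cong: "even e \<longleftrightarrow> even e' \<Longrightarrow> graded_op P e = graded_op P e'"
  by (simp add: graded_op_def)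

lemma graded_op_mult: "A \<in> graded_op P e \<Longrightarrow> B \<in> graded_op P e' \<Longrightarrow> A * B \<in> graded_op P (e + e')"
  unfolding graded_op_def
proof (intro CollectI allI ballI)
  fix d u assume *: "A \<in> {A. \<forall>d. \<forall>u\<in>P d. app A u \<in> P (d \<noteq> odd e)}"
    "B \<in> {A. \<forall>d. \<forall>u\<in>P d. app A u \<in> P (d \<noteq> odd e')}" "u \<in> P d"
  then have "app A (app B u) \<in> P ((d \<noteq> odd e') \<noteq> odd e)" by blast
  moreover have "((d \<noteq> odd e') \<noteq> odd e) = (d \<noteq> odd (e + e'))" by auto
  ultimately show "app (A * B) u \<in> P (d \<noteq> odd (e + e'))" by simp
qed

context
  fixes P :: "bool \<Rightarrow> ('a \<Rightarrow>\<^sub>0 complex) set"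
  assumes P: "\<And>d. cvec.subspace (P d)"
begin

lemma graded_op_closed:
  "A \<in> graded_op P e \<Longrightarrow> B \<in> graded_op P e \<Longrightarrow> A + B \<in> graded_op P e"
  "A \<in> graded_op P e \<Longrightarrow> B \<in> graded_op P e \<Longrightarrow> A - B \<in> graded_op P e"
  "A \<in> graded_op P e \<Longrightarrow> smul k A \<in> graded_op P e" "1 \<in> graded_op P 0" "0 \<in> graded_op P e"
  using cvec.subspace_add[OF P] cvec.subspace_diff[OF P] cvec.subspace_scale[OF P] cvec.subspace_0[OF P]
  by (auto simp: graded_op_def)

lemma graded_op_sum: "(\<And>a. a \<in> D \<Longrightarrow> f a \<in> graded_op P e) \<Longrightarrow> sum f D \<in> graded_op P e"
  by (induction D rule: infinite_finite_induct) (simp_all add: graded_op_closed)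

lemma graded_op_scalar:
  "A \<in> graded_op P e \<Longrightarrow> (-1) ^ k * A \<in> graded_op P e" "A \<in> graded_op P e \<Longrightarrow> of_int z * A \<in> graded_op P e"
  "A \<in> graded_op P e \<Longrightarrow> - of_int z * A \<in> graded_op P e"
  using graded_op_closed(3)[of A e "(-1) ^ k"] graded_op_closed(3)[of A e "of_int z"]
    graded_op_closed(3)[of A e "of_int (- z)"] unfolding smul_sign smul_of_int by simp_all

end

lemma tensor_part_alt:
  "tensor_part m n p l (of_bool d) = {v. Poly_Mapping.keys v \<subseteq> {w \<in> words m n l. odd (sum_list (map (par m p) w)) = d}}"
  by (auto simp: tensor_part_def tensor_power_carrier odd_iff_mod_2_eq_one even_iff_mod_2_eq_zero of_bool_def split: if_splits)

lemma tensor_part_subspace: "cvec.subspace (tensor_part m n p l (of_bool d))"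
  unfolding tensor_part_alt by (rule free_space_subspace)

lemma E_op_part:
  assumes "v \<in> tensor_part m n p l (of_bool d)" "a \<in> {1..m + n}" "b \<in> {1..m + n}" "k \<in> {1..l}"
  shows "app (E_op m p a b k) v \<in> tensor_part m n p l (of_bool (d \<noteq> odd (par m p a + par m p b)))"
proof (rule app_span[OF tensor_part_subspace])
  show "v \<in> cvec.span ((\<lambda>w. Poly_Mapping.single w 1) ` {w \<in> words m n l. odd (sum_list (map (par m p) w)) = d})"
    using assms(1) by (simp add: tensor_part_alt flip: free_space_span)
  fix u :: tensor assume "u \<in> (\<lambda>w. Poly_Mapping.single w 1) ` {w \<in> words m n l. odd (sum_list (map (par m p) w)) = d}"
  then obtain w where w: "w \<in> words m n l" "odd (sum_list (map (par m p) w)) = d" "u = Poly_Mapping.single w 1" by blast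
  have k: "k - 1 < length w" using w(1) assms(4) by (auto simp: words_def)
  have "sum_list (map (par m p) (w[k - 1 := a])) + par m p (w ! (k - 1)) = sum_list (map (par m p) w) + par m p a"
    using k member_le_sum_list[of "par m p (w ! (k - 1))" "map (par m p) w"]
    by (simp add: map_update sum_list_update)
  then have "odd (sum_list (map (par m p) (w[k - 1 := a])) + par m p (w ! (k - 1))) = odd (sum_list (map (par m p) w) + par m p a)"
    by (rule arg_cong)
  then have "odd (sum_list (map (par m p) (w[k - 1 := a]))) = (d \<noteq> odd (par m p a + par m p (w ! (k - 1))))"
    using w(2) by auto
  then show "app (E_op m p a b k) u \<in> tensor_part m n p l (of_bool (d \<noteq> odd (par m p a + par m p b)))"
    using words_update[OF w(1) assms(2), of "k - 1"]
    by (auto simp: w(3) E_op_word tensor_part_alt simp del: odd_add even_add)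
qed

section \<open>Invariant subspaces of the action\<close>

context schur_weyl
begin

sublocale V: free_space_quotient "carrier M \<times> N" tensor_rels
proof
  show "tensor_rels \<subseteq> carrier (free_space (carrier M \<times> N))"
  proof
    have s: "Poly_Mapping.keys (Poly_Mapping.single (x, v) (k :: complex)) \<subseteq> carrier M \<times> N"
      if "x \<in> carrier M" "v \<in> N" for x v k using that by (intro single_keys_subset) auto
    have d: "Poly_Mapping.keys (f - g) \<subseteq> carrier M \<times> N"
      if "Poly_Mapping.keys f \<subseteq> carrier M \<times> N" "Poly_Mapping.keys g \<subseteq> carrier M \<times> N" for f g :: "('m \<times> tensor) \<Rightarrow>\<^sub>0 complex"
      using that keys_diff_subset[of f g] by blast
    have m: "x \<oplus>\<^bsub>M\<^esub> y \<in> carrier M" if "x \<in> carrier M" "y \<in> carrier M" for x y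
      using that abelian_monoid.a_closed[OF abelian_group.axioms(1)[OF module.axioms(2)[OF vector_space]]] by blast
    have perm: "lin_ext dperm r \<in> FA" "perm_algebra_act m p l r v \<in> N" if "r \<in> perm_algebra l" "v \<in> N" for r v
      using that unfolding lin_ext_def perm_algebra_act_def perm_act_op
      by (auto simp: perm_algebra_def intro!: free_algebra_sum_closed cscale_closed FA_perm tensor_power_sum_closed tensor_power_closed(3) perm_op_closed)
    fix u assume "u \<in> tensor_rels"
    from this[unfolded tensor_rels_def] show "u \<in> carrier (free_space (carrier M \<times> N))"
    proof cases
      case (balanced x r v)
      have "act x (perm_to_daha l t c r) \<in> carrier M"
        using ract_closed[OF balanced(2) perm(1)[OF balanced(3,4)]] by (simp add: ract_def perm_to_daha_def)
      then show ?thesis unfolding balanced(1) free_space_simps mem_Collect_eq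
        by (intro d s balanced perm(2))
    qed (simp only: free_space_simps mem_Collect_eq; intro d s; simp add: m N_simps tensor_power_closed)+
  qed
qed

lemma single_Fr: "x \<in> carrier M \<Longrightarrow> v \<in> N \<Longrightarrow> Poly_Mapping.single (x, v) k \<in> V.Fr"
  by (simp add: single_keys_subset)

lemma single_tau: "Poly_Mapping.single (x, v) 1 - tau x v \<in> V.K"
  by (rule proj(2)) simp

text \<open>The formal tensor and its projection differ by a combination of relations, so a subspace
  containing the relations cannot tell them apart.\<close>

lemma tau_in_subspace:
  fixes D :: "(('m \<times> tensor) \<Rightarrow>\<^sub>0 complex) set"
  assumes "cvec.subspace D" "tensor_rels \<subseteq> D" "Poly_Mapping.single (x, v) 1 \<in> D"
  shows "tau x v \<in> D"
proof -
  have "Poly_Mapping.single (x, v) 1 - (Poly_Mapping.single (x, v) 1 - tau x v) \<in> D"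
    by (rule cvec.subspace_diff[OF assms(1,3) subsetD[OF cvec.span_minimal[OF assms(2,1)] single_tau]])
  then show ?thesis by simp
qed

lemma good_kernel: "A \<in> good \<Longrightarrow> u \<in> V.K \<Longrightarrow> app A u = 0"
proof -
  assume "A \<in> good" "u \<in> V.K"
  then have "A * proj V.K = A" "app (proj V.K) u = 0" by (simp_all add: good_def proj_span_iff)
  then show ?thesis using app_simps(6)[of A "proj V.K" u] by simp
qed

definition gens :: "bool \<Rightarrow> (('m \<times> tensor) \<Rightarrow>\<^sub>0 complex) set" where
  "gens d = {Poly_Mapping.single (x, v) 1 | x v. x \<in> carrier M \<and> v \<in> tensor_part m n p l (of_bool d)}"

text \<open>The formal combinations whose cosets form the component of parity \<open>d\<close>;
  including the relations allows the grading to be handled upstairs.\<close>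

definition grad :: "bool \<Rightarrow> (('m \<times> tensor) \<Rightarrow>\<^sub>0 complex) set" where
  "grad d = cvec.span (gens d \<union> tensor_rels)"

lemma grad_subspace: "cvec.subspace (grad d)" and tensor_rels_grad: "tensor_rels \<subseteq> grad d"
  by (auto simp: grad_def cvec.span_base)

lemma tensor_part_N: "v \<in> tensor_part m n p l a \<Longrightarrow> v \<in> N"
  by (simp add: tensor_part_def)

lemma tau_grad: "x \<in> carrier M \<Longrightarrow> v \<in> tensor_part m n p l (of_bool d) \<Longrightarrow> tau x v \<in> grad d"
  unfolding grad_def by (rule tau_in_subspace, simp, simp add: cvec.span_base subsetI, rule cvec.span_base) (unfold gens_def, blast)

text \<open>Either operator maps a pure tensor to a sum of tensors whose second entries are images
  under a single matrix unit, and a matrix unit shifts the parity of a word by that of its two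
  indices.\<close>

lemma graded_EJ_act:
  assumes a: "a \<in> {1..m + n}" and b: "b \<in> {1..m + n}"
  shows "E_act a b \<in> graded_op grad (par m p a + par m p b)" "J_act a b \<in> graded_op grad (par m p a + par m p b)"
proof -
  have *: "A \<in> graded_op grad (par m p a + par m p b)"
    if A: "A \<in> good" and img: "\<And>x v. x \<in> carrier M \<Longrightarrow> v \<in> N \<Longrightarrow> app A (tau x v) = (\<Sum>k = 1..l. tau (f x k) (app (Eop a b k) v))"
      and f: "\<And>x k. x \<in> carrier M \<Longrightarrow> k \<in> {1..l} \<Longrightarrow> f x k \<in> carrier M" for A f
    unfolding graded_op_def
  proof (intro CollectI allI ballI)
    fix d u assume u: "u \<in> grad d"
    show "app A u \<in> grad (d \<noteq> odd (par m p a + par m p b))"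
    proof (rule app_span[OF grad_subspace _ u[unfolded grad_def]])
      fix u assume "u \<in> gens d \<union> tensor_rels"
      then show "app A u \<in> grad (d \<noteq> odd (par m p a + par m p b))"
      proof
        assume "u \<in> gens d"
        then obtain x v where xv: "x \<in> carrier M" "v \<in> tensor_part m n p l (of_bool d)" "u = Poly_Mapping.single (x, v) 1"
          by (auto simp: gens_def)
        show ?thesis
          unfolding xv(3) good_tau[OF A, symmetric] img[OF xv(1) tensor_part_N[OF xv(2)]]
          by (intro cvec.subspace_sum[OF grad_subspace] tau_grad f xv(1) E_op_part[OF xv(2) a b])
      next
        assume "u \<in> tensor_rels"
        then show ?thesis
          using good_kernel[OF A] by (simp add: cvec.span_base cvec.subspace_0[OF grad_subspace])
      qed
    qed
  qed
  show "E_act a b \<in> graded_op grad (par m p a + par m p b)"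
    by (rule *[OF E_act_good, of _ _ "\<lambda>x _. x"])
      (use a in \<open>simp_all add: E_act_tau E_tot_op app_sum_left tau_sum_right Eop_closed\<close>)
  show "J_act a b \<in> graded_op grad (par m p a + par m p b)"
    by (rule *[OF J_act_good, of _ _ "\<lambda>x k. ract x (frak_y l t c k)"]) (use a in \<open>simp_all add: J_act_tau\<close>)
qed

lemma const_EJ_act:
  assumes a: "a \<in> {1..m + n}"
  shows "E_act a b \<in> graded_op (\<lambda>_. V.Fr) e" "J_act a b \<in> graded_op (\<lambda>_. V.Fr) e"
    "E_act a b \<in> graded_op (\<lambda>_. V.K) e" "J_act a b \<in> graded_op (\<lambda>_. V.K) e"
proof -
  have tF: "tau x v \<in> V.Fr" if "x \<in> carrier M" "v \<in> N" for x v
    by (rule tau_in_subspace) (use that V.rel_closed in \<open>auto simp: free_space_subspace intro!: single_keys_subset\<close>)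
  have *: "A \<in> graded_op (\<lambda>_. V.Fr) e"
    if A: "A \<in> good" and img: "\<And>x v. x \<in> carrier M \<Longrightarrow> v \<in> N \<Longrightarrow> app A (tau x v) \<in> V.Fr" for A
    unfolding graded_op_def free_space_simps
  proof (rule CollectI, rule allI, rule ballI)
    fix u :: "('m \<times> tensor) \<Rightarrow>\<^sub>0 complex" assume u: "u \<in> {f. Poly_Mapping.keys f \<subseteq> carrier M \<times> N}"
    show "app A u \<in> {f. Poly_Mapping.keys f \<subseteq> carrier M \<times> N}"
      by (rule app_span[OF free_space_subspace _ u[unfolded free_space_span]])
        (use img good_tau[OF A] in \<open>auto simp del: mem_Collect_eq simp: free_space_simps\<close>)
  qed
  show "E_act a b \<in> graded_op (\<lambda>_. V.Fr) e"
    by (rule *[OF E_act_good]) (use a in \<open>simp only: E_act_tau tF E_tot_closed\<close>)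
  show "J_act a b \<in> graded_op (\<lambda>_. V.Fr) e"
    by (rule *[OF J_act_good]) (simp only: J_act_tau a, rule V.Fr_sum, rule tF, simp, rule Eop_closed[OF a])
  show "E_act a b \<in> graded_op (\<lambda>_. V.K) e" "J_act a b \<in> graded_op (\<lambda>_. V.K) e"
    using good_kernel[OF E_act_good] good_kernel[OF J_act_good] by (simp_all add: graded_op_def cvec.span_zero)
qed

section \<open>Parity of the images of the generators\<close>

context
  fixes P :: "bool \<Rightarrow> (('m \<times> tensor) \<Rightarrow>\<^sub>0 complex) set"
  assumes P: "\<And>d. cvec.subspace (P d)"
    and E: "\<And>a b. a \<in> {1..m + n} \<Longrightarrow> b \<in> {1..m + n} \<Longrightarrow> E_act a b \<in> graded_op P (par m p a + par m p b)"
    and J: "\<And>a b. a \<in> {1..m + n} \<Longrightarrow> b \<in> {1..m + n} \<Longrightarrow> J_act a b \<in> graded_op P (par m p a + par m p b)"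
begin

lemmas graded = graded_op_closed[OF P] graded_op_sum[OF P] graded_op_scalar[OF P]

lemma graded_diag:
  assumes "a \<in> {1..m + n}"
  shows "E_act a a \<in> graded_op P 0" "J_act a a \<in> graded_op P 0"
  using E[OF assms assms] J[OF assms assms] graded_op_cong[of "par m p a + par m p a" 0 P] by simp_all

lemma graded_outer:
  assumes "a \<in> {1..m + n}" "b \<in> {1..m + n}"
  shows "gl.outer i D a b \<in> graded_op P (par m p a + par m p b)"
  unfolding gl.outer_def
proof (rule graded(6))
  fix k assume "k \<in> {1..m + n} - D"
  then have k: "k \<in> {1..m + n}" by simp
  have "E_act a k * E_act k b \<in> graded_op P (par m p a + par m p b)"
    using graded_op_mult[OF E[OF assms(1) k] E[OF k assms(2)]] by (subst graded_op_cong) auto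
  then show "gl.sg k * of_int (sgn (int k - int i)) * (E_act a k * E_act k b) \<in> graded_op P (par m p a + par m p b)"
    unfolding gl.sg_def mult.assoc by (intro graded)
qed

lemma graded_gen_op:
  assumes "g \<in> ygens m n"
  shows "gen_op g \<in> graded_op P (Ypar g)"
proof -
  have *: "gen_op (YX e i r) \<in> graded_op P (gl.pt i) \<and> gen_op (YH i r) \<in> graded_op P 0"
    if "i \<in> {1..m + n - 1}" for e i r
  proof -
    have i: "i \<in> {1..m + n}" "i + 1 \<in> {1..m + n}" using node_range[OF that] by auto
    have pt: "graded_op P (par m p i + par m p (i + 1)) = graded_op P (gl.pt i)"
      "graded_op P (par m p (i + 1) + par m p i) = graded_op P (gl.pt i)"
      by (rule graded_op_cong; simp add: gl.pt_def par_def)+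
    have h: "gl.h i \<in> graded_op P 0" unfolding gl.h_def gl.sg_def by (intro graded graded_diag i)
    note o = graded_outer[OF i(1) i(2), unfolded pt] graded_outer[OF i(2) i(1), unfolded pt]
      graded_outer[OF i(1) i(1)] graded_outer[OF i(2) i(2)]
    have o0: "gl.outer j D i i \<in> graded_op P 0" "gl.outer j D (i + 1) (i + 1) \<in> graded_op P 0" for j D
      using o(3,4) by (simp_all add: graded_op_cong[of "x + x" 0 for x])
    have hh: "A \<in> graded_op P q \<Longrightarrow> gl.h i * A \<in> graded_op P q" "A \<in> graded_op P q \<Longrightarrow> A * gl.h i \<in> graded_op P q" for A q
      using graded_op_mult[OF h, of A q] graded_op_mult[OF _ h, of A q] by simp_all
    note e = E[OF i(1) i(2), unfolded pt] E[OF i(2) i(1), unfolded pt] J[OF i(1) i(2), unfolded pt] J[OF i(2) i(1), unfolded pt]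
    have xp: "gl.xp i \<in> graded_op P (gl.pt i)" "gl.xm i \<in> graded_op P (gl.pt i)"
      "gl.jp i \<in> graded_op P (gl.pt i)" "gl.jm i \<in> graded_op P (gl.pt i)"
      unfolding gl.xp_def gl.xm_def gl.jp_def gl.jm_def gl.sg_def by (intro graded e)+
    have "gl.wp2 i \<in> graded_op P (gl.pt i)" "gl.wm2 i \<in> graded_op P (gl.pt i)"
      unfolding gl.wp2_def gl.wm2_def gl.sg_def by (intro graded e o hh)+
    moreover have "Ht i \<in> graded_op P 0"
      unfolding Ht_def gl.jh_def gl.th2_def gl.sg_def by (intro graded graded_diag i o0 h)
    ultimately show ?thesis
      using xp h by (cases e) (auto intro!: graded hh)
  qed
  from assms show ?thesis using * by (auto simp: ygens_def gl.pt_def simp del: gen_op.simps)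
qed

lemma graded_word:
  assumes "set ws \<subseteq> ygens m n"
  shows "prod_list (map gen_op ws) \<in> graded_op P (sum_list (map Ypar ws))"
  using assms by (induction ws) (simp_all add: graded graded_op_mult graded_gen_op)

lemma graded_ev:
  assumes "f \<in> carrier (free_algebra (ygens m n))" "\<And>w. w \<in> Poly_Mapping.keys f \<Longrightarrow> graded_op P (word_parity Ypar w) \<subseteq> graded_op P a"
  shows "evp f \<in> graded_op P a"
  unfolding ev_def
proof (intro graded)
  fix w assume w: "w \<in> Poly_Mapping.keys f"
  have "prod_list (map gen_op (letters w)) \<in> graded_op P (word_parity Ypar w)"
    using graded_word[of "letters w"] assms(1) w graded_op_cong[of "word_parity Ypar w" "sum_list (map Ypar (letters w))" P]
    by (auto simp: free_algebra_def word_parity_def)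
  then show "prod_list (map gen_op (letters w)) \<in> graded_op P a" using assms(2)[OF w] by blast
qed

end

text \<open>Constant families make the parity condition trivial, so elements that are not
  homogeneous are covered too.\<close>

lemma evp_closed:
  assumes "f \<in> carrier (free_algebra (ygens m n))"
  shows "u \<in> V.Fr \<Longrightarrow> app (evp f) u \<in> V.Fr" "u \<in> V.K \<Longrightarrow> app (evp f) u \<in> V.K"
proof -
  have "evp f \<in> graded_op (\<lambda>_. V.Fr) 0"
    by (rule graded_ev[OF _ const_EJ_act(1,2) assms]) (simp_all add: free_space_subspace graded_op_def)
  moreover have "evp f \<in> graded_op (\<lambda>_. V.K) 0"
    by (rule graded_ev[OF _ const_EJ_act(3,4) assms]) (simp_all add: graded_op_def)
  ultimately show "u \<in> V.Fr \<Longrightarrow> app (evp f) u \<in> V.Fr" "u \<in> V.K \<Longrightarrow> app (evp f) u \<in> V.K"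
    by (auto simp: graded_op_def simp del: free_space_simps)
qed

lemma evp_grad:
  assumes "f \<in> carrier (free_algebra (ygens m n)) \<inter> homogeneous Ypar a" "u \<in> grad d"
  shows "app (evp f) u \<in> grad (d \<noteq> odd a)"
proof -
  have "evp f \<in> graded_op grad a"
    using assms(1) by (intro graded_ev grad_subspace graded_EJ_act) (auto simp: homogeneous_def)
  then show ?thesis using assms(2) by (auto simp: graded_op_def)
qed

end

section \<open>The action and its uniqueness\<close>

context
  fixes D :: "ygen free_alg set" and m n p :: nat
  assumes add: "\<And>f g. f \<in> D \<Longrightarrow> g \<in> D \<Longrightarrow> f + g \<in> D" and mult: "\<And>f g. f \<in> D \<Longrightarrow> g \<in> D \<Longrightarrow> f * g \<in> D"
    and scale: "\<And>k f. f \<in> D \<Longrightarrow> cscale k f \<in> D" and zero: "0 \<in> D"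
    and H0: "\<And>i. i \<in> {1..m + n - 1} \<Longrightarrow> yH i 0 \<in> D" and X0: "\<And>e i. i \<in> {1..m + n - 1} \<Longrightarrow> yX e i 0 \<in> D"
begin

lemma subalgebra_diff: "f \<in> D \<Longrightarrow> g \<in> D \<Longrightarrow> f - g \<in> D"
  using add[of f "cscale (-1) g"] scale[of g "-1"] by (simp add: cscale_simps)

lemma subalgebra_sum: "(\<And>a. a \<in> A \<Longrightarrow> h a \<in> D) \<Longrightarrow> sum h A \<in> D"
  by (induction A rule: infinite_finite_induct) (simp_all add: zero add)

lemma subalgebra_supercomm:
  "f \<in> D \<Longrightarrow> g \<in> D \<Longrightarrow> f \<in> homogeneous \<pi> a \<Longrightarrow> g \<in> homogeneous \<pi> b \<Longrightarrow> supercomm \<pi> f g \<in> D"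
  by (simp add: supercomm_homogeneous subalgebra_diff mult scale)

lemma subalgebra_yE:
  assumes "i \<in> {1..m + n}" "j \<in> {1..m + n}" "i \<noteq> j"
  shows "yE m p i j \<in> D"
proof -
  have X_hom: "yX e i 0 \<in> homogeneous (ygen_parity m p) (ygen_parity m p (YX e i 0) mod 2)" for e i
    by (rule gen_homogeneous)
  have up: "yE_up m p i d \<in> D" if "1 \<le> i" "i + d + 1 \<le> m + n" for i d
    using that
  proof (induction d)
    case (Suc d)
    then have d: "i + d + 1 \<in> {1..m + n - 1}" "i + d + 1 \<le> m + n" by auto
    show ?case
      using subalgebra_supercomm[OF Suc.IH[OF Suc.prems(1) d(2)] X0[OF d(1)] IntD2[OF yE_up_props[OF Suc.prems(1) d(2)]] X_hom]
      by simp
  qed (simp add: X0)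
  have down: "yE_down m p i d \<in> D" if "1 \<le> i" "i + d + 1 \<le> m + n" for i d
    using that
  proof (induction d)
    case (Suc d)
    then have d: "i + d + 1 \<in> {1..m + n - 1}" "i + d + 1 \<le> m + n" by auto
    show ?case
      using subalgebra_supercomm[OF scale[OF X0[OF d(1)]] Suc.IH[OF Suc.prems(1) d(2)] homogeneous_cscale[OF X_hom]
          IntD2[OF yE_down_props[OF Suc.prems(1) d(2)]]]
      by simp
  qed (simp add: X0 scale)
  show ?thesis
    using assms up[of i "j - i - 1"] down[of j "i - j - 1"] by (auto simp: yE_def)
qed

lemma subalgebra_vartheta:
  assumes "i \<in> {1..m + n - 1}"
  shows "vartheta m n p i \<in> D" "varpi_plus m n p i \<in> D" "varpi_minus m n p i \<in> D"
proof -
  have i: "i \<in> {1..m + n}" "i + 1 \<in> {1..m + n}" using assms by auto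
  show "vartheta m n p i \<in> D" "varpi_plus m n p i \<in> D" "varpi_minus m n p i \<in> D"
    unfolding vartheta_def varpi_plus_def varpi_minus_def
    by (intro add subalgebra_diff scale mult subalgebra_sum subalgebra_yE H0[OF assms] X0[OF assms]; use i in auto)+
qed

text \<open>Applied to two choices of \<open>D\<close>: the whole free algebra on the generators,
  which shows that the elements J lie in it, and the set on which two given actions agree.\<close>

lemma subalgebra_J:
  assumes i: "i \<in> {1..m + n - 1}"
  shows "yH i 1 \<in> D \<longleftrightarrow> J_h m n p c i \<in> D"
    and "yX Plus i 1 \<in> D \<longleftrightarrow> J_x_plus m n p c i \<in> D" and "yX Minus i 1 \<in> D \<longleftrightarrow> J_x_minus m n p c i \<in> D"
proof -
  have shift: "f \<in> D \<longleftrightarrow> f + g \<in> D" if "g \<in> D" for f g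
    using add[of f g] subalgebra_diff[of "f + g" g] that by auto
  have "J_h m n p c i = yH i 1 + (cscale c (vartheta m n p i) - cscale (c / 2) (yH i 0 * yH i 0))"
    by (simp add: J_h_def yH_tilde_def)
  then show "yH i 1 \<in> D \<longleftrightarrow> J_h m n p c i \<in> D"
    using shift[OF subalgebra_diff[OF scale[OF subalgebra_vartheta(1)[OF i]] scale[OF mult[OF H0[OF i] H0[OF i]]]]] by simp
  show "yX Plus i 1 \<in> D \<longleftrightarrow> J_x_plus m n p c i \<in> D" "yX Minus i 1 \<in> D \<longleftrightarrow> J_x_minus m n p c i \<in> D"
    unfolding J_x_plus_def J_x_minus_def by (intro shift scale subalgebra_vartheta i)+
qed

end

section \<open>The action on the tensor product\<close>

context schur_weyl
begin

abbreviation "YF \<equiv> carrier (free_algebra (ygens m n))"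
abbreviation "Y \<equiv> yangian m n p c"
abbreviation "ycl \<equiv> yangian_class m n p c"

lemma SW_space_eq: "SW_space m n p l t c M act = V.Q"
  by (simp add: SW_space_def tensor_space_def tensor_kernel_def lin_span_free_space[OF V.rel_closed] flip: tensor_rels_def)

lemma SW_tensor_eq: "SW_tensor m n p l t c M act x v = V.coset (Poly_Mapping.single (x, v) 1)"
  by (simp add: SW_tensor_def pure_tensor_def tensor_kernel_def lin_span_free_space[OF V.rel_closed] V.coset_def flip: tensor_rels_def)

lemma SW_part_eq: "SW_part m n p l t c M act (of_bool d) = V.coset ` grad d"
proof -
  have "gens d \<subseteq> V.Fr" by (auto simp: gens_def dest!: tensor_part_N)
  moreover have "{V.coset (Poly_Mapping.single (x, v) 1) | x v. x \<in> carrier M \<and> v \<in> tensor_part m n p l (of_bool d)} = V.coset ` gens d"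
    unfolding gens_def by blast
  ultimately show ?thesis
    by (simp only: SW_part_def SW_space_eq SW_tensor_eq grad_def V.lin_span_Q)
qed

lemma coset_tau: "V.coset (Poly_Mapping.single (x, v) 1) = V.coset (tau x v)"
  by (simp only: V.coset_eq_iff single_tau)

lemma ycl_hom: "ring_hom_ring (free_algebra (ygens m n)) Y ycl"
  using presented_algebra_ring_hom[OF yangian_rel_closed] by (simp add: yangian_def yangian_class_def)

lemma ycl_add_mult: "f \<in> YF \<Longrightarrow> g \<in> YF \<Longrightarrow> ycl f \<oplus>\<^bsub>Y\<^esub> ycl g = ycl (f + g)"
    "f \<in> YF \<Longrightarrow> g \<in> YF \<Longrightarrow> ycl f \<otimes>\<^bsub>Y\<^esub> ycl g = ycl (f * g)"
  and ycl_one: "\<one>\<^bsub>Y\<^esub> = ycl 1" and ycl_closed: "f \<in> YF \<Longrightarrow> ycl f \<in> carrier Y"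
proof -
  interpret h: ring_hom_ring "free_algebra (ygens m n)" Y ycl by (rule ycl_hom)
  show "f \<in> YF \<Longrightarrow> g \<in> YF \<Longrightarrow> ycl f \<oplus>\<^bsub>Y\<^esub> ycl g = ycl (f + g)"
    "f \<in> YF \<Longrightarrow> g \<in> YF \<Longrightarrow> ycl f \<otimes>\<^bsub>Y\<^esub> ycl g = ycl (f * g)" "\<one>\<^bsub>Y\<^esub> = ycl 1" "f \<in> YF \<Longrightarrow> ycl f \<in> carrier Y"
    using h.hom_add[of f g] h.hom_mult[of f g] h.hom_one h.hom_closed[of f] by simp_all
qed

lemma ycl_scale: "f \<in> YF \<Longrightarrow> k \<odot>\<^bsub>Y\<^esub> ycl f = ycl (cscale k f)"
  using presented_class_cscale[OF yangian_rel_closed] by (simp add: yangian_def yangian_class_def)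

lemma YE:
  assumes "y \<in> carrier Y"
  obtains f where "f \<in> YF" "y = ycl f"
  using assms unfolding yangian_def presented_algebra_def quot_module_simps FactRing_def
    A_RCOSETS_def' yangian_class_def presented_class_def by auto

lemma YF_closed: "0 \<in> YF" "1 \<in> YF" "f \<in> YF \<Longrightarrow> g \<in> YF \<Longrightarrow> f + g \<in> YF" "f \<in> YF \<Longrightarrow> g \<in> YF \<Longrightarrow> f * g \<in> YF" "f \<in> YF \<Longrightarrow> cscale k f \<in> YF"
    "f \<in> YF \<Longrightarrow> g \<in> YF \<Longrightarrow> f - g \<in> YF"
  by (simp_all add: free_algebra_zero_closed free_algebra_add_closed free_algebra_closed cscale_closed)
    (simp add: free_algebra_def)

lemma YF_gens:
  assumes "i \<in> {1..m + n - 1}"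
  shows "yH i 0 \<in> YF" "yX e i 0 \<in> YF" "yH i 1 \<in> YF" "yX e i 1 \<in> YF"
  using assms by (auto simp: ygens_def)

lemma YF_J:
  assumes "i \<in> {1..m + n - 1}"
  shows "J_h m n p c i \<in> YF" "J_x_plus m n p c i \<in> YF" "J_x_minus m n p c i \<in> YF"
proof -
  note J = subalgebra_J[of YF m n, OF YF_closed(3,4,5,1) YF_gens(1,2) assms, of p c]
  show "J_h m n p c i \<in> YF" "J_x_plus m n p c i \<in> YF" "J_x_minus m n p c i \<in> YF"
    using J YF_gens(3,4)[OF assms] by blast+
qed

context
  assumes m: "2 \<le> m"
begin

text \<open>The kernel of the evaluation is an ideal that contains the defining relations, hence
  also the ideal they generate.\<close>

lemma evp_cong:
  assumes "f \<in> YF" "g \<in> YF" "ycl f = ycl g"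
  shows "evp f = evp g"
proof -
  let ?F = "free_algebra (ygens m n)" and ?I = "{f \<in> YF. evp f = 0}"
  interpret F: ring ?F by (rule free_algebra_ring)
  have neg: "\<ominus>\<^bsub>?F\<^esub> x = - x" "- x \<in> YF" if "x \<in> YF" for x
  proof -
    show *: "- x \<in> YF" using YF_closed(5)[OF that, of "-1"] by (simp add: cscale_simps)
    show "\<ominus>\<^bsub>?F\<^esub> x = - x" using that * by (intro F.minus_equality) simp_all
  qed
  have "ideal ?I ?F"
  proof (rule idealI[OF free_algebra_ring])
    show "subgroup ?I (add_monoid ?F)"
      by (rule F.add.subgroupI) (use YF_closed neg in auto)
  qed (use YF_closed in auto)
  then have "genideal ?F (yangian_rel m n p c) \<subseteq> ?I"
    using evp_rel[OF m] yangian_rel_closed[of m n p c] by (intro F.genideal_minimal) auto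
  moreover interpret J: ideal "genideal ?F (yangian_rel m n p c)" ?F
    by (rule F.genideal_ideal[OF yangian_rel_closed])
  have "f \<in> genideal ?F (yangian_rel m n p c) +>\<^bsub>?F\<^esub> g"
    using J.a_rcos_self[OF assms(1)] assms(3) by (simp add: yangian_class_def presented_class_def)
  then obtain h where "h \<in> genideal ?F (yangian_rel m n p c)" "f = h + g"
    by (auto simp: a_r_coset_def')
  ultimately show ?thesis by auto
qed

text \<open>Classes are evaluated at chosen representatives; \<open>rho_coset\<close> shows that the
  choice does not matter. Restriction to the carriers makes the function extensional, as uniqueness
  demands.\<close>

definition rho :: "ygen free_alg set \<Rightarrow> (('m \<times> tensor) \<Rightarrow>\<^sub>0 complex) set \<Rightarrow> (('m \<times> tensor) \<Rightarrow>\<^sub>0 complex) set" where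
  "rho = (\<lambda>y\<in>carrier Y. \<lambda>x\<in>carrier V.Q.
     V.coset (app (evp (SOME f. f \<in> YF \<and> ycl f = y)) (SOME u. u \<in> V.Fr \<and> V.coset u = x)))"

lemma rho_coset:
  assumes "f \<in> YF" "u \<in> V.Fr"
  shows "rho (ycl f) (V.coset u) = V.coset (app (evp f) u)"
proof -
  define g where "g = (SOME g. g \<in> YF \<and> ycl g = ycl f)"
  define v where "v = (SOME v. v \<in> V.Fr \<and> V.coset v = V.coset u)"
  have g: "g \<in> YF \<and> ycl g = ycl f" unfolding g_def by (rule someI[of _ f]) (simp add: assms)
  have v: "v \<in> V.Fr \<and> V.coset v = V.coset u" unfolding v_def by (rule someI[of _ u]) (use assms in blast)
  have "app (evp f) (v - u) \<in> V.K"
    using v evp_closed(2)[OF assms(1)] by (simp add: V.coset_eq_iff del: free_space_simps)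
  then have "V.coset (app (evp f) v) = V.coset (app (evp f) u)"
    by (simp add: V.coset_eq_iff app_diff)
  moreover have "evp g = evp f" using g assms by (intro evp_cong) auto
  ultimately show ?thesis
    using assms ycl_closed[OF assms(1)] V.coset_in_carrier[OF assms(2)]
    by (simp add: rho_def del: free_space_simps flip: g_def v_def)
qed

lemma rho_funcset: "rho \<in> carrier Y \<rightarrow>\<^sub>E (carrier V.Q \<rightarrow>\<^sub>E carrier V.Q)"
proof (rule PiE_I)
  fix y assume y: "y \<in> carrier Y"
  then obtain f where f: "f \<in> YF" "y = ycl f" by (rule YE)
  show "rho y \<in> carrier V.Q \<rightarrow>\<^sub>E carrier V.Q"
  proof (rule PiE_I)
    fix x assume "x \<in> carrier V.Q"
    then obtain u where u: "u \<in> V.Fr" "x = V.coset u" by (rule V.carrier_QE)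
    show "rho y x \<in> carrier V.Q"
      unfolding f(2) u(2) rho_coset[OF f(1) u(1)] by (intro V.coset_in_carrier evp_closed f u)
  qed (simp add: rho_def y)
qed (simp add: rho_def)

lemma rho_module: "left_algebra_module Y V.Q rho"
proof (rule left_algebra_module.intro[OF V.Q_module])
  note r = rho_coset V.coset_add V.coset_smult
  have YQ: "thesis" if "y \<in> carrier Y" "x \<in> carrier V.Q"
    "\<And>f u. f \<in> YF \<Longrightarrow> u \<in> V.Fr \<Longrightarrow> y = ycl f \<Longrightarrow> x = V.coset u \<Longrightarrow> thesis" for y x thesis
    using that by (elim YE V.carrier_QE) blast
  fix y z x x' and k :: complex
  assume y: "y \<in> carrier Y" and x: "x \<in> carrier V.Q"
  then obtain f u where f: "f \<in> YF" "y = ycl f" and u: "u \<in> V.Fr" "x = V.coset u" by (rule YQ)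
  show "rho y x \<in> carrier V.Q"
    unfolding f(2) u(2) rho_coset[OF f(1) u(1)] by (intro V.coset_in_carrier evp_closed f u)
  show "rho y (k \<odot>\<^bsub>V.Q\<^esub> x) = k \<odot>\<^bsub>V.Q\<^esub> rho y x"
    unfolding f(2) u(2) V.coset_smult rho_coset[OF f(1) u(1)] rho_coset[OF f(1) V.Fr_closed(4)[OF u(1)]] app_linear ..
  show "rho (k \<odot>\<^bsub>Y\<^esub> y) x = k \<odot>\<^bsub>V.Q\<^esub> rho y x"
    unfolding f(2) u(2) ycl_scale[OF f(1)] V.coset_smult rho_coset[OF f(1) u(1)] rho_coset[OF YF_closed(5)[OF f(1)] u(1)] by simp
  {
    assume "x' \<in> carrier V.Q"
    with y obtain u' where u': "u' \<in> V.Fr" "x' = V.coset u'" by (rule YQ)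
    show "rho y (x \<oplus>\<^bsub>V.Q\<^esub> x') = rho y x \<oplus>\<^bsub>V.Q\<^esub> rho y x'"
      unfolding f(2) u(2) u'(2) V.coset_add rho_coset[OF f(1) u(1)] rho_coset[OF f(1) u'(1)]
        rho_coset[OF f(1) V.Fr_closed(2)[OF u(1) u'(1)]] app_linear ..
  }
  assume "z \<in> carrier Y"
  then obtain g where g: "g \<in> YF" "z = ycl g" by (rule YE)
  show "rho (y \<oplus>\<^bsub>Y\<^esub> z) x = rho y x \<oplus>\<^bsub>V.Q\<^esub> rho z x"
    unfolding f(2) u(2) g(2) V.coset_add ycl_add_mult(1)[OF f(1) g(1)] rho_coset[OF f(1) u(1)] rho_coset[OF g(1) u(1)]
      rho_coset[OF YF_closed(3)[OF f(1) g(1)] u(1)] by simp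
  show "rho (y \<otimes>\<^bsub>Y\<^esub> z) x = rho y (rho z x)"
    unfolding f(2) u(2) g(2) ycl_add_mult(2)[OF f(1) g(1)] rho_coset[OF g(1) u(1)] rho_coset[OF f(1) evp_closed(1)[OF g(1) u(1)]]
      rho_coset[OF YF_closed(4)[OF f(1) g(1)] u(1)] by simp
next
  fix x assume "x \<in> carrier V.Q"
  then obtain u where u: "u \<in> V.Fr" "x = V.coset u" by (rule V.carrier_QE)
  show "rho \<one>\<^bsub>Y\<^esub> x = x"
    unfolding u(2) ycl_one rho_coset[OF YF_closed(2) u(1)] by simp
qed

lemma rho_supermodule:
  "left_superalgebra_module Y (yangian_part m n p c) V.Q (SW_part m n p l t c M act) rho"
proof (intro left_superalgebra_module.intro left_superalgebra_module_axioms.intro rho_module)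
  fix a b y v assume "a < (2 :: nat)" and b: "b < (2 :: nat)" and y: "y \<in> yangian_part m n p c a"
    and v: "v \<in> SW_part m n p l t c M act b"
  have "b = of_bool (b = 1)" using b by auto
  then obtain d where d: "b = of_bool d" by blast
  obtain f where f: "f \<in> YF \<inter> homogeneous Ypar a" "y = ycl f" using y by (auto simp: yangian_part_def)
  obtain u where u: "u \<in> grad d" "v = V.coset u" using v unfolding d SW_part_eq by blast
  have "grad d \<subseteq> V.Fr"
    unfolding grad_def using V.rel_closed
    by (intro cvec.span_minimal) (auto simp: free_space_subspace gens_def dest!: tensor_part_N)
  with u have "u \<in> V.Fr" by blast
  then have "rho y v \<in> SW_part m n p l t c M act (of_bool (d \<noteq> odd a))"
    unfolding SW_part_eq f(2) u(2) using f(1) evp_grad[OF f(1) u(1)] by (subst rho_coset) auto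
  moreover have "of_bool (d \<noteq> odd a) = (a + b) mod 2" by (auto simp: d mod2_eq_if)
  ultimately show "rho y v \<in> SW_part m n p l t c M act ((a + b) mod 2)" by simp
qed

lemma rho_tensor:
  assumes "f \<in> YF" "evp f \<in> good" "x \<in> carrier M" "v \<in> N"
  shows "rho (ycl f) (V.coset (Poly_Mapping.single (x, v) 1)) = V.coset (app (evp f) (tau x v))"
  using assms by (simp add: rho_coset good_tau single_Fr del: free_space_simps)

lemma rho_formulas:
  assumes i: "i \<in> {1..m + n - 1}" and x: "x \<in> carrier M" and v: "v \<in> N"
  defines "tens \<equiv> SW_tensor m n p l t c M act"
  shows "rho (ycl (yH i 0)) (tens x v) = tens x (cscale (psgn m p i) (E_tot m p l i i v)
       - cscale (psgn m p (i + 1)) (E_tot m p l (i + 1) (i + 1) v))"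
    and "rho (ycl (yX Plus i 0)) (tens x v) = tens x (E_tot m p l i (i + 1) v)"
    and "rho (ycl (yX Minus i 0)) (tens x v) = psgn m p i \<odot>\<^bsub>V.Q\<^esub> tens x (E_tot m p l (i + 1) i v)"
    and "rho (ycl (J_h m n p c i)) (tens x v) = (\<Oplus>\<^bsub>V.Q\<^esub>k\<in>{1..l}. tens (act x (cl (frak_y l t c k)))
       (cscale (psgn m p i) (E_at m p i i k v) - cscale (psgn m p (i + 1)) (E_at m p (i + 1) (i + 1) k v)))"
    and "rho (ycl (J_x_plus m n p c i)) (tens x v)
       = (\<Oplus>\<^bsub>V.Q\<^esub>k\<in>{1..l}. tens (act x (cl (frak_y l t c k))) (E_at m p i (i + 1) k v))"
    and "rho (ycl (J_x_minus m n p c i)) (tens x v)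
       = psgn m p i \<odot>\<^bsub>V.Q\<^esub> (\<Oplus>\<^bsub>V.Q\<^esub>k\<in>{1..l}. tens (act x (cl (frak_y l t c k))) (E_at m p (i + 1) i k v))"
proof -
  have i': "i \<in> {1..m + n}" "i + 1 \<in> {1..m + n}" using node_range[OF i] by auto
  have sg: "gl.sg k * A = smul (psgn m p k) A" for k A by (simp add: gl.sg_def psgn_def smul_sign)
  note tot = E_tot_closed[OF i'(1) v] E_tot_closed[OF i'(2) v]
  note at = Eop_closed[OF i'(1) v] Eop_closed[OF i'(2) v]
  have good: "gl.h i \<in> good" "gl.xp i \<in> good" "gl.xm i \<in> good" "gl.jh i \<in> good" "gl.jp i \<in> good" "gl.jm i \<in> good"
    unfolding gl.h_def gl.xp_def gl.xm_def gl.jh_def gl.jp_def gl.jm_def by (intro good_closed E_act_good J_act_good)+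
  have y: "ract x (frak_y l t c k) \<in> carrier M" if "k \<in> {1..l}" for k using that x by simp
  \<comment> \<open>Each formal tensor may be replaced by its projection inside a coset, which turns
    the finite sum in the quotient into the coset of an ordinary sum.\<close>
  have fin: "(\<Oplus>\<^bsub>V.Q\<^esub>k\<in>{1..l}. V.coset (Poly_Mapping.single (ract x (frak_y l t c k), f k) 1))
      = V.coset (\<Sum>k = 1..l. tau (ract x (frak_y l t c k)) (f k))" if f: "\<And>k. f k \<in> N" for f
  proof -
    have tF: "tau (ract x (frak_y l t c k)) (f k) \<in> V.Fr" if "k \<in> {1..l}" for k
      by (rule tau_in_subspace) (use that y f V.rel_closed in \<open>auto simp: free_space_subspace\<close>)
    have "(\<Oplus>\<^bsub>V.Q\<^esub>k\<in>{1..l}. V.coset (tau (ract x (frak_y l t c k)) (f k)))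
        = V.coset (\<Sum>k = 1..l. tau (ract x (frak_y l t c k)) (f k))"
      by (rule V.coset_finsum) (simp, rule tF)
    then show ?thesis by (simp only: coset_tau)
  qed
  note gens = YF_gens[OF i] YF_J[OF i]
  show "rho (ycl (yH i 0)) (tens x v) = tens x (cscale (psgn m p i) (E_tot m p l i i v)
       - cscale (psgn m p (i + 1)) (E_tot m p l (i + 1) (i + 1) v))"
    using rho_tensor[OF gens(1) _ x v] good(1) i' x v tot
    by (simp add: tens_def SW_tensor_eq gl.h_def sg E_act_tau coset_tau tau_diff_right tau_smult_right tensor_power_closed)
  show "rho (ycl (yX Plus i 0)) (tens x v) = tens x (E_tot m p l i (i + 1) v)"
    using rho_tensor[OF gens(2)[of Plus] _ x v] good(2) i' x v
    by (simp add: tens_def SW_tensor_eq gl.xp_def E_act_tau coset_tau)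
  show "rho (ycl (yX Minus i 0)) (tens x v) = psgn m p i \<odot>\<^bsub>V.Q\<^esub> tens x (E_tot m p l (i + 1) i v)"
    using rho_tensor[OF gens(2)[of Minus] _ x v] good(3) i' x v
    by (simp add: tens_def SW_tensor_eq gl.xm_def sg E_act_tau coset_tau V.coset_smult)
  show "rho (ycl (J_h m n p c i)) (tens x v) = (\<Oplus>\<^bsub>V.Q\<^esub>k\<in>{1..l}. tens (act x (cl (frak_y l t c k)))
       (cscale (psgn m p i) (E_at m p i i k v) - cscale (psgn m p (i + 1)) (E_at m p (i + 1) (i + 1) k v)))"
    unfolding tens_def SW_tensor_eq ract_def[symmetric] E_at_op
    using rho_tensor[OF gens(5) _ x v] good(4) i' x v at y
    by (simp add: fin[unfolded One_nat_def] evp_J[OF i] gl.jh_def sg J_act_tau tau_diff_right tau_smult_right tensor_power_closed cscale_sum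
        sum_subtractf)
  show "rho (ycl (J_x_plus m n p c i)) (tens x v)
       = (\<Oplus>\<^bsub>V.Q\<^esub>k\<in>{1..l}. tens (act x (cl (frak_y l t c k))) (E_at m p i (i + 1) k v))"
    unfolding tens_def SW_tensor_eq ract_def[symmetric] E_at_op
    using rho_tensor[OF gens(6) _ x v] good(5) i' x v at
    by (simp add: fin[unfolded One_nat_def] evp_J[OF i] gl.jp_def J_act_tau)
  show "rho (ycl (J_x_minus m n p c i)) (tens x v)
       = psgn m p i \<odot>\<^bsub>V.Q\<^esub> (\<Oplus>\<^bsub>V.Q\<^esub>k\<in>{1..l}. tens (act x (cl (frak_y l t c k))) (E_at m p (i + 1) i k v))"
    unfolding tens_def SW_tensor_eq ract_def[symmetric] E_at_op
    using rho_tensor[OF gens(7) _ x v] good(6) i' x v at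
    by (simp add: fin[unfolded One_nat_def] evp_J[OF i] gl.jm_def sg J_act_tau V.coset_smult)
qed

end

text \<open>For a fixed algebra element the vectors on which both actions agree form a subspace
  upstairs, so pure tensors suffice; the algebra elements with agreement everywhere form a
  subalgebra, so generators suffice.\<close>

lemma action_unique:
  assumes f1: "\<rho>1 \<in> carrier Y \<rightarrow>\<^sub>E (carrier V.Q \<rightarrow>\<^sub>E carrier V.Q)" and f2: "\<rho>2 \<in> carrier Y \<rightarrow>\<^sub>E (carrier V.Q \<rightarrow>\<^sub>E carrier V.Q)"
    and m1: "left_algebra_module Y V.Q \<rho>1" and m2: "left_algebra_module Y V.Q \<rho>2"
    and eq: "\<And>i x v f. \<lbrakk>i \<in> {1..m + n - 1}; x \<in> carrier M; v \<in> N;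
        f \<in> {yH i 0, yX Plus i 0, yX Minus i 0, J_h m n p c i, J_x_plus m n p c i, J_x_minus m n p c i}\<rbrakk>
      \<Longrightarrow> \<rho>1 (ycl f) (SW_tensor m n p l t c M act x v) = \<rho>2 (ycl f) (SW_tensor m n p l t c M act x v)"
  shows "\<rho>1 = \<rho>2"
proof -
  interpret m1: left_algebra_module Y V.Q \<rho>1 by fact
  interpret m2: left_algebra_module Y V.Q \<rho>2 by fact
  define D where "D = {f \<in> YF. \<forall>x\<in>carrier V.Q. \<rho>1 (ycl f) x = \<rho>2 (ycl f) x}"
  note cY = ycl_closed
  have add: "f + g \<in> D" and mult: "f * g \<in> D" if "f \<in> D" "g \<in> D" for f g
    using that m2.act_closed[OF cY]
    by (auto simp: D_def YF_closed cY m1.act_add_left m2.act_add_left m1.act_mult m2.act_mult simp flip: ycl_add_mult)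
  have scale: "cscale k f \<in> D" if "f \<in> D" for k f
    using that
    by (auto simp: D_def YF_closed cY m1.act_smult_left m2.act_smult_left simp flip: ycl_scale)
  have one: "1 \<in> D"
    using m1.act_one m2.act_one YF_closed(2) by (auto simp: D_def simp flip: ycl_one)
  have zero: "0 \<in> D" using scale[OF one, of 0] by (simp add: cscale_simps)
  have D: "f \<in> D" if f: "f \<in> YF"
    and T: "\<And>x v. x \<in> carrier M \<Longrightarrow> v \<in> N \<Longrightarrow> \<rho>1 (ycl f) (SW_tensor m n p l t c M act x v) = \<rho>2 (ycl f) (SW_tensor m n p l t c M act x v)"
    for f
  proof -
    have "cvec.subspace {u \<in> V.Fr. \<rho>1 (ycl f) (V.coset u) = \<rho>2 (ycl f) (V.coset u)}"
      unfolding cvec.subspace_def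
    proof (intro conjI ballI allI)
      \<comment> \<open>That both actions send zero to zero is read off from homogeneity with the
        scalar 0.\<close>
      have "0 \<odot>\<^bsub>V.Q\<^esub> x = V.coset 0" if "x \<in> carrier V.Q" for x
        using that by (auto elim!: V.carrier_QE simp: V.coset_smult cscale_simps)
      then show "0 \<in> {u \<in> V.Fr. \<rho>1 (ycl f) (V.coset u) = \<rho>2 (ycl f) (V.coset u)}"
        using V.coset_in_carrier[OF V.Fr_closed(1)] m1.act_smult_right[OF cY[OF f], of "V.coset 0" 0]
          m2.act_smult_right[OF cY[OF f], of "V.coset 0" 0] m1.act_closed[OF cY[OF f]] m2.act_closed[OF cY[OF f]]
        by (simp add: V.Fr_closed del: free_space_simps)
    qed (auto simp: V.Fr_closed m1.act_add_right m2.act_add_right m1.act_smult_right m2.act_smult_right cY f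
        simp flip: V.coset_add V.coset_smult simp del: free_space_simps)
    moreover have "(\<lambda>q. Poly_Mapping.single q 1) ` (carrier M \<times> N) \<subseteq> {u \<in> V.Fr. \<rho>1 (ycl f) (V.coset u) = \<rho>2 (ycl f) (V.coset u)}"
      using T single_Fr[of _ _ 1] by (auto simp: SW_tensor_eq simp del: free_space_simps)
    ultimately have "cvec.span ((\<lambda>q. Poly_Mapping.single q (1 :: complex)) ` (carrier M \<times> N))
        \<subseteq> {u \<in> V.Fr. \<rho>1 (ycl f) (V.coset u) = \<rho>2 (ycl f) (V.coset u)}"
      by (intro cvec.span_minimal)
    then have "V.Fr \<subseteq> {u \<in> V.Fr. \<rho>1 (ycl f) (V.coset u) = \<rho>2 (ycl f) (V.coset u)}"
      unfolding free_space_simps(1) free_space_span .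
    then show ?thesis using f unfolding D_def by (auto elim!: V.carrier_QE simp del: free_space_simps)
  qed
  have base: "yH i 0 \<in> D" "yX e i 0 \<in> D" "J_h m n p c i \<in> D" "J_x_plus m n p c i \<in> D" "J_x_minus m n p c i \<in> D"
    if "i \<in> {1..m + n - 1}" for i e
  proof -
    show "yH i 0 \<in> D" by (rule D[OF YF_gens(1)[OF that]]) (rule eq[OF that], auto)
    show "yX e i 0 \<in> D" by (rule D[OF YF_gens(2)[OF that]]) (rule eq[OF that], assumption, assumption, cases e, auto)
    show "J_h m n p c i \<in> D" by (rule D[OF YF_J(1)[OF that]]) (rule eq[OF that], auto)
    show "J_x_plus m n p c i \<in> D" by (rule D[OF YF_J(2)[OF that]]) (rule eq[OF that], auto)
    show "J_x_minus m n p c i \<in> D" by (rule D[OF YF_J(3)[OF that]]) (rule eq[OF that], auto)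
  qed
  note J = subalgebra_J[of D m n, OF add mult scale zero base(1,2)]
  have "f \<in> D" if "f \<in> YF" for f
    using that
  proof (induction rule: free_algebra_induct)
    case (gen g)
    then obtain i e r where "i \<in> {1..m + n - 1}" "r \<in> {0, 1}" "g = YX e i r \<or> g = YH i r"
      unfolding ygens_def by blast
    then show ?case
      using base[of i] J[of i p c] by (cases e) auto
  qed (use one add mult scale in auto)
  then have "\<rho>1 (ycl f) x = \<rho>2 (ycl f) x" if "f \<in> YF" "x \<in> carrier V.Q" for f x
    using that unfolding D_def by blast
  then show ?thesis
    by (intro PiE_ext[OF f1 f2] PiE_ext[OF PiE_mem[OF f1] PiE_mem[OF f2]]) (auto elim!: YE)
qed

end

theorem theorem5p13:
  fixes m n l p :: nat and t lam :: complex
    and M :: "(complex, 'm) module" and act :: "'m \<Rightarrow> dgen free_alg set \<Rightarrow> 'm"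
  assumes "m \<ge> 2" and "n \<ge> 2" and "m \<noteq> n" and "l \<ge> 1" and "p \<le> n"
    and "right_algebra_module (daha l t lam) M act"
  shows
    "let Y = yangian m n p lam;
         V = SW_space m n p l t lam M act;
         T = SW_tensor m n p l t lam M act;
         cl = yangian_class m n p lam;
         y = (\<lambda>k. daha_class l t lam (frak_y l t lam k))
     in \<exists>!\<rho>. \<rho> \<in> carrier Y \<rightarrow>\<^sub>E (carrier V \<rightarrow>\<^sub>E carrier V)
       \<and> left_superalgebra_module Y (yangian_part m n p lam) V (SW_part m n p l t lam M act) \<rho>
       \<and> (\<forall>i\<in>{1..m + n - 1}. \<forall>x\<in>carrier M. \<forall>v\<in>carrier (tensor_power m n l).
            \<rho> (cl (yH i 0)) (T x v)
              = T x (cscale (psgn m p i) (E_tot m p l i i v)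
                     - cscale (psgn m p (i + 1)) (E_tot m p l (i + 1) (i + 1) v))
          \<and> \<rho> (cl (yX Plus i 0)) (T x v) = T x (E_tot m p l i (i + 1) v)
          \<and> \<rho> (cl (yX Minus i 0)) (T x v) = psgn m p i \<odot>\<^bsub>V\<^esub> T x (E_tot m p l (i + 1) i v)
          \<and> \<rho> (cl (J_h m n p lam i)) (T x v)
              = (\<Oplus>\<^bsub>V\<^esub>k\<in>{1..l}. T (act x (y k))
                   (cscale (psgn m p i) (E_at m p i i k v)
                    - cscale (psgn m p (i + 1)) (E_at m p (i + 1) (i + 1) k v)))
          \<and> \<rho> (cl (J_x_plus m n p lam i)) (T x v)
              = (\<Oplus>\<^bsub>V\<^esub>k\<in>{1..l}. T (act x (y k)) (E_at m p i (i + 1) k v))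
          \<and> \<rho> (cl (J_x_minus m n p lam i)) (T x v)
              = psgn m p i \<odot>\<^bsub>V\<^esub> (\<Oplus>\<^bsub>V\<^esub>k\<in>{1..l}. T (act x (y k)) (E_at m p (i + 1) i k v)))"
proof -
  interpret schur_weyl l t lam M act m n p
    by (rule schur_weyl.intro, rule daha_right_module.intro, fact)
  let ?y = "\<lambda>k. daha_class l t lam (frak_y l t lam k)"
  note ext = rho_funcset[OF \<open>m \<ge> 2\<close>] and sm = rho_supermodule[OF \<open>m \<ge> 2\<close>] and formulas = rho_formulas[OF \<open>m \<ge> 2\<close>]
  show ?thesis
    unfolding Let_def SW_space_eq
  proof (rule ex1I[of _ rho], intro conjI ballI)
    fix \<rho>
    assume *: "\<rho> \<in> carrier Y \<rightarrow>\<^sub>E (carrier V.Q \<rightarrow>\<^sub>E carrier V.Q)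
       \<and> left_superalgebra_module Y (yangian_part m n p lam) V.Q (SW_part m n p l t lam M act) \<rho>
       \<and> (\<forall>i\<in>{1..m + n - 1}. \<forall>x\<in>carrier M. \<forall>v\<in>carrier (tensor_power m n l).
            \<rho> (ycl (yH i 0)) (SW_tensor m n p l t lam M act x v)
              = SW_tensor m n p l t lam M act x (cscale (psgn m p i) (E_tot m p l i i v)
                     - cscale (psgn m p (i + 1)) (E_tot m p l (i + 1) (i + 1) v))
          \<and> \<rho> (ycl (yX Plus i 0)) (SW_tensor m n p l t lam M act x v) = SW_tensor m n p l t lam M act x (E_tot m p l i (i + 1) v)
          \<and> \<rho> (ycl (yX Minus i 0)) (SW_tensor m n p l t lam M act x v)
              = psgn m p i \<odot>\<^bsub>V.Q\<^esub> SW_tensor m n p l t lam M act x (E_tot m p l (i + 1) i v)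
          \<and> \<rho> (ycl (J_h m n p lam i)) (SW_tensor m n p l t lam M act x v)
              = (\<Oplus>\<^bsub>V.Q\<^esub>k\<in>{1..l}. SW_tensor m n p l t lam M act (act x (?y k))
                   (cscale (psgn m p i) (E_at m p i i k v)
                    - cscale (psgn m p (i + 1)) (E_at m p (i + 1) (i + 1) k v)))
          \<and> \<rho> (ycl (J_x_plus m n p lam i)) (SW_tensor m n p l t lam M act x v)
              = (\<Oplus>\<^bsub>V.Q\<^esub>k\<in>{1..l}. SW_tensor m n p l t lam M act (act x (?y k)) (E_at m p i (i + 1) k v))
          \<and> \<rho> (ycl (J_x_minus m n p lam i)) (SW_tensor m n p l t lam M act x v)
              = psgn m p i \<odot>\<^bsub>V.Q\<^esub> (\<Oplus>\<^bsub>V.Q\<^esub>k\<in>{1..l}. SW_tensor m n p l t lam M act (act x (?y k)) (E_at m p (i + 1) i k v)))"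
    show "\<rho> = rho"
    proof (rule action_unique)
      show "\<rho> \<in> carrier Y \<rightarrow>\<^sub>E (carrier V.Q \<rightarrow>\<^sub>E carrier V.Q)" "left_algebra_module Y V.Q \<rho>"
        using * left_superalgebra_module.axioms(1) by blast+
      fix i x v f
      assume i: "i \<in> {1..m + n - 1}" and x: "x \<in> carrier M" and v: "v \<in> N"
        and "f \<in> {yH i 0, yX Plus i 0, yX Minus i 0, J_h m n p lam i, J_x_plus m n p lam i, J_x_minus m n p lam i}"
      then show "\<rho> (ycl f) (SW_tensor m n p l t lam M act x v) = rho (ycl f) (SW_tensor m n p l t lam M act x v)"
        using formulas[OF i x v] conjunct2[OF conjunct2[OF *], rule_format, OF i x v]
        by (elim insertE emptyE; simp only:)
    qed (rule ext, rule rho_module[OF \<open>m \<ge> 2\<close>])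
  qed (rule ext sm formulas; assumption)+
qed

end
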